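(* There is no functor $\boldsymbol{\Sigma}^{\mathrm{top}}:\mathbf{SpinMfds}\to\mathbf{VB}$ such that $$\mathbf{forget}\circ\boldsymbol\Sigma=\boldsymbol\Sigma^{\mathrm{top}}\circ\mathbf{MetrTop}:\mathbf{RiemSpinMf}\to\mathbf{VB}\qquad\text{and}\qquad \mathbf{pr}\circ\boldsymbol\Sigma^{\mathrm{top}}=\mathbf{forget}:\mathbf{SpinMfds}\to\mathbf{Mfds}.$$
   Context: Fix the dimension $m$; let $\vartheta_m:\widetilde{\mathrm{GL}}{}^+_m\to\mathrm{GL}^+_m$ be the non-trivial (connected) double covering group, $\mathrm{Spin}_m=\vartheta_m^{-1}(\mathrm{SO}_m)$, and $\rho:\mathrm{Spin}_m\to\mathrm{GL}(\Sigma_m)$ the complex spinor representation. $\mathbf{SpinMfds}$: objects are pairs $(M,\Theta)$ with $M$ an oriented smooth $m$-manifold and $\Theta:\widetilde{\mathrm{GL}}{}^+M\to\mathrm{GL}^+M$ a topological spin structure (a principal $\widetilde{\mathrm{GL}}{}^+_m$-bundle with a $\vartheta_m$-equivariant 2:1 covering of the bundle of oriented frames); morphisms are pairs $(f,\tilde F)$ with $f:M_1\to M_2$ an orientation-preserving diffeomorphism and $\tilde F:\widetilde{\mathrm{GL}}{}^+M_1\to\widetilde{\mathrm{GL}}{}^+M_2$ a lift with $\Theta_2\circ\tilde F=df\circ\Theta_1$. $\mathbf{RiemSpinMf}$: objects are triples $(M,g,\Theta^g)$ with $g$ a Riemannian metric on the smooth $m$-manifold $M$ and $\Theta^g:\mathrm{Spin}^gM\to\mathrm{SO}^gM$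 a metric spin structure; morphisms are pairs $(f,\tilde F)$ with $f$ an orientation-preserving isometric diffeomorphism and $\tilde F:\mathrm{Spin}^{g_1}M_1\to\mathrm{Spin}^{g_2}M_2$ a lift of $df$, $\Theta_2\circ\tilde F=df\circ\Theta_1$. $\mathbf{DiracBdl}$ is the category of generalized Dirac bundles (a complex vector bundle $S\to N$ with metric and metric connection, a real metric vector bundle $E\to N$ with metric connection, and a compatible Clifford multiplication $E\otimes S\to S$; morphisms are bundle maps on $S$ and $E$ over a common smooth base map preserving all structures). $\mathbf{VB}$ is the category of vector bundles, $\mathbf{Mfds}$ the category of smooth manifolds. Functors: $\boldsymbol\Sigma:\mathbf{RiemSpinMf}\to\mathbf{DiracBdl}$ sends $(M,g,\Theta^g)$ to the spinor bundle $\Sigma^gM=\mathrm{Spin}^gM\times_\rho\Sigma_m$ with its usual metric, connection and Clifford multiplication by $E=TM$, and $(f,\tilde F)$ to $(f,df,\bar F)$ with $\bar F:[\tilde b,v]\mapsto[\tilde F(\tilde b),v]$. $\mathbf{MetrTop}:\mathbf{RiemSpinMf}\to\mathbf{SpinMfds}$ replaces a metric spin structure by the topological one (extension of the structure group along $\mathrm{SO}_m\hookrightarrow\mathrm{GL}^+_m$, respectively $\mathrm{Spin}_m\hookrightarrow\widetilde{\mathrm{GL}}{}^+_m$). $\mathbf{forget}$ forgets all structure except that of the vector bundle $S\to N$ ($\mathbf{DiracBdl}\to\mathbf{VB}$), respectively of the manifold ($\mathbf{SpinMfds}\to\mathbf{Mfds}$). $\mathbf{pr}:\mathbf{VB}\to\mathbf{Mfds}$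 sends a vector bundle to its base. *)

theory Defs
  imports "HOL-Analysis.Analysis" "HOL-Algebra.Group" "Jordan_Normal_Form.Determinant"
begin

section \<open>Categories and functors\<close>

text \<open>Morphisms do not carry their source and target, so composition, identities and the
  morphism part of a functor take the objects involved as arguments.\<close>

record ('o, 'f) cat =
  Ob :: "'o set"
  Hom :: "'o \<Rightarrow> 'o \<Rightarrow> 'f set"
  Ide :: "'o \<Rightarrow> 'f"
  Cmp :: "'o \<Rightarrow> 'o \<Rightarrow> 'o \<Rightarrow> 'f \<Rightarrow> 'f \<Rightarrow> 'f"

record ('o1, 'f1, 'o2, 'f2) funct =
  omap :: "'o1 \<Rightarrow> 'o2"
  mmap :: "'o1 \<Rightarrow> 'o1 \<Rightarrow> 'f1 \<Rightarrow> 'f2"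

definition is_functor ::
  "('o1, 'f1) cat \<Rightarrow> ('o2, 'f2) cat \<Rightarrow> ('o1, 'f1, 'o2, 'f2) funct \<Rightarrow> bool" where
  "is_functor C D F \<longleftrightarrow>
     (\<forall>A\<in>Ob C. omap F A \<in> Ob D) \<and>
     (\<forall>A\<in>Ob C. \<forall>B\<in>Ob C. \<forall>f\<in>Hom C A B. mmap F A B f \<in> Hom D (omap F A) (omap F B)) \<and>
     (\<forall>A\<in>Ob C. mmap F A A (Ide C A) = Ide D (omap F A)) \<and>
     (\<forall>A\<in>Ob C. \<forall>B\<in>Ob C. \<forall>E\<in>Ob C. \<forall>f\<in>Hom C A B. \<forall>g\<in>Hom C B E.
        mmap F A E (Cmp C A B E g f) =
        Cmp D (omap F A) (omap F B) (omap F E) (mmap F B E g) (mmap F A B f))"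

definition funct_comp ::
  "('o2, 'f2, 'o3, 'f3) funct \<Rightarrow> ('o1, 'f1, 'o2, 'f2) funct \<Rightarrow> ('o1, 'f1, 'o3, 'f3) funct"
  (infixl \<open>\<circ>\<^sub>F\<close> 55) where
  "G \<circ>\<^sub>F F =
     \<lparr>omap = (\<lambda>A. omap G (omap F A)),
      mmap = (\<lambda>A B f. mmap G (omap F A) (omap F B) (mmap F A B f))\<rparr>"

definition funct_eq ::
  "('o1, 'f1) cat \<Rightarrow> ('o1, 'f1, 'o2, 'f2) funct \<Rightarrow> ('o1, 'f1, 'o2, 'f2) funct \<Rightarrow> bool" where
  "funct_eq C F G \<longleftrightarrow>
     (\<forall>A\<in>Ob C. omap F A = omap G A) \<and>
     (\<forall>A\<in>Ob C. \<forall>B\<in>Ob C. \<forall>f\<in>Hom C A B. mmap F A B f = mmap G A B f)"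

section \<open>General topology\<close>

definition quotient_top :: "'x topology \<Rightarrow> ('x \<Rightarrow> 'y) \<Rightarrow> 'y topology" where
  "quotient_top X q =
     topology (\<lambda>W. W \<subseteq> q ` topspace X \<and> openin X {x \<in> topspace X. q x \<in> W})"

definition double_covering :: "'x topology \<Rightarrow> 'y topology \<Rightarrow> ('x \<Rightarrow> 'y) \<Rightarrow> bool" where
  "double_covering X Y p \<longleftrightarrow> continuous_map X Y p \<and>
     (\<forall>y\<in>topspace Y. \<exists>U V1 V2. openin Y U \<and> y \<in> U \<and> openin X V1 \<and> openin X V2 \<and>
        V1 \<inter> V2 = {} \<and> {x \<in> topspace X. p x \<in> U} = V1 \<union> V2 \<and>
        homeomorphic_map (subtopology X V1) (subtopology Y U) p \<and>
        homeomorphic_map (subtopology X V2) (subtopology Y U) p)"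

definition vec_top :: "nat \<Rightarrow> 'k::topological_space Matrix.vec topology" where
  "vec_top n = pullback_topology (carrier_vec n) (\<lambda>v. \<lambda>i\<in>{..<n}. vec_index v i)
     (product_topology (\<lambda>_. euclidean) {..<n})"

definition mat_top :: "nat \<Rightarrow> 'k::topological_space Matrix.mat topology" where
  "mat_top n = pullback_topology (carrier_mat n n) (\<lambda>A. \<lambda>ij\<in>{..<n}\<times>{..<n}. A $$ ij)
     (product_topology (\<lambda>_. euclidean) ({..<n}\<times>{..<n}))"

definition topological_group :: "'h monoid \<Rightarrow> 'h topology \<Rightarrow> bool" where
  "topological_group G T \<longleftrightarrow> group G \<and> topspace T = carrier G \<and>
     continuous_map (prod_topology T T) T (\<lambda>(x, y). x \<otimes>\<^bsub>G\<^esub> y) \<and>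
     continuous_map T T (\<lambda>x. inv\<^bsub>G\<^esub> x)"

definition principal_bundle ::
  "'h monoid \<Rightarrow> 'h topology \<Rightarrow> 'x topology \<Rightarrow> 'p topology \<Rightarrow> ('p \<Rightarrow> 'h \<Rightarrow> 'p) \<Rightarrow> ('p \<Rightarrow> 'x) \<Rightarrow> bool"
  where
  "principal_bundle G T X P act \<pi> \<longleftrightarrow>
     continuous_map P X \<pi> \<and>
     continuous_map (prod_topology P T) P (\<lambda>(b, h). act b h) \<and>
     (\<forall>b\<in>topspace P. act b \<one>\<^bsub>G\<^esub> = b \<and>
        (\<forall>h\<in>carrier G. \<pi> (act b h) = \<pi> b \<and>
           (\<forall>k\<in>carrier G. act (act b h) k = act b (h \<otimes>\<^bsub>G\<^esub> k)))) \<and>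
     (\<forall>x\<in>topspace X. \<exists>U \<psi>. openin X U \<and> x \<in> U \<and>
        homeomorphic_map (subtopology P {b \<in> topspace P. \<pi> b \<in> U})
          (prod_topology (subtopology X U) T) \<psi> \<and>
        (\<forall>b\<in>topspace P. \<pi> b \<in> U \<longrightarrow> fst (\<psi> b) = \<pi> b \<and>
           (\<forall>h\<in>carrier G. \<psi> (act b h) = (\<pi> b, snd (\<psi> b) \<otimes>\<^bsub>G\<^esub> h))))"

section \<open>Smooth manifolds\<close>

text \<open>Points of \<open>\<real>\<^sup>n\<close> are sequences vanishing from index \<open>n\<close> on, so that the
  dimension is an ordinary natural number.  \<open>Rn_Ck\<close> and \<open>Rn_smooth\<close> are meant for \<open>U\<close> open in
  \<open>Euclidean_space n\<close>; smoothness is existence and continuity of all iterated partial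
  derivatives.\<close>

definition partial :: "nat \<Rightarrow> ((nat \<Rightarrow> real) \<Rightarrow> real) \<Rightarrow> (nat \<Rightarrow> real) \<Rightarrow> real" where
  "partial i f x = deriv (\<lambda>t. f (x(i := t))) (x i)"

primrec Rn_Ck :: "nat \<Rightarrow> nat \<Rightarrow> (nat \<Rightarrow> real) set \<Rightarrow> ((nat \<Rightarrow> real) \<Rightarrow> real) \<Rightarrow> bool" where
  "Rn_Ck 0 n U f \<longleftrightarrow> continuous_map (subtopology (Euclidean_space n) U) euclideanreal f"
| "Rn_Ck (Suc k) n U f \<longleftrightarrow>
     continuous_map (subtopology (Euclidean_space n) U) euclideanreal f \<and>
     (\<forall>i<n. (\<forall>x\<in>U. (\<lambda>t. f (x(i := t))) field_differentiable (at (x i))) \<and>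
            Rn_Ck k n U (partial i f))"

definition Rn_smooth :: "nat \<Rightarrow> (nat \<Rightarrow> real) set \<Rightarrow> ((nat \<Rightarrow> real) \<Rightarrow> real) \<Rightarrow> bool" where
  "Rn_smooth n U f \<longleftrightarrow> (\<forall>k. Rn_Ck k n U f)"

definition Rn_smooth_map ::
  "nat \<Rightarrow> (nat \<Rightarrow> real) set \<Rightarrow> ((nat \<Rightarrow> real) \<Rightarrow> nat \<Rightarrow> real) \<Rightarrow> bool" where
  "Rn_smooth_map n U h \<longleftrightarrow> (\<forall>i. Rn_smooth n U (\<lambda>x. h x i))"

definition jac :: "nat \<Rightarrow> ((nat \<Rightarrow> real) \<Rightarrow> nat \<Rightarrow> real) \<Rightarrow> (nat \<Rightarrow> real) \<Rightarrow> (nat \<Rightarrow> real) \<Rightarrow> nat \<Rightarrow> real"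
  where "jac n h x w = (\<lambda>i. \<Sum>j<n. partial j (\<lambda>y. h y i) x * w j)"

definition jac_mat :: "nat \<Rightarrow> ((nat \<Rightarrow> real) \<Rightarrow> nat \<Rightarrow> real) \<Rightarrow> (nat \<Rightarrow> real) \<Rightarrow> real Matrix.mat" where
  "jac_mat n h x = Matrix.mat n n (\<lambda>(i, j). partial j (\<lambda>y. h y i) x)"

definition join :: "nat \<Rightarrow> (nat \<Rightarrow> real) \<Rightarrow> (nat \<Rightarrow> real) \<Rightarrow> nat \<Rightarrow> real" where
  "join n x y = (\<lambda>i. if i < n then x i else y (i - n))"

type_synonym 'a chart = "'a set \<times> ('a \<Rightarrow> nat \<Rightarrow> real)"

record 'a manifold =
  mtop :: "'a topology"
  atlas :: "'a chart set"
  mdim :: nat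

abbreviation points :: "'a manifold \<Rightarrow> 'a set" where
  "points M \<equiv> topspace (mtop M)"

abbreviation charts_at :: "'a manifold \<Rightarrow> 'a \<Rightarrow> 'a chart set" where
  "charts_at M p \<equiv> {c \<in> atlas M. p \<in> fst c}"

definition chart_inv :: "'a chart \<Rightarrow> (nat \<Rightarrow> real) \<Rightarrow> 'a" where
  "chart_inv c = inv_into (fst c) (snd c)"

definition is_chart :: "'a topology \<Rightarrow> nat \<Rightarrow> 'a chart \<Rightarrow> bool" where
  "is_chart X n c \<longleftrightarrow> openin X (fst c) \<and> snd c \<in> extensional (fst c) \<and>
     openin (Euclidean_space n) (snd c ` fst c) \<and>
     homeomorphic_map (subtopology X (fst c)) (subtopology (Euclidean_space n) (snd c ` fst c)) (snd c)"

definition local_rep :: "'a chart \<Rightarrow> ('a \<Rightarrow> 'b) \<Rightarrow> 'b chart \<Rightarrow> (nat \<Rightarrow> real) \<Rightarrow> nat \<Rightarrow> real" where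
  "local_rep c f c' = (\<lambda>x. snd c' (f (chart_inv c x)))"

definition compatible :: "nat \<Rightarrow> 'a chart \<Rightarrow> 'a chart \<Rightarrow> bool" where
  "compatible n c c' \<longleftrightarrow>
     Rn_smooth_map n (snd c ` (fst c \<inter> fst c')) (local_rep c (\<lambda>q. q) c') \<and>
     Rn_smooth_map n (snd c' ` (fst c \<inter> fst c')) (local_rep c' (\<lambda>q. q) c)"

definition max_atlas :: "'a topology \<Rightarrow> nat \<Rightarrow> 'a chart set \<Rightarrow> 'a chart set" where
  "max_atlas X n A = {c. is_chart X n c \<and> (\<forall>c'\<in>A. compatible n c c')}"

definition smooth_manifold :: "'a manifold \<Rightarrow> bool" where
  "smooth_manifold M \<longleftrightarrow> Hausdorff_space (mtop M) \<and> second_countable (mtop M) \<and>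
     (\<forall>p\<in>points M. charts_at M p \<noteq> {}) \<and>
     atlas M = max_atlas (mtop M) (mdim M) (atlas M)"

definition smooth_maps :: "'a manifold \<Rightarrow> 'b manifold \<Rightarrow> ('a \<Rightarrow> 'b) set" where
  "smooth_maps M N = {f \<in> extensional (points M). continuous_map (mtop M) (mtop N) f \<and>
     (\<forall>c\<in>atlas M. \<forall>c'\<in>atlas N.
        Rn_smooth_map (mdim M) (snd c ` {q \<in> fst c. f q \<in> fst c'}) (local_rep c f c'))}"

definition smooth_fun :: "'a manifold \<Rightarrow> ('a \<Rightarrow> real) \<Rightarrow> bool" where
  "smooth_fun M a \<longleftrightarrow> (\<forall>c\<in>atlas M. Rn_smooth (mdim M) (snd c ` fst c) (\<lambda>x. a (chart_inv c x)))"

text \<open>The points of a manifold form a subset of the type \<open>'a\<close>, which serves as universe; likewise for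
  total spaces of bundles below.  A type with at least continuum many elements contains
  a copy of every second countable manifold.\<close>

definition Mfds :: "('a manifold, 'a \<Rightarrow> 'a) cat" where
  "Mfds = \<lparr>Ob = {M. smooth_manifold M}, Hom = smooth_maps,
     Ide = (\<lambda>M. \<lambda>p\<in>points M. p),
     Cmp = (\<lambda>M N K g f. compose (points M) g f)\<rparr>"

subsection \<open>Tangent vectors, frames and orientations\<close>

text \<open>A tangent vector at \<open>p\<close> is the pair of \<open>p\<close> and the family of its coordinate vectors with
  respect to all charts around \<open>p\<close>, which transform by the Jacobians of the chart changes; the
  family is \<open>0\<close> at charts not containing \<open>p\<close>.\<close>

type_synonym 'a tvec = "'a \<times> ('a chart \<Rightarrow> nat \<Rightarrow> real)"

definition tangent :: "'a manifold \<Rightarrow> 'a \<Rightarrow> 'a tvec set" where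
  "tangent M p = {(q, v). q = p \<and>
     (\<forall>c. c \<notin> charts_at M p \<longrightarrow> v c = (\<lambda>_. 0)) \<and>
     (\<forall>c\<in>charts_at M p. v c \<in> topspace (Euclidean_space (mdim M))) \<and>
     (\<forall>c\<in>charts_at M p. \<forall>c'\<in>charts_at M p.
        v c' = jac (mdim M) (local_rep c (\<lambda>q. q) c') (snd c p) (v c))}"

definition tvec_of :: "'a manifold \<Rightarrow> 'a chart \<Rightarrow> 'a \<Rightarrow> (nat \<Rightarrow> real) \<Rightarrow> 'a tvec" where
  "tvec_of M c p w = (p, \<lambda>c'. if c' \<in> charts_at M p
     then jac (mdim M) (local_rep c (\<lambda>q. q) c') (snd c p) w else (\<lambda>_. 0))"

definition dmap :: "'a manifold \<Rightarrow> 'b manifold \<Rightarrow> ('a \<Rightarrow> 'b) \<Rightarrow> 'a tvec \<Rightarrow> 'b tvec" where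
  "dmap M N f = (\<lambda>(p, v). let c = (SOME c. c \<in> charts_at M p) in
     (f p, \<lambda>c'. if c' \<in> charts_at N (f p)
        then jac (mdim M) (local_rep c f c') (snd c p) (v c) else (\<lambda>_. 0)))"

definition dirderiv :: "'a manifold \<Rightarrow> 'a tvec \<Rightarrow> ('a \<Rightarrow> real) \<Rightarrow> real" where
  "dirderiv M = (\<lambda>(p, v) a. let c = (SOME c. c \<in> charts_at M p) in
     \<Sum>j<mdim M. partial j (\<lambda>x. a (chart_inv c x)) (snd c p) * v c j)"

text \<open>An orientation is a maximal oriented subatlas.\<close>

definition orientation :: "'a manifold \<Rightarrow> 'a chart set \<Rightarrow> bool" where
  "orientation M A \<longleftrightarrow>
     A \<subseteq> atlas M \<and> (\<forall>p\<in>points M. \<exists>c\<in>A. p \<in> fst c) \<and>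
     (\<forall>c\<in>atlas M. c \<in> A \<longleftrightarrow> (\<forall>c'\<in>A. \<forall>p\<in>fst c \<inter> fst c'.
        0 < Determinant.det (jac_mat (mdim M) (local_rep c (\<lambda>q. q) c') (snd c p))))"

text \<open>A frame is a point together with a basis of its tangent space, indexed by \<open>j < dim M\<close>
  (and padded by \<open>0\<close>).\<close>

type_synonym 'a frame = "'a \<times> (nat \<Rightarrow> 'a chart \<Rightarrow> nat \<Rightarrow> real)"

definition frame_mat :: "'a manifold \<Rightarrow> 'a chart \<Rightarrow> 'a frame \<Rightarrow> real Matrix.mat" where
  "frame_mat M c b = Matrix.mat (mdim M) (mdim M) (\<lambda>(i, j). snd b j c i)"

definition pos_frames :: "'a manifold \<Rightarrow> 'a chart set \<Rightarrow> 'a frame set" where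
  "pos_frames M A = {(p, B). p \<in> points M \<and>
     (\<forall>j<mdim M. (p, B j) \<in> tangent M p) \<and> (\<forall>j\<ge>mdim M. B j = (\<lambda>_ _. 0)) \<and>
     (\<forall>c\<in>A. p \<in> fst c \<longrightarrow> 0 < Determinant.det (frame_mat M c (p, B)))}"

definition frame_top :: "'a manifold \<Rightarrow> 'a chart set \<Rightarrow> 'a frame topology" where
  "frame_top M A = topology_generated_by
     {{b \<in> pos_frames M A. fst b \<in> fst c \<and> (fst b, frame_mat M c b) \<in> V} | c V.
        c \<in> atlas M \<and> openin (prod_topology (mtop M) (mat_top (mdim M))) V}"

definition frame_act :: "nat \<Rightarrow> 'a frame \<Rightarrow> real Matrix.mat \<Rightarrow> 'a frame" where
  "frame_act m b A =
     (fst b, \<lambda>j. if j < m then (\<lambda>c i. \<Sum>k<m. A $$ (k, j) * snd b k c i) else (\<lambda>_ _. 0))"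

definition frame_comb :: "nat \<Rightarrow> 'a frame \<Rightarrow> (nat \<Rightarrow> real) \<Rightarrow> 'a tvec" where
  "frame_comb m b x = (fst b, \<lambda>c i. \<Sum>k<m. x k * snd b k c i)"

definition dframe :: "'a manifold \<Rightarrow> 'b manifold \<Rightarrow> ('a \<Rightarrow> 'b) \<Rightarrow> 'a frame \<Rightarrow> 'b frame" where
  "dframe M N f b = (f (fst b), \<lambda>j. if j < mdim M
     then snd (dmap M N f (fst b, snd b j)) else (\<lambda>_ _. 0))"

definition oriented_diffeos ::
  "'a manifold \<Rightarrow> 'a chart set \<Rightarrow> 'b manifold \<Rightarrow> 'b chart set \<Rightarrow> ('a \<Rightarrow> 'b) set" where
  "oriented_diffeos M A N B = {f \<in> smooth_maps M N. bij_betw f (points M) (points N) \<and>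
     restrict (inv_into (points M) f) (points N) \<in> smooth_maps N M \<and>
     (\<forall>b\<in>pos_frames M A. dframe M N f b \<in> pos_frames N B)}"

definition riemannian_metric :: "'a manifold \<Rightarrow> ('a tvec \<Rightarrow> 'a tvec \<Rightarrow> real) \<Rightarrow> bool" where
  "riemannian_metric M g \<longleftrightarrow>
     (\<forall>p\<in>points M. \<forall>v w. (p, v) \<in> tangent M p \<longrightarrow> (p, w) \<in> tangent M p \<longrightarrow>
        g (p, v) (p, w) = g (p, w) (p, v) \<and>
        (v \<noteq> (\<lambda>_ _. 0) \<longrightarrow> 0 < g (p, v) (p, v)) \<and>
        (\<forall>u a. (p, u) \<in> tangent M p \<longrightarrow>
           g (p, \<lambda>c i. a * v c i + u c i) (p, w) = a * g (p, v) (p, w) + g (p, u) (p, w))) \<and>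
     (\<forall>c\<in>atlas M. \<forall>i<mdim M. \<forall>j<mdim M.
        Rn_smooth (mdim M) (snd c ` fst c)
          (\<lambda>x. g (tvec_of M c (chart_inv c x) (\<lambda>k. if k = i then 1 else 0))
                 (tvec_of M c (chart_inv c x) (\<lambda>k. if k = j then 1 else 0))))"

section \<open>Vector bundles\<close>

record ('a, 'e, 'k) vbundle =
  vbase :: "'a manifold"
  vtot :: "'e manifold"
  vproj :: "'e \<Rightarrow> 'a"
  vadd :: "'e \<Rightarrow> 'e \<Rightarrow> 'e"
  vscl :: "'k \<Rightarrow> 'e \<Rightarrow> 'e"

text \<open>The parameter \<open>\<kappa>\<close> below lists the real coordinates of a scalar; it is one of the following
  two functions, for real and complex vector bundles respectively.\<close>

definition real_co :: "real \<Rightarrow> real list" where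
  "real_co x = [x]"

definition complex_co :: "complex \<Rightarrow> real list" where
  "complex_co z = [Re z, Im z]"

definition flatten :: "('k::zero \<Rightarrow> real list) \<Rightarrow> (nat \<Rightarrow> 'k) \<Rightarrow> nat \<Rightarrow> real" where
  "flatten \<kappa> y = (\<lambda>i. let d = length (\<kappa> 0) in \<kappa> (y (i div d)) ! (i mod d))"

definition vfib :: "('a, 'e, 'k) vbundle \<Rightarrow> 'a \<Rightarrow> 'e set" where
  "vfib V p = {e \<in> points (vtot V). vproj V e = p}"

definition vpre :: "('a, 'e, 'k) vbundle \<Rightarrow> 'a set \<Rightarrow> 'e set" where
  "vpre V U = {e \<in> points (vtot V). vproj V e \<in> U}"

text \<open>Local triviality: over the domain of a chart \<open>c\<close> of the base there are fibrewise linear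
  isomorphisms \<open>\<phi>\<close> to \<open>\<K>\<^sup>r\<close> such that \<open>(c, \<phi>)\<close> is a chart of the total space.  This makes every
  fibre a vector space of dimension \<open>r\<close> and the projection a smooth submersion.\<close>

definition vector_bundle :: "('k::field \<Rightarrow> real list) \<Rightarrow> ('a, 'e, 'k) vbundle \<Rightarrow> bool" where
  "vector_bundle \<kappa> V \<longleftrightarrow>
     smooth_manifold (vbase V) \<and> smooth_manifold (vtot V) \<and>
     vproj V \<in> points (vtot V) \<rightarrow> points (vbase V) \<and>
     (\<forall>p\<in>points (vbase V). \<exists>c\<in>charts_at (vbase V) p. \<exists>r \<phi>.
        mdim (vtot V) = mdim (vbase V) + length (\<kappa> 0) * r \<and>
        (\<forall>q\<in>fst c. bij_betw \<phi> (vfib V q) {y. \<forall>i\<ge>r. y i = 0} \<and>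
           (\<forall>u\<in>vfib V q. \<forall>w\<in>vfib V q. vadd V u w \<in> vfib V q \<and>
              \<phi> (vadd V u w) = (\<lambda>i. \<phi> u i + \<phi> w i)) \<and>
           (\<forall>z. \<forall>u\<in>vfib V q. vscl V z u \<in> vfib V q \<and>
              \<phi> (vscl V z u) = (\<lambda>i. z * \<phi> u i))) \<and>
        (vpre V (fst c),
         \<lambda>e\<in>vpre V (fst c). join (mdim (vbase V)) (snd c (vproj V e)) (flatten \<kappa> (\<phi> e)))
          \<in> atlas (vtot V))"

definition bundle_maps ::
  "('a, 'e, 'k) vbundle \<Rightarrow> ('b, 'f, 'k) vbundle \<Rightarrow> (('a \<Rightarrow> 'b) \<times> ('e \<Rightarrow> 'f)) set" where
  "bundle_maps V W = {(f, F). f \<in> smooth_maps (vbase V) (vbase W) \<and>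
     F \<in> smooth_maps (vtot V) (vtot W) \<and>
     (\<forall>e\<in>points (vtot V). vproj W (F e) = f (vproj V e)) \<and>
     (\<forall>p\<in>points (vbase V). \<forall>u\<in>vfib V p.
        (\<forall>w\<in>vfib V p. F (vadd V u w) = vadd W (F u) (F w)) \<and>
        (\<forall>z. F (vscl V z u) = vscl W z (F u)))}"

definition VB :: "(('a, 'e, complex) vbundle, ('a \<Rightarrow> 'a) \<times> ('e \<Rightarrow> 'e)) cat" where
  "VB = \<lparr>Ob = {V. vector_bundle complex_co V}, Hom = bundle_maps,
     Ide = (\<lambda>V. (\<lambda>p\<in>points (vbase V). p, \<lambda>e\<in>points (vtot V). e)),
     Cmp = (\<lambda>V W X (g, G) (f, F). (compose (points (vbase V)) g f, compose (points (vtot V)) G F))\<rparr>"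

definition pr ::
  "(('a, 'e, complex) vbundle, ('a \<Rightarrow> 'a) \<times> ('e \<Rightarrow> 'e), 'a manifold, 'a \<Rightarrow> 'a) funct" where
  "pr = \<lparr>omap = vbase, mmap = (\<lambda>V W (f, F). f)\<rparr>"

subsection \<open>The tangent bundle\<close>

definition tangent_chart :: "'a manifold \<Rightarrow> 'a chart \<Rightarrow> 'a tvec chart" where
  "tangent_chart M c = (\<Union>p\<in>fst c. tangent M p,
     \<lambda>(p, v)\<in>(\<Union>p\<in>fst c. tangent M p). join (mdim M) (snd c p) (v c))"

definition tangent_top :: "'a manifold \<Rightarrow> 'a tvec topology" where
  "tangent_top M = topology_generated_by
     {{e \<in> fst (tangent_chart M c). snd (tangent_chart M c) e \<in> V} | c V.
        c \<in> atlas M \<and> openin (Euclidean_space (2 * mdim M)) V}"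

definition tangent_bundle :: "'a manifold \<Rightarrow> ('a, 'a tvec, real) vbundle" where
  "tangent_bundle M =
     \<lparr>vbase = M,
      vtot = \<lparr>mtop = tangent_top M,
        atlas = max_atlas (tangent_top M) (2 * mdim M) (tangent_chart M ` atlas M),
        mdim = 2 * mdim M\<rparr>,
      vproj = fst,
      vadd = (\<lambda>(p, v) (q, w). (p, \<lambda>c i. v c i + w c i)),
      vscl = (\<lambda>a (p, v). (p, \<lambda>c i. a * v c i))\<rparr>"

subsection \<open>Sections, bundle metrics and connections\<close>

definition sections :: "('a, 'e, 'k) vbundle \<Rightarrow> ('a \<Rightarrow> 'e) set" where
  "sections V = {s \<in> smooth_maps (vbase V) (vtot V). \<forall>p\<in>points (vbase V). vproj V (s p) = p}"

definition vzero :: "('a, 'e, 'k) vbundle \<Rightarrow> 'a \<Rightarrow> 'e" where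
  "vzero V p = (THE z. z \<in> vfib V p \<and> vadd V z z = z)"

text \<open>Linear combination, in the fibre over \<open>p\<close>, of a list of real coefficients and vectors.\<close>

definition lincomb ::
  "('a, 'e, 'k::real_algebra_1) vbundle \<Rightarrow> 'a \<Rightarrow> (real \<times> 'e) list \<Rightarrow> 'e" where
  "lincomb V p xs = foldr (\<lambda>(a, e) w. vadd V (vscl V (of_real a) e) w) xs (vzero V p)"

text \<open>\<open>cj\<close> is the conjugation of scalars: the identity for real, \<open>cnj\<close> for complex bundles.\<close>

definition bundle_metric ::
  "('k::real_normed_field \<Rightarrow> real list) \<Rightarrow> ('k \<Rightarrow> 'k) \<Rightarrow> ('a, 'e, 'k) vbundle \<Rightarrow> ('e \<Rightarrow> 'e \<Rightarrow> 'k) \<Rightarrow> bool"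
  where
  "bundle_metric \<kappa> cj V h \<longleftrightarrow>
     (\<forall>p\<in>points (vbase V). \<forall>u\<in>vfib V p. \<forall>w\<in>vfib V p.
        h u w = cj (h w u) \<and>
        (u \<noteq> vzero V p \<longrightarrow> (\<exists>a>0. h u u = of_real a)) \<and>
        (\<forall>z. h (vscl V z u) w = z * h u w) \<and>
        (\<forall>u'\<in>vfib V p. h (vadd V u u') w = h u w + h u' w)) \<and>
     (\<forall>s\<in>sections V. \<forall>t\<in>sections V. \<forall>k<length (\<kappa> 0).
        smooth_fun (vbase V) (\<lambda>p. \<kappa> (h (s p) (t p)) ! k))"

text \<open>A connection sends a tangent vector \<open>v\<close> at \<open>p\<close> and a section \<open>s\<close> to \<open>\<nabla>\<^sub>v s\<close> in the fibre
  over \<open>p\<close>.\<close>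

type_synonym ('a, 'e) conn = "'a tvec \<Rightarrow> ('a \<Rightarrow> 'e) \<Rightarrow> 'e"

definition connection :: "('a, 'e, 'k::real_algebra_1) vbundle \<Rightarrow> ('a, 'e) conn \<Rightarrow> bool" where
  "connection V D \<longleftrightarrow>
     (\<forall>p\<in>points (vbase V). \<forall>v. (p, v) \<in> tangent (vbase V) p \<longrightarrow> (\<forall>s\<in>sections V.
        D (p, v) s \<in> vfib V p \<and>
        (\<forall>a w. (p, w) \<in> tangent (vbase V) p \<longrightarrow>
           D (p, \<lambda>c i. a * v c i + w c i) s = vadd V (vscl V (of_real a) (D (p, v) s)) (D (p, w) s)) \<and>
        (\<forall>t\<in>sections V. D (p, v) (\<lambda>q\<in>points (vbase V). vadd V (s q) (t q)) =
           vadd V (D (p, v) s) (D (p, v) t)) \<and>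
        (\<forall>z. D (p, v) (\<lambda>q\<in>points (vbase V). vscl V z (s q)) = vscl V z (D (p, v) s)) \<and>
        (\<forall>a. smooth_fun (vbase V) a \<longrightarrow>
           D (p, v) (\<lambda>q\<in>points (vbase V). vscl V (of_real (a q)) (s q)) =
           vadd V (vscl V (of_real (dirderiv (vbase V) (p, v) a)) (s p))
                  (vscl V (of_real (a p)) (D (p, v) s))))) \<and>
     (\<forall>X\<in>sections (tangent_bundle (vbase V)). \<forall>s\<in>sections V.
        (\<lambda>q\<in>points (vbase V). D (X q) s) \<in> sections V)"

definition metric_connection ::
  "('k::real_normed_field \<Rightarrow> real list) \<Rightarrow> ('a, 'e, 'k) vbundle \<Rightarrow> ('e \<Rightarrow> 'e \<Rightarrow> 'k) \<Rightarrow> ('a, 'e) conn \<Rightarrow> bool"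
  where
  "metric_connection \<kappa> V h D \<longleftrightarrow> connection V D \<and>
     (\<forall>p\<in>points (vbase V). \<forall>v\<in>tangent (vbase V) p. \<forall>s\<in>sections V. \<forall>t\<in>sections V.
        \<forall>k<length (\<kappa> 0). dirderiv (vbase V) v (\<lambda>q. \<kappa> (h (s q) (t q)) ! k) =
          \<kappa> (h (D v s) (t p) + h (s p) (D v t)) ! k)"

text \<open>A bundle map \<open>(f, F)\<close> preserves connections if \<open>F (\<nabla>\<^sub>v s) = (f\<^sup>*\<nabla>')\<^sub>v (F \<circ> s)\<close>, where
  the pullback connection is determined by
  \<open>(f\<^sup>*\<nabla>')\<^sub>v (\<Sum>\<^sub>j a\<^sub>j (t\<^sub>j \<circ> f)) = \<Sum>\<^sub>j (v(a\<^sub>j) t\<^sub>j(f p) + a\<^sub>j(p) \<nabla>'\<^bsub>df v\<^esub> t\<^sub>j)\<close>; near \<open>p\<close>, every section of the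
  pullback bundle has this form.\<close>

definition preserves_connection ::
  "('a, 'e, 'k::real_algebra_1) vbundle \<Rightarrow> ('b, 'f, 'k) vbundle \<Rightarrow> ('a \<Rightarrow> 'b) \<Rightarrow> ('e \<Rightarrow> 'f) \<Rightarrow>
    ('a, 'e) conn \<Rightarrow> ('b, 'f) conn \<Rightarrow> bool" where
  "preserves_connection V W f F D D' \<longleftrightarrow>
     (\<forall>p\<in>points (vbase V). \<forall>v\<in>tangent (vbase V) p. \<forall>s\<in>sections V. \<forall>L U.
        (\<forall>(a, t)\<in>set L. smooth_fun (vbase V) a \<and> t \<in> sections W) \<and>
        openin (mtop (vbase V)) U \<and> p \<in> U \<and>
        (\<forall>q\<in>U. F (s q) = lincomb W (f q) (map (\<lambda>(a, t). (a q, t (f q))) L)) \<longrightarrow>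
        F (D v s) = lincomb W (f p)
          (map (\<lambda>(a, t). (dirderiv (vbase V) v a, t (f p))) L @
           map (\<lambda>(a, t). (a p, D' (dmap (vbase V) (vbase W) f v) t)) L))"

section \<open>Generalized Dirac bundles\<close>

record ('a, 'e, 's) dirac =
  dirS :: "('a, 's, complex) vbundle"
  dirE :: "('a, 'e, real) vbundle"
  metS :: "'s \<Rightarrow> 's \<Rightarrow> complex"
  metE :: "'e \<Rightarrow> 'e \<Rightarrow> real"
  conS :: "('a, 's) conn"
  conE :: "('a, 'e) conn"
  cliff :: "'e \<Rightarrow> 's \<Rightarrow> 's"

definition dirac_bundle :: "('a, 'e, 's) dirac \<Rightarrow> bool" where
  "dirac_bundle X \<longleftrightarrow>
     (let S = dirS X; E = dirE X; M = vbase S; cl = cliff X in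
      vbase E = M \<and> vector_bundle complex_co S \<and> vector_bundle real_co E \<and>
      bundle_metric complex_co cnj S (metS X) \<and> bundle_metric real_co (\<lambda>x. x) E (metE X) \<and>
      metric_connection complex_co S (metS X) (conS X) \<and>
      metric_connection real_co E (metE X) (conE X) \<and>
      (\<forall>p\<in>points M. \<forall>e\<in>vfib E p. \<forall>u\<in>vfib S p.
         cl e u \<in> vfib S p \<and>
         (\<forall>e'\<in>vfib E p. cl (vadd E e e') u = vadd S (cl e u) (cl e' u)) \<and>
         (\<forall>a. cl (vscl E a e) u = vscl S (of_real a) (cl e u)) \<and>
         (\<forall>w\<in>vfib S p. cl e (vadd S u w) = vadd S (cl e u) (cl e w) \<and>
            metS X (cl e u) w = - metS X u (cl e w)) \<and>
         (\<forall>z. cl e (vscl S z u) = vscl S z (cl e u)) \<and>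
         cl e (cl e u) = vscl S (- of_real (metE X e e)) u) \<and>
      (\<forall>t\<in>sections E. \<forall>s\<in>sections S.
         (\<lambda>p\<in>points M. cl (t p) (s p)) \<in> sections S \<and>
         (\<forall>p\<in>points M. \<forall>v\<in>tangent M p. conS X v (\<lambda>p\<in>points M. cl (t p) (s p)) =
            vadd S (cl (conE X v t) (s p)) (cl (t p) (conS X v s)))))"

definition dirac_maps ::
  "('a, 'e, 's) dirac \<Rightarrow> ('b, 'f, 't) dirac \<Rightarrow> (('a \<Rightarrow> 'b) \<times> ('e \<Rightarrow> 'f) \<times> ('s \<Rightarrow> 't)) set" where
  "dirac_maps X Y = {(f, FE, FS).
     (f, FE) \<in> bundle_maps (dirE X) (dirE Y) \<and> (f, FS) \<in> bundle_maps (dirS X) (dirS Y) \<and>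
     (\<forall>p\<in>points (vbase (dirS X)).
        (\<forall>e\<in>vfib (dirE X) p. \<forall>e'\<in>vfib (dirE X) p. metE Y (FE e) (FE e') = metE X e e') \<and>
        (\<forall>u\<in>vfib (dirS X) p. \<forall>w\<in>vfib (dirS X) p. metS Y (FS u) (FS w) = metS X u w) \<and>
        (\<forall>e\<in>vfib (dirE X) p. \<forall>u\<in>vfib (dirS X) p. FS (cliff X e u) = cliff Y (FE e) (FS u))) \<and>
     preserves_connection (dirE X) (dirE Y) f FE (conE X) (conE Y) \<and>
     preserves_connection (dirS X) (dirS Y) f FS (conS X) (conS Y)}"

definition DiracBdl ::
  "(('a, 'e, 's) dirac, ('a \<Rightarrow> 'a) \<times> ('e \<Rightarrow> 'e) \<times> ('s \<Rightarrow> 's)) cat" where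
  "DiracBdl = \<lparr>Ob = {X. dirac_bundle X}, Hom = dirac_maps,
     Ide = (\<lambda>X. (\<lambda>p\<in>points (vbase (dirS X)). p, \<lambda>e\<in>points (vtot (dirE X)). e,
                 \<lambda>s\<in>points (vtot (dirS X)). s)),
     Cmp = (\<lambda>X Y Z (g, GE, GS) (f, FE, FS).
       (compose (points (vbase (dirS X))) g f, compose (points (vtot (dirE X))) GE FE,
        compose (points (vtot (dirS X))) GS FS))\<rparr>"

definition forget_dirac ::
  "(('a, 'e, 's) dirac, ('a \<Rightarrow> 'a) \<times> ('e \<Rightarrow> 'e) \<times> ('s \<Rightarrow> 's),
    ('a, 's, complex) vbundle, ('a \<Rightarrow> 'a) \<times> ('s \<Rightarrow> 's)) funct" where
  "forget_dirac = \<lparr>omap = dirS, mmap = (\<lambda>X Y (f, FE, FS). (f, FS))\<rparr>"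

section \<open>The double covering group and the spinor representation\<close>

text \<open>\<open>sd_grp\<close> with topology \<open>sd_top\<close> is the double covering group of \<open>GL\<^sup>+\<^sub>m\<close>, with covering map
  \<open>sd_cov\<close>; \<open>\<Sigma>\<^sub>m\<close> is \<open>\<complex>\<^sup>N\<close> with \<open>N = sd_rank\<close>, on which the standard basis vectors of \<open>\<real>\<^sup>m\<close> act by
  the matrices \<open>sd_gam\<close>; and \<open>sd_rep\<close> is the spinor representation.\<close>

record 'h spin_data =
  sd_dim :: nat
  sd_grp :: "'h monoid"
  sd_top :: "'h topology"
  sd_cov :: "'h \<Rightarrow> real Matrix.mat"
  sd_rank :: nat
  sd_gam :: "nat \<Rightarrow> complex Matrix.mat"
  sd_rep :: "'h \<Rightarrow> complex Matrix.mat"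

definition GL_pos :: "nat \<Rightarrow> real Matrix.mat monoid" where
  "GL_pos m = \<lparr>carrier = {A \<in> carrier_mat m m. 0 < Determinant.det A}, mult = (*), one = 1\<^sub>m m\<rparr>"

definition SO_mats :: "nat \<Rightarrow> real Matrix.mat set" where
  "SO_mats m = {A \<in> carrier_mat m m. transpose_mat A * A = 1\<^sub>m m \<and> Determinant.det A = 1}"

definition spin_carrier :: "'h spin_data \<Rightarrow> 'h set" where
  "spin_carrier D = {h \<in> carrier (sd_grp D). sd_cov D h \<in> SO_mats (sd_dim D)}"

definition spin_grp :: "'h spin_data \<Rightarrow> 'h monoid" where
  "spin_grp D = (sd_grp D)\<lparr>carrier := spin_carrier D\<rparr>"

definition spin_top :: "'h spin_data \<Rightarrow> 'h topology" where
  "spin_top D = subtopology (sd_top D) (spin_carrier D)"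

definition cliff_mat :: "'h spin_data \<Rightarrow> (nat \<Rightarrow> real) \<Rightarrow> complex Matrix.mat" where
  "cliff_mat D x = Matrix.mat (sd_rank D) (sd_rank D)
     (\<lambda>ab. \<Sum>i<sd_dim D. complex_of_real (x i) * sd_gam D i $$ ab)"

text \<open>An irreducible complex module of the Clifford algebra of \<open>\<real>\<^sup>m\<close> (with \<open>x \<cdot> x = -|x|\<^sup>2\<close>), given
  by the matrices of the generators; the standard Hermitian product is required to be
  invariant, i.e. unit vectors act unitarily.\<close>

definition irreducible_clifford_module :: "'h spin_data \<Rightarrow> bool" where
  "irreducible_clifford_module D \<longleftrightarrow>
     (let m = sd_dim D; N = sd_rank D; \<gamma> = sd_gam D in
      0 < N \<and>
      (\<forall>i<m. \<gamma> i \<in> carrier_mat N N) \<and>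
      (\<forall>i<m. \<forall>j<m. \<gamma> i * \<gamma> j + \<gamma> j * \<gamma> i = (if i = j then - 2 else 0) \<cdot>\<^sub>m 1\<^sub>m N) \<and>
      (\<forall>i<m. \<forall>a<N. \<forall>b<N. \<gamma> i $$ (a, b) = - cnj (\<gamma> i $$ (b, a))) \<and>
      (\<forall>W. W \<subseteq> carrier_vec N \<and> 0\<^sub>v N \<in> W \<and>
           (\<forall>u\<in>W. \<forall>w\<in>W. u + w \<in> W) \<and> (\<forall>z. \<forall>u\<in>W. z \<cdot>\<^sub>v u \<in> W) \<and>
           (\<forall>i<m. \<forall>u\<in>W. \<gamma> i *\<^sub>v u \<in> W)
         \<longrightarrow> W = {0\<^sub>v N} \<or> W = carrier_vec N))"

text \<open>The spinor representation is the restriction of the Clifford module to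
  \<open>Spin\<^sub>m\<close>, where \<open>Spin\<^sub>m\<close> is regarded as the group of even products of unit vectors in the Clifford
  algebra, covering \<open>SO\<^sub>m\<close> by conjugation on \<open>\<real>\<^sup>m\<close>.  The even part of the Clifford algebra acts
  faithfully on an irreducible complex module, so this may be expressed by the
  operators on the module; as \<open>Spin\<^sub>m\<close> is connected, the conditions determine \<open>sd_rep\<close> on
  \<open>Spin\<^sub>m\<close> uniquely.\<close>

definition spinor_representation :: "'h spin_data \<Rightarrow> bool" where
  "spinor_representation D \<longleftrightarrow>
     (let m = sd_dim D; N = sd_rank D; \<rho> = sd_rep D in
      continuous_map (spin_top D) (mat_top N) \<rho> \<and>
      (\<forall>h\<in>spin_carrier D. \<forall>k\<in>spin_carrier D. \<rho> (h \<otimes>\<^bsub>sd_grp D\<^esub> k) = \<rho> h * \<rho> k) \<and>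
      (\<forall>h\<in>spin_carrier D.
         (\<exists>xs. even (length xs) \<and> (\<forall>x\<in>set xs. (\<Sum>i<m. (x i)\<^sup>2) = 1) \<and>
            \<rho> h = foldr (\<lambda>x A. cliff_mat D x * A) xs (1\<^sub>m N)) \<and>
         (\<forall>x. \<rho> h * cliff_mat D x =
            cliff_mat D (\<lambda>i. \<Sum>j<m. sd_cov D h $$ (i, j) * x j) * \<rho> h)))"

text \<open>Connected double coverings of \<open>GL\<^sup>+\<^sub>m\<close> exist only for \<open>m \<ge> 2\<close>.\<close>

definition spin_setup :: "'h spin_data \<Rightarrow> bool" where
  "spin_setup D \<longleftrightarrow> 2 \<le> sd_dim D \<and>
     topological_group (sd_grp D) (sd_top D) \<and>
     connected_space (sd_top D) \<and>
     sd_cov D \<in> hom (sd_grp D) (GL_pos (sd_dim D)) \<and>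
     double_covering (sd_top D)
       (subtopology (mat_top (sd_dim D)) (carrier (GL_pos (sd_dim D)))) (sd_cov D) \<and>
     irreducible_clifford_module D \<and> spinor_representation D"

section \<open>Topological and metric spin structures\<close>

text \<open>\<open>sm_top\<close> is the total space of the spin structure, \<open>sm_act\<close> its right
  action of the structure group and \<open>sm_map\<close> the covering of the frame bundle; the projection to
  the manifold is \<open>fst \<circ> sm_map\<close>.  The total space carries only a topology, since its smooth
  structure is the unique one that makes \<open>sm_map\<close> a local diffeomorphism; continuous lifts of
  smooth maps are then automatically smooth.  They are also automatically equivariant, the structure
  groups being connected.\<close>

record ('a, 'p, 'h) spin_mfd =
  sm_mfd :: "'a manifold"
  sm_or :: "'a chart set"
  sm_top :: "'p topology"
  sm_act :: "'p \<Rightarrow> 'h \<Rightarrow> 'p"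
  sm_map :: "'p \<Rightarrow> 'a frame"

record ('a, 'p, 'h) riem_spin_mfd = "('a, 'p, 'h) spin_mfd" +
  sm_met :: "'a tvec \<Rightarrow> 'a tvec \<Rightarrow> real"

definition spin_lifts ::
  "('a, 'p, 'h, 'x) spin_mfd_scheme \<Rightarrow> ('b, 'q, 'h, 'y) spin_mfd_scheme \<Rightarrow> (('a \<Rightarrow> 'b) \<times> ('p \<Rightarrow> 'q)) set"
  where
  "spin_lifts X Y = {(f, F). f \<in> oriented_diffeos (sm_mfd X) (sm_or X) (sm_mfd Y) (sm_or Y) \<and>
     F \<in> extensional (topspace (sm_top X)) \<and> continuous_map (sm_top X) (sm_top Y) F \<and>
     (\<forall>b\<in>topspace (sm_top X). sm_map Y (F b) = dframe (sm_mfd X) (sm_mfd Y) f (sm_map X b))}"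

definition spin_ide :: "('a, 'p, 'h, 'x) spin_mfd_scheme \<Rightarrow> ('a \<Rightarrow> 'a) \<times> ('p \<Rightarrow> 'p)" where
  "spin_ide X = (\<lambda>p\<in>points (sm_mfd X). p, \<lambda>b\<in>topspace (sm_top X). b)"

definition spin_cmp :: "('a, 'p, 'h, 'x) spin_mfd_scheme \<Rightarrow> ('b \<Rightarrow> 'c) \<times> ('q \<Rightarrow> 'r) \<Rightarrow>
    ('a \<Rightarrow> 'b) \<times> ('p \<Rightarrow> 'q) \<Rightarrow> ('a \<Rightarrow> 'c) \<times> ('p \<Rightarrow> 'r)" where
  "spin_cmp X = (\<lambda>(g, G) (f, F).
     (compose (points (sm_mfd X)) g f, compose (topspace (sm_top X)) G F))"

definition topological_spin_mfd :: "'h spin_data \<Rightarrow> ('a, 'p, 'h) spin_mfd \<Rightarrow> bool" where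
  "topological_spin_mfd D X \<longleftrightarrow>
     (let M = sm_mfd X; A = sm_or X; P = sm_top X; m = sd_dim D in
      smooth_manifold M \<and> mdim M = m \<and> orientation M A \<and>
      principal_bundle (sd_grp D) (sd_top D) (mtop M) P (sm_act X) (\<lambda>b. fst (sm_map X b)) \<and>
      double_covering P (frame_top M A) (sm_map X) \<and>
      (\<forall>b\<in>topspace P. \<forall>h\<in>carrier (sd_grp D).
         sm_map X (sm_act X b h) = frame_act m (sm_map X b) (sd_cov D h)))"

definition SpinMfds ::
  "'h spin_data \<Rightarrow> (('a, 'p, 'h) spin_mfd, ('a \<Rightarrow> 'a) \<times> ('p \<Rightarrow> 'p)) cat" where
  "SpinMfds D = \<lparr>Ob = {X. topological_spin_mfd D X}, Hom = spin_lifts,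
     Ide = spin_ide, Cmp = (\<lambda>X Y Z. spin_cmp X)\<rparr>"

definition forget_spin ::
  "(('a, 'p, 'h) spin_mfd, ('a \<Rightarrow> 'a) \<times> ('p \<Rightarrow> 'p), 'a manifold, 'a \<Rightarrow> 'a) funct" where
  "forget_spin = \<lparr>omap = sm_mfd, mmap = (\<lambda>X Y (f, F). f)\<rparr>"

definition on_frames ::
  "'a manifold \<Rightarrow> 'a chart set \<Rightarrow> ('a tvec \<Rightarrow> 'a tvec \<Rightarrow> real) \<Rightarrow> 'a frame set" where
  "on_frames M A g = {(p, B) \<in> pos_frames M A.
     \<forall>i<mdim M. \<forall>j<mdim M. g (p, B i) (p, B j) = (if i = j then 1 else 0)}"

definition metric_spin_mfd :: "'h spin_data \<Rightarrow> ('a, 'p, 'h) riem_spin_mfd \<Rightarrow> bool" where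
  "metric_spin_mfd D X \<longleftrightarrow>
     (let M = sm_mfd X; A = sm_or X; P = sm_top X; g = sm_met X; m = sd_dim D in
      smooth_manifold M \<and> mdim M = m \<and> orientation M A \<and> riemannian_metric M g \<and>
      principal_bundle (spin_grp D) (spin_top D) (mtop M) P (sm_act X) (\<lambda>b. fst (sm_map X b)) \<and>
      double_covering P (subtopology (frame_top M A) (on_frames M A g)) (sm_map X) \<and>
      (\<forall>b\<in>topspace P. \<forall>h\<in>spin_carrier D.
         sm_map X (sm_act X b h) = frame_act m (sm_map X b) (sd_cov D h)))"

definition RiemSpinMf ::
  "'h spin_data \<Rightarrow> (('a, 'p, 'h) riem_spin_mfd, ('a \<Rightarrow> 'a) \<times> ('p \<Rightarrow> 'p)) cat" where
  "RiemSpinMf D = \<lparr>Ob = {X. metric_spin_mfd D X},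
     Hom = (\<lambda>X Y. {(f, F) \<in> spin_lifts X Y.
       \<forall>p\<in>points (sm_mfd X). \<forall>v\<in>tangent (sm_mfd X) p. \<forall>w\<in>tangent (sm_mfd X) p.
         sm_met Y (dmap (sm_mfd X) (sm_mfd Y) f v) (dmap (sm_mfd X) (sm_mfd Y) f w) = sm_met X v w}),
     Ide = spin_ide, Cmp = (\<lambda>X Y Z. spin_cmp X)\<rparr>"

subsection \<open>Associated bundles and extension of the structure group\<close>

text \<open>\<open>L\<close> is a left action of \<open>Spin\<^sub>m\<close> on the typical fibre.  Elements of the
  associated bundle are the equivalence classes \<open>[b, y] = {(b s, s\<^sup>-\<^sup>1 y) | s \<in> Spin\<^sub>m}\<close>.\<close>

definition assoc_cls ::
  "'h spin_data \<Rightarrow> ('p \<Rightarrow> 'h \<Rightarrow> 'p) \<Rightarrow> ('h \<Rightarrow> 'y \<Rightarrow> 'y) \<Rightarrow> 'p \<times> 'y \<Rightarrow> ('p \<times> 'y) set" where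
  "assoc_cls D act L = (\<lambda>(b, y). {(act b s, L (inv\<^bsub>sd_grp D\<^esub> s) y) | s. s \<in> spin_carrier D})"

definition ext_cls ::
  "'h spin_data \<Rightarrow> ('a, 'p, 'h) riem_spin_mfd \<Rightarrow> 'p \<times> 'h \<Rightarrow> ('p \<times> 'h) set" where
  "ext_cls D X = assoc_cls D (sm_act X) (\<lambda>s h. s \<otimes>\<^bsub>sd_grp D\<^esub> h)"

definition ext_top ::
  "'h spin_data \<Rightarrow> ('a, 'p, 'h) riem_spin_mfd \<Rightarrow> ('p \<times> 'h) set topology" where
  "ext_top D X = quotient_top (prod_topology (sm_top X) (sd_top D)) (ext_cls D X)"

definition MetrTop ::
  "'h spin_data \<Rightarrow> (('a, 'p, 'h) riem_spin_mfd, ('a \<Rightarrow> 'a) \<times> ('p \<Rightarrow> 'p),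
     ('a, ('p \<times> 'h) set, 'h) spin_mfd, ('a \<Rightarrow> 'a) \<times> (('p \<times> 'h) set \<Rightarrow> ('p \<times> 'h) set)) funct" where
  "MetrTop D =
     \<lparr>omap = (\<lambda>X. \<lparr>sm_mfd = sm_mfd X, sm_or = sm_or X, sm_top = ext_top D X,
        sm_act = (\<lambda>C k. case SOME y. y \<in> C of (b, h) \<Rightarrow> ext_cls D X (b, h \<otimes>\<^bsub>sd_grp D\<^esub> k)),
        sm_map = (\<lambda>C. case SOME y. y \<in> C of (b, h) \<Rightarrow>
          frame_act (sd_dim D) (sm_map X b) (sd_cov D h))\<rparr>),
      mmap = (\<lambda>X Y (f, F). (f, \<lambda>C\<in>topspace (ext_top D X). case SOME y. y \<in> C of (b, h) \<Rightarrow>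
        ext_cls D Y (F b, h)))\<rparr>"

section \<open>The spinor bundle functor\<close>

definition spinor_cls ::
  "'h spin_data \<Rightarrow> ('a, 'p, 'h) riem_spin_mfd \<Rightarrow> 'p \<times> complex Matrix.vec \<Rightarrow>
    ('p \<times> complex Matrix.vec) set" where
  "spinor_cls D X = assoc_cls D (sm_act X) (\<lambda>s v. sd_rep D s *\<^sub>v v)"

definition spinor_top ::
  "'h spin_data \<Rightarrow> ('a, 'p, 'h) riem_spin_mfd \<Rightarrow> ('p \<times> complex Matrix.vec) set topology" where
  "spinor_top D X = quotient_top (prod_topology (sm_top X) (vec_top (sd_rank D))) (spinor_cls D X)"

definition spinor_proj ::
  "('a, 'p, 'h) riem_spin_mfd \<Rightarrow> ('p \<times> complex Matrix.vec) set \<Rightarrow> 'a" where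
  "spinor_proj X C = fst (sm_map X (fst (SOME y. y \<in> C)))"

text \<open>Smooth local sections of \<open>Spin\<^sup>gM\<close>: continuous ones that lie over smooth local frames.\<close>

definition spin_frame :: "('a, 'p, 'h) riem_spin_mfd \<Rightarrow> 'a set \<Rightarrow> ('a \<Rightarrow> 'p) \<Rightarrow> bool" where
  "spin_frame X U s \<longleftrightarrow>
     (let M = sm_mfd X in
      openin (mtop M) U \<and> continuous_map (subtopology (mtop M) U) (sm_top X) s \<and>
      (\<forall>q\<in>U. fst (sm_map X (s q)) = q) \<and>
      (\<forall>c\<in>atlas M. \<forall>i<mdim M. \<forall>j<mdim M. Rn_smooth (mdim M) (snd c ` (U \<inter> fst c))
         (\<lambda>x. snd (sm_map X (s (chart_inv c x))) j c i)))"

definition spinor_coords ::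
  "'h spin_data \<Rightarrow> ('a, 'p, 'h) riem_spin_mfd \<Rightarrow> ('a \<Rightarrow> 'p) \<Rightarrow> ('p \<times> complex Matrix.vec) set \<Rightarrow>
    nat \<Rightarrow> complex" where
  "spinor_coords D X s C =
     (let v = (THE v. v \<in> carrier_vec (sd_rank D) \<and> C = spinor_cls D X (s (spinor_proj X C), v))
      in (\<lambda>i. if i < sd_rank D then vec_index v i else 0))"

definition spinor_charts ::
  "'h spin_data \<Rightarrow> ('a, 'p, 'h) riem_spin_mfd \<Rightarrow> ('p \<times> complex Matrix.vec) set chart set" where
  "spinor_charts D X =
     {(E, \<lambda>C\<in>E. join (sd_dim D) (snd c (spinor_proj X C)) (flatten complex_co (spinor_coords D X s C)))
       | c s E. c \<in> atlas (sm_mfd X) \<and> spin_frame X (fst c) s \<and>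
           E = {C \<in> topspace (spinor_top D X). spinor_proj X C \<in> fst c}}"

definition spinor_bundle ::
  "'h spin_data \<Rightarrow> ('a, 'p, 'h) riem_spin_mfd \<Rightarrow>
    ('a, ('p \<times> complex Matrix.vec) set, complex) vbundle" where
  "spinor_bundle D X =
     \<lparr>vbase = sm_mfd X,
      vtot = \<lparr>mtop = spinor_top D X,
        atlas = max_atlas (spinor_top D X) (sd_dim D + 2 * sd_rank D) (spinor_charts D X),
        mdim = sd_dim D + 2 * sd_rank D\<rparr>,
      vproj = spinor_proj X,
      vadd = (\<lambda>C C'. case SOME (b, v, w). (b, v) \<in> C \<and> (b, w) \<in> C' of (b, v, w) \<Rightarrow>
        spinor_cls D X (b, v + w)),
      vscl = (\<lambda>z C. case SOME y. y \<in> C of (b, v) \<Rightarrow> spinor_cls D X (b, z \<cdot>\<^sub>v v))\<rparr>"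

definition spinor_metric ::
  "'h spin_data \<Rightarrow> ('p \<times> complex Matrix.vec) set \<Rightarrow> ('p \<times> complex Matrix.vec) set \<Rightarrow> complex" where
  "spinor_metric D C C' =
     (case SOME (b, v, w). (b, v) \<in> C \<and> (b, w) \<in> C' of (b, v, w) \<Rightarrow>
        \<Sum>i<sd_rank D. vec_index v i * cnj (vec_index w i))"

definition spinor_cliff ::
  "'h spin_data \<Rightarrow> ('a, 'p, 'h) riem_spin_mfd \<Rightarrow> 'a tvec \<Rightarrow> ('p \<times> complex Matrix.vec) set \<Rightarrow>
    ('p \<times> complex Matrix.vec) set" where
  "spinor_cliff D X e C =
     (case SOME (b, v, x). (b, v) \<in> C \<and> e = frame_comb (sd_dim D) (sm_map X b) x of (b, v, x) \<Rightarrow>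
        spinor_cls D X (b, cliff_mat D x *\<^sub>v v))"

text \<open>\<open>levi_civita_pair M g c v Y z\<close> is \<open>g(\<nabla>\<^sub>v Y, z)\<close> for the Levi-Civita connection \<open>\<nabla>\<close> and a local vector
  field \<open>Y\<close>, computed in the chart \<open>c\<close> with the Christoffel symbols of the first kind.\<close>

definition levi_civita_pair ::
  "'a manifold \<Rightarrow> ('a tvec \<Rightarrow> 'a tvec \<Rightarrow> real) \<Rightarrow> 'a chart \<Rightarrow> 'a tvec \<Rightarrow> ('a \<Rightarrow> 'a tvec) \<Rightarrow> 'a tvec \<Rightarrow> real"
  where
  "levi_civita_pair M g c v Y z =
     (let n = mdim M; x = snd c (fst v);
          G = (\<lambda>i j y. g (tvec_of M c (chart_inv c y) (\<lambda>k. if k = i then 1 else 0))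
                         (tvec_of M c (chart_inv c y) (\<lambda>k. if k = j then 1 else 0)));
          Yc = (\<lambda>j y. snd (Y (chart_inv c y)) c j)
      in \<Sum>i<n. \<Sum>j<n. \<Sum>k<n.
           snd v c i * snd z c k *
             (G j k x * partial i (Yc j) x +
              (partial i (G j k) x + partial j (G i k) x - partial k (G i j) x) / 2 * Yc j x))"

definition levi_civita ::
  "'a manifold \<Rightarrow> ('a tvec \<Rightarrow> 'a tvec \<Rightarrow> real) \<Rightarrow> ('a, 'a tvec) conn" where
  "levi_civita M g v Y = (THE w. w \<in> tangent M (fst v) \<and>
     (\<forall>c\<in>charts_at M (fst v). \<forall>z\<in>tangent M (fst v). g w z = levi_civita_pair M g c v Y z))"

text \<open>The connection induced by the Levi-Civita connection: over a spin frame \<open>s\<close> lying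
  over the orthonormal frame \<open>(b\<^sub>1, \<dots>, b\<^sub>m)\<close>,
  \<open>\<nabla>\<^sub>v [s, \<phi>] = [s, v(\<phi>) + 1/2 \<Sum>\<^bsub>i<j\<^esub> g(\<nabla>\<^sub>v b\<^sub>i, b\<^sub>j) \<gamma>\<^sub>i \<gamma>\<^sub>j \<phi>]\<close>.\<close>

definition spinor_connection ::
  "'h spin_data \<Rightarrow> ('a, 'p, 'h) riem_spin_mfd \<Rightarrow> ('a, ('p \<times> complex Matrix.vec) set) conn" where
  "spinor_connection D X v \<psi> =
     (let M = sm_mfd X; p = fst v; m = sd_dim D; N = sd_rank D in
      THE e. \<exists>U s \<phi>. p \<in> U \<and> spin_frame X U s \<and>
        (\<forall>q\<in>U. \<phi> q \<in> carrier_vec N \<and> \<psi> q = spinor_cls D X (s q, \<phi> q)) \<and>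
        (\<forall>c\<in>charts_at M p. e = spinor_cls D X (s p, Matrix.vec N (\<lambda>a.
           Complex (dirderiv M v (\<lambda>q. Re (vec_index (\<phi> q) a)))
                   (dirderiv M v (\<lambda>q. Im (vec_index (\<phi> q) a))) +
           (\<Sum>i<m. \<Sum>j\<in>{i<..<m}.
              complex_of_real (levi_civita_pair M (sm_met X) c v
                (\<lambda>q. (q, snd (sm_map X (s q)) i)) (p, snd (sm_map X (s p)) j)) *
              vec_index (sd_gam D i *\<^sub>v (sd_gam D j *\<^sub>v \<phi> p)) a) / 2))))"

definition Sigma_fun ::
  "'h spin_data \<Rightarrow> (('a, 'p, 'h) riem_spin_mfd, ('a \<Rightarrow> 'a) \<times> ('p \<Rightarrow> 'p),
     ('a, 'a tvec, ('p \<times> complex Matrix.vec) set) dirac,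
     ('a \<Rightarrow> 'a) \<times> ('a tvec \<Rightarrow> 'a tvec) \<times>
       (('p \<times> complex Matrix.vec) set \<Rightarrow> ('p \<times> complex Matrix.vec) set)) funct" where
  "Sigma_fun D =
     \<lparr>omap = (\<lambda>X. \<lparr>dirS = spinor_bundle D X, dirE = tangent_bundle (sm_mfd X),
        metS = spinor_metric D, metE = sm_met X,
        conS = spinor_connection D X, conE = levi_civita (sm_mfd X) (sm_met X),
        cliff = spinor_cliff D X\<rparr>),
      mmap = (\<lambda>X Y (f, F).
        (f, restrict (dmap (sm_mfd X) (sm_mfd Y) f) (topspace (tangent_top (sm_mfd X))),
         \<lambda>C\<in>topspace (spinor_top D X). case SOME y. y \<in> C of (b, v) \<Rightarrow>
           spinor_cls D Y (F b, v)))\<rparr>"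

end

theory Submission
  imports Defs "Jordan_Normal_Form.Spectral_Radius"
begin

text \<open>A functor as in the theorem would turn the action of \<open>GL~\<^sup>+\<^sub>m\<close> on the spin manifold \<open>\<real>\<^sup>m\<close> by linear
  maps, all of which fix the origin, into a linear action \<open>T\<close> on the fibre \<open>\<Sigma>\<^sub>m\<close> over the origin.
  On \<open>Spin\<^sub>m\<close> these maps are isometries, so \<open>T\<close> extends the spinor representation.  No such extension
  exists, even without continuity: a lift \<open>h\<close> of a rotation by \<open>\<theta>\<close> in a coordinate plane satisfies
  \<open>T h + T h\<^sup>-\<^sup>1 = \<plusminus> 2 cos (\<theta>/2)\<close>, and conjugation in \<open>GL~\<^sup>+\<^sub>m\<close> carries this over to lifts of
  all elliptic elements of \<open>SL\<^sub>2\<close>.  Adding the identities for \<open>ab\<close> and \<open>ab\<^sup>-\<^sup>1\<close> gives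
  \<open>k\<^sub>a\<^sub>b + k' = k\<^sub>a k\<^sub>b\<close> for the scalars, which fails whatever the signs, since half angles do not
  obey the trace identity of \<open>SL\<^sub>2\<close>.\<close>

section \<open>Double coverings and quotients\<close>

text \<open>Functoriality produces one smooth bundle map for each group element, but no continuity
  in that element. The Lie algebra argument, by which finite-dimensional continuous representations
  of the double cover factor through \<open>GL_pos\<close>, is therefore out of reach; the
  contradiction has to come from finitely many elements. An element over a rotation is one of two
  lifts, so only the squares of the scalars are determined. Let x, y, z, w be the traces of a, b,
  ab, ab^-1, so that z + w = xy. Squaring the relation between the scalars, whose squares are 2 + x,
  2 + y, 2 + z, 2 + w, shows that the scalars of ab and ab^-1 have product x + y, hence (2 + z)(2 +
  w) = (x + y)^2. By Fricke's identity this says that the commutator of a and b has trace 2.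
  Rotations of one plane commute and satisfy it, so matrices that are not orthogonal must enter; for
  the pair used the commutator has trace 33/16. The two functor equations have separate tasks: the
  one with \<open>pr\<close> keeps the bundle maps in the fibre over the origin, the one with
  \<open>MetrTop\<close> identifies this fibre with the spinors.\<close>

lemma topspace_mat_top [simp]: "topspace (mat_top n) = carrier_mat n n"
  by (auto simp: mat_top_def topspace_pullback_topology)

text \<open>A single sheet already maps onto the evenly covered neighbourhood.\<close>

lemma double_covering_surj:
  assumes "double_covering X Y p" "y \<in> topspace Y"
  shows "\<exists>x\<in>topspace X. p x = y"
proof -
  obtain U V1 where "y \<in> U" and hm: "homeomorphic_map (subtopology X V1) (subtopology Y U) p"
    using assms by (auto simp: double_covering_def)
  then have "y \<in> p ` topspace (subtopology X V1)"
    using assms(2) homeomorphic_imp_surjective_map[OF hm] by simp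
  then show ?thesis by auto
qed

text \<open>\<open>quotient_top\<close> is given through \<open>topology\<close>, so its open sets
  are known only once the defining family is shown to be a topology.\<close>

lemma openin_quotient_top:
  "openin (quotient_top X q) W \<longleftrightarrow> W \<subseteq> q ` topspace X \<and> openin X {x \<in> topspace X. q x \<in> W}"
proof -
  have "istopology (\<lambda>W. W \<subseteq> q ` topspace X \<and> openin X {x \<in> topspace X. q x \<in> W})"
    unfolding istopology_def
  proof (intro conjI allI impI)
    fix V W assume "V \<subseteq> q ` topspace X \<and> openin X {x \<in> topspace X. q x \<in> V}"
      "W \<subseteq> q ` topspace X \<and> openin X {x \<in> topspace X. q x \<in> W}"
    moreover have "{x \<in> topspace X. q x \<in> V \<inter> W} = {x \<in> topspace X. q x \<in> V} \<inter> {x \<in> topspace X. q x \<in> W}"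
      by auto
    ultimately show "V \<inter> W \<subseteq> q ` topspace X" "openin X {x \<in> topspace X. q x \<in> V \<inter> W}"
      by (auto intro: openin_Int)
  next
    fix K assume K: "\<forall>W\<in>K. W \<subseteq> q ` topspace X \<and> openin X {x \<in> topspace X. q x \<in> W}"
    then show "\<Union>K \<subseteq> q ` topspace X" by blast
    have "{x \<in> topspace X. q x \<in> \<Union>K} = \<Union>((\<lambda>W. {x \<in> topspace X. q x \<in> W}) ` K)" by auto
    then show "openin X {x \<in> topspace X. q x \<in> \<Union>K}" using K by auto
  qed
  then show ?thesis unfolding quotient_top_def by (simp add: topology_inverse')
qed

lemma topspace_quotient_top [simp]: "topspace (quotient_top X q) = q ` topspace X"
proof
  show "topspace (quotient_top X q) \<subseteq> q ` topspace X"
    using openin_topspace[of "quotient_top X q"] unfolding openin_quotient_top by (rule conjunct1)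
  have "{x \<in> topspace X. q x \<in> q ` topspace X} = topspace X" by auto
  then have "openin (quotient_top X q) (q ` topspace X)"
    unfolding openin_quotient_top by simp
  then show "q ` topspace X \<subseteq> topspace (quotient_top X q)" by (rule openin_subset)
qed

text \<open>A continuous map with a continuous section is a quotient map.\<close>

lemma quotient_top_homeo:
  assumes r: "continuous_map X Z r" and \<sigma>: "continuous_map Z X \<sigma>"
    and r\<sigma>: "\<And>z. z \<in> topspace Z \<Longrightarrow> r (\<sigma> z) = z"
    and q\<sigma>: "\<And>x. x \<in> topspace X \<Longrightarrow> q (\<sigma> (r x)) = q x"
    and d: "\<And>x. x \<in> topspace X \<Longrightarrow> d (q x) = r x"
  shows "homeomorphic_maps Z (quotient_top X q) (\<lambda>z. q (\<sigma> z)) d"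
  unfolding homeomorphic_maps_def
proof (intro conjI ballI)
  have \<sigma>t: "\<sigma> z \<in> topspace X" if "z \<in> topspace Z" for z
    using continuous_map_funspace[OF \<sigma>] that by auto
  have rt: "r x \<in> topspace Z" if "x \<in> topspace X" for x
    using continuous_map_funspace[OF r] that by auto
  show "continuous_map Z (quotient_top X q) (\<lambda>z. q (\<sigma> z))"
    unfolding continuous_map_alt
  proof (intro conjI allI impI)
    fix W assume "openin (quotient_top X q) W"
    then have "openin X {x \<in> topspace X. q x \<in> W}" by (simp add: openin_quotient_top)
    then have "openin Z (\<sigma> -` {x \<in> topspace X. q x \<in> W} \<inter> topspace Z)"
      by (rule continuous_map_open[OF \<sigma>])
    moreover have "\<sigma> -` {x \<in> topspace X. q x \<in> W} \<inter> topspace Z = (\<lambda>z. q (\<sigma> z)) -` W \<inter> topspace Z"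
      using \<sigma>t by auto
    ultimately show "openin Z ((\<lambda>z. q (\<sigma> z)) -` W \<inter> topspace Z)" by simp
  qed (use \<sigma>t in auto)
  show "continuous_map (quotient_top X q) Z d"
    unfolding continuous_map_alt
  proof (intro conjI allI impI)
    fix V assume "openin Z V"
    then have "openin X (r -` V \<inter> topspace X)" by (rule continuous_map_open[OF r])
    moreover have "{x \<in> topspace X. q x \<in> d -` V \<inter> topspace (quotient_top X q)} = r -` V \<inter> topspace X"
    proof -
      have "q x \<in> d -` V \<inter> topspace (quotient_top X q) \<longleftrightarrow> r x \<in> V" if "x \<in> topspace X" for x
        using that d[OF that] by simp
      then show ?thesis by auto
    qed
    ultimately show "openin (quotient_top X q) (d -` V \<inter> topspace (quotient_top X q))"
      by (simp add: openin_quotient_top)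
  qed (use d rt in auto)
  show "d (q (\<sigma> z)) = z" if "z \<in> topspace Z" for z using d[OF \<sigma>t[OF that]] r\<sigma>[OF that] by simp
  show "q (\<sigma> (d w)) = w" if "w \<in> topspace (quotient_top X q)" for w
    using that d q\<sigma> by auto
qed

lemma double_coveringE:
  assumes "double_covering X Y p" "y \<in> topspace Y"
  obtains U V1 V2 where "openin Y U" "y \<in> U" "openin X V1" "openin X V2" "V1 \<inter> V2 = {}"
      "{x \<in> topspace X. p x \<in> U} = V1 \<union> V2"
      "homeomorphic_map (subtopology X V1) (subtopology Y U) p"
      "homeomorphic_map (subtopology X V2) (subtopology Y U) p"
proof -
  from assms(1) have "\<exists>U V1 V2. openin Y U \<and> y \<in> U \<and> openin X V1 \<and> openin X V2 \<and>
        V1 \<inter> V2 = {} \<and> {x \<in> topspace X. p x \<in> U} = V1 \<union> V2 \<and>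
        homeomorphic_map (subtopology X V1) (subtopology Y U) p \<and>
        homeomorphic_map (subtopology X V2) (subtopology Y U) p"
    unfolding double_covering_def by (elim conjE) (rule bspec[OF _ assms(2)])
  then show thesis by (elim exE conjE) (rule that)
qed

text \<open>Transported coverings are composites that agree with the structure map of a bundle on
  its total space only; this lemma exchanges one for the other.\<close>

lemma double_covering_cong:
  assumes p: "double_covering X Y p" and eq: "\<And>x. x \<in> topspace X \<Longrightarrow> p x = p' x"
  shows "double_covering X Y p'"
  unfolding double_covering_def
proof (intro conjI ballI)
  show "continuous_map X Y p'"
    using p eq by (auto simp: double_covering_def intro: continuous_map_eq)
  fix y assume "y \<in> topspace Y"
  then obtain U V1 V2 where *: "openin Y U" "y \<in> U" "openin X V1" "openin X V2" "V1 \<inter> V2 = {}"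
      "{x \<in> topspace X. p x \<in> U} = V1 \<union> V2"
      "homeomorphic_map (subtopology X V1) (subtopology Y U) p"
      "homeomorphic_map (subtopology X V2) (subtopology Y U) p"
    by (rule double_coveringE[OF p])
  have "{x \<in> topspace X. p' x \<in> U} = V1 \<union> V2" 
  proof -
    have "{x \<in> topspace X. p' x \<in> U} = {x \<in> topspace X. p x \<in> U}"
      by (intro Collect_cong conj_cong refl) (simp add: eq)
    then show ?thesis by (simp only: *(6))
  qed
  moreover have "homeomorphic_map (subtopology X V1) (subtopology Y U) p'"
    "homeomorphic_map (subtopology X V2) (subtopology Y U) p'"
    by (rule homeomorphic_map_eq[OF *(7)], use eq in simp, rule homeomorphic_map_eq[OF *(8)], use eq in simp)
  ultimately show "\<exists>U V1 V2. openin Y U \<and> y \<in> U \<and> openin X V1 \<and> openin X V2 \<and>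
        V1 \<inter> V2 = {} \<and> {x \<in> topspace X. p' x \<in> U} = V1 \<union> V2 \<and>
        homeomorphic_map (subtopology X V1) (subtopology Y U) p' \<and>
        homeomorphic_map (subtopology X V2) (subtopology Y U) p'"
    using *(1-5) by blast
qed

text \<open>Serves to pass from the covering of \<open>GL_pos\<close> to that of the special
  orthogonal group by Spin. Both sheets are cut down to the preimage of \<open>B\<close>.\<close>

lemma double_covering_restrict:
  assumes p: "double_covering X Y p"
  shows "double_covering (subtopology X {x \<in> topspace X. p x \<in> B}) (subtopology Y B) p"
    (is "double_covering ?X ?Y p")
  unfolding double_covering_def
proof (intro conjI ballI)
  have pc: "continuous_map X Y p" using p by (simp add: double_covering_def)
  then show "continuous_map ?X ?Y p"
    by (auto simp: continuous_map_in_subtopology intro: continuous_map_from_subtopology)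
  fix y assume "y \<in> topspace ?Y"
  then have y: "y \<in> topspace Y" "y \<in> B" by auto
  from y(1) obtain U V1 V2 where *: "openin Y U" "y \<in> U" "openin X V1" "openin X V2" "V1 \<inter> V2 = {}"
      "{x \<in> topspace X. p x \<in> U} = V1 \<union> V2"
      "homeomorphic_map (subtopology X V1) (subtopology Y U) p"
      "homeomorphic_map (subtopology X V2) (subtopology Y U) p"
    by (rule double_coveringE[OF p])
  let ?A = "{x \<in> topspace X. p x \<in> B}"
  have hm: "homeomorphic_map (subtopology ?X (V \<inter> ?A)) (subtopology ?Y (U \<inter> B)) p"
    if h: "homeomorphic_map (subtopology X V) (subtopology Y U) p" and V: "V \<subseteq> topspace X" "\<And>x. x \<in> V \<Longrightarrow> p x \<in> U" for V
  proof -
    have "homeomorphic_map (subtopology (subtopology X V) ?A) (subtopology (subtopology Y U) B) p"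
    proof (rule homeomorphic_map_subtopologies_alt[OF h])
      fix x assume "x \<in> topspace (subtopology X V)"
      then show "p x \<in> B \<longleftrightarrow> x \<in> ?A" by simp
    qed
    moreover have "subtopology (subtopology X V) ?A = subtopology ?X (V \<inter> ?A)"
      "subtopology (subtopology Y U) B = subtopology ?Y (U \<inter> B)"
      by (simp_all add: subtopology_subtopology Int_ac)
    ultimately show ?thesis by simp
  qed
  have V: "V1 \<subseteq> topspace X" "V2 \<subseteq> topspace X" "\<And>x. x \<in> V1 \<Longrightarrow> p x \<in> U" "\<And>x. x \<in> V2 \<Longrightarrow> p x \<in> U"
    using *(6) by auto
  show "\<exists>U V1 V2. openin ?Y U \<and> y \<in> U \<and> openin ?X V1 \<and> openin ?X V2 \<and>
        V1 \<inter> V2 = {} \<and> {x \<in> topspace ?X. p x \<in> U} = V1 \<union> V2 \<and>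
        homeomorphic_map (subtopology ?X V1) (subtopology ?Y U) p \<and>
        homeomorphic_map (subtopology ?X V2) (subtopology ?Y U) p"
  proof (intro exI conjI)
    show "openin ?Y (U \<inter> B)" "openin ?X (V1 \<inter> ?A)" "openin ?X (V2 \<inter> ?A)"
      using *(1,3,4) by (auto intro: openin_subtopology_Int)
    show "y \<in> U \<inter> B" using * y by simp
    show "V1 \<inter> ?A \<inter> (V2 \<inter> ?A) = {}" using *(5) by auto
    show "{x \<in> topspace ?X. p x \<in> U \<inter> B} = V1 \<inter> ?A \<union> V2 \<inter> ?A" using *(6) by auto
    show "homeomorphic_map (subtopology ?X (V1 \<inter> ?A)) (subtopology ?Y (U \<inter> B)) p"
      by (rule hm[OF *(7) V(1) V(3)])
    show "homeomorphic_map (subtopology ?X (V2 \<inter> ?A)) (subtopology ?Y (U \<inter> B)) p"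
      by (rule hm[OF *(8) V(2) V(4)])
  qed
qed

lemma homeomorphic_map_prod_id:
  assumes "homeomorphic_map X Y p"
  shows "homeomorphic_map (prod_topology Z X) (prod_topology Z Y) (\<lambda>(z, x). (z, p x))"
proof -
  obtain p' where p': "homeomorphic_maps X Y p p'" using assms by (auto simp: homeomorphic_map_maps)
  have "homeomorphic_maps (prod_topology Z X) (prod_topology Z Y) (\<lambda>(z, x). (z, p x)) (\<lambda>(z, x). (z, p' x))"
    using p' homeomorphic_maps_prod[of Z X Z Y id p id p'] by (auto simp: homeomorphic_maps_def)
  then show ?thesis by (rule homeomorphic_maps_imp_map)
qed

text \<open>The spin structures below are products with the base; each sheet is multiplied by all of
  \<open>Z\<close>.\<close>

lemma double_covering_prod:
  assumes p: "double_covering X Y p"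
  shows "double_covering (prod_topology Z X) (prod_topology Z Y) (\<lambda>(z, x). (z, p x))"
    (is "double_covering ?X ?Y ?p")
  unfolding double_covering_def
proof (intro conjI ballI)
  have pc: "continuous_map X Y p" using p by (simp add: double_covering_def)
  show "continuous_map ?X ?Y ?p"
    using continuous_map_fst[of Z X] continuous_map_compose[OF continuous_map_snd[of Z X] pc]
    by (simp add: continuous_map_pairwise o_def split_def)
  fix y assume y: "y \<in> topspace ?Y"
  then have "snd y \<in> topspace Y" by auto
  then obtain U V1 V2 where *: "openin Y U" "snd y \<in> U" "openin X V1" "openin X V2" "V1 \<inter> V2 = {}"
      "{x \<in> topspace X. p x \<in> U} = V1 \<union> V2"
      "homeomorphic_map (subtopology X V1) (subtopology Y U) p"
      "homeomorphic_map (subtopology X V2) (subtopology Y U) p"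
    by (rule double_coveringE[OF p])
  let ?Z = "topspace Z"
  have sub: "subtopology (prod_topology Z W) (?Z \<times> V) = prod_topology Z (subtopology W V)" for W :: "'z topology" and V
    by (metis prod_topology_subtopology(2))
  show "\<exists>U V1 V2. openin ?Y U \<and> y \<in> U \<and> openin ?X V1 \<and> openin ?X V2 \<and>
        V1 \<inter> V2 = {} \<and> {x \<in> topspace ?X. ?p x \<in> U} = V1 \<union> V2 \<and>
        homeomorphic_map (subtopology ?X V1) (subtopology ?Y U) ?p \<and>
        homeomorphic_map (subtopology ?X V2) (subtopology ?Y U) ?p"
  proof (intro exI conjI)
    show "openin ?Y (?Z \<times> U)" "openin ?X (?Z \<times> V1)" "openin ?X (?Z \<times> V2)"
      using *(1,3,4) by (simp_all add: openin_prod_Times_iff)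
    show "y \<in> ?Z \<times> U" using * y by auto
    show "?Z \<times> V1 \<inter> ?Z \<times> V2 = {}" using *(5) by auto
    show "{x \<in> topspace ?X. ?p x \<in> ?Z \<times> U} = ?Z \<times> V1 \<union> ?Z \<times> V2" using *(6) by auto
    show "homeomorphic_map (subtopology ?X (?Z \<times> V1)) (subtopology ?Y (?Z \<times> U)) ?p"
      "homeomorphic_map (subtopology ?X (?Z \<times> V2)) (subtopology ?Y (?Z \<times> U)) ?p"
      using homeomorphic_map_prod_id[OF *(7), of Z] homeomorphic_map_prod_id[OF *(8), of Z]
      by (simp_all add: prod_topology_subtopology)
  qed
qed

text \<open>Transports a covering of products to the copies that live in the prescribed types. The
  new sheets are the images of the old ones under \<open>a'\<close>.\<close>

lemma double_covering_homeo:
  assumes p: "double_covering X Y p" and a: "homeomorphic_maps X' X a a'" and b: "homeomorphic_maps Y Y' b b'"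
  shows "double_covering X' Y' (\<lambda>x. b (p (a x)))"
  unfolding double_covering_def
proof (intro conjI ballI)
  have pc: "continuous_map X Y p" using p by (simp add: double_covering_def)
  have ac: "continuous_map X' X a" and bc: "continuous_map Y Y' b" and a'c: "continuous_map X X' a'"
    using a b by (simp_all add: homeomorphic_maps_def)
  show "continuous_map X' Y' (\<lambda>x. b (p (a x)))"
    using continuous_map_compose[OF continuous_map_compose[OF ac pc] bc] by (simp add: o_def)
  fix y assume y: "y \<in> topspace Y'"
  have ah: "homeomorphic_map X' X a" and bh: "homeomorphic_map Y Y' b" and b'h: "homeomorphic_map Y' Y b'" and a'h: "homeomorphic_map X X' a'"
    using a b homeomorphic_maps_map by blast+
  have b'y: "b' y \<in> topspace Y" "b (b' y) = y" using y b by (auto simp: homeomorphic_maps_def continuous_map_def)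
  from b'y(1) obtain U V1 V2 where *: "openin Y U" "b' y \<in> U" "openin X V1" "openin X V2" "V1 \<inter> V2 = {}"
      "{x \<in> topspace X. p x \<in> U} = V1 \<union> V2"
      "homeomorphic_map (subtopology X V1) (subtopology Y U) p"
      "homeomorphic_map (subtopology X V2) (subtopology Y U) p"
    by (rule double_coveringE[OF p])
  have aa': "a (a' x) = x" "a' x \<in> topspace X'" if "x \<in> topspace X" for x
    using that a by (auto simp: homeomorphic_maps_def continuous_map_def)
  have a'a: "a' (a x) = x" "a x \<in> topspace X" if "x \<in> topspace X'" for x
    using that a by (auto simp: homeomorphic_maps_def continuous_map_def)
  have bb: "b' (b z) = z" if "z \<in> topspace Y" for z
    using that b by (auto simp: homeomorphic_maps_def)
  have Ut: "U \<subseteq> topspace Y" and Vt: "V1 \<subseteq> topspace X" "V2 \<subseteq> topspace X" using * openin_subset by blast+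
  have hm: "homeomorphic_map (subtopology X' (a' ` V)) (subtopology Y' (b ` U)) (\<lambda>x. b (p (a x)))"
    if V: "V \<subseteq> topspace X" "homeomorphic_map (subtopology X V) (subtopology Y U) p" for V
  proof -
    have "homeomorphic_map (subtopology X' (a' ` V)) (subtopology X V) a"
    proof (rule homeomorphic_map_subtopologies[OF ah])
      have "topspace X' \<inter> a' ` V = a' ` V" using V(1) aa'(2) by blast
      moreover have "a ` a' ` V = V"
        unfolding image_image using V(1) aa'(1) by (intro Set.set_eqI) (force simp: image_iff)
      ultimately show "a ` (topspace X' \<inter> a' ` V) = topspace X \<inter> V" using V(1) by (simp add: inf_absorb2)
    qed
    moreover have "homeomorphic_map (subtopology Y U) (subtopology Y' (b ` U)) b"
    proof (rule homeomorphic_map_subtopologies[OF bh])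
      have "b ` U \<subseteq> topspace Y'" using Ut continuous_map_image_subset_topspace[OF bc] by blast
      then show "b ` (topspace Y \<inter> U) = topspace Y' \<inter> b ` U" using Ut by (simp add: inf_absorb2)
    qed
    ultimately have "homeomorphic_map (subtopology X' (a' ` V)) (subtopology Y' (b ` U)) (b \<circ> (p \<circ> a))"
      using V(2) by (intro homeomorphic_map_compose)
    then show ?thesis by (simp add: o_def)
  qed
  show "\<exists>U V1 V2. openin Y' U \<and> y \<in> U \<and> openin X' V1 \<and> openin X' V2 \<and>
        V1 \<inter> V2 = {} \<and> {x \<in> topspace X'. b (p (a x)) \<in> U} = V1 \<union> V2 \<and>
        homeomorphic_map (subtopology X' V1) (subtopology Y' U) (\<lambda>x. b (p (a x))) \<and>
        homeomorphic_map (subtopology X' V2) (subtopology Y' U) (\<lambda>x. b (p (a x)))"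
  proof (intro exI conjI)
    show "openin Y' (b ` U)" using homeomorphic_imp_open_map[OF bh] *(1) by (simp add: open_map_def)
    show "openin X' (a' ` V1)" "openin X' (a' ` V2)"
      using homeomorphic_imp_open_map[OF a'h] *(3,4) by (simp_all add: open_map_def)
    show "y \<in> b ` U" using *(2) b'y(2) by (metis imageI)
    show "a' ` V1 \<inter> a' ` V2 = {}"
    proof -
      have "False" if "v1 \<in> V1" "v2 \<in> V2" "a' v1 = a' v2" for v1 v2
      proof -
        have "v1 = v2" using aa'(1)[of v1] aa'(1)[of v2] that Vt by (metis subsetD)
        then show False using that *(5) by auto
      qed
      then show ?thesis by auto
    qed
    show "{x \<in> topspace X'. b (p (a x)) \<in> b ` U} = a' ` V1 \<union> a' ` V2"
    proof (rule Set.set_eqI)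
      fix x
      have "x \<in> {x \<in> topspace X'. b (p (a x)) \<in> b ` U} \<longleftrightarrow> x \<in> topspace X' \<and> p (a x) \<in> U"
      proof -
        have "b (p (a x)) \<in> b ` U \<longleftrightarrow> p (a x) \<in> U" if "x \<in> topspace X'"
        proof
          assume "b (p (a x)) \<in> b ` U"
          then obtain u where u: "u \<in> U" "b (p (a x)) = b u" by auto
          have "p (a x) \<in> topspace Y" using continuous_map_funspace[OF pc] a'a(2)[OF that] by auto
          then have "p (a x) = u" using u Ut bb by (metis subsetD)
          then show "p (a x) \<in> U" using u by simp
        qed simp
        then show ?thesis by auto
      qed
      also have "\<dots> \<longleftrightarrow> x \<in> topspace X' \<and> a x \<in> V1 \<union> V2" using a'a(2) *(6) by auto
      also have "\<dots> \<longleftrightarrow> x \<in> a' ` (V1 \<union> V2)"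
      proof
        assume x: "x \<in> topspace X' \<and> a x \<in> V1 \<union> V2"
        then have "x = a' (a x)" using a'a(1) by simp
        then show "x \<in> a' ` (V1 \<union> V2)" using x by (metis imageI)
      next
        assume "x \<in> a' ` (V1 \<union> V2)"
        then obtain v where v: "v \<in> V1 \<union> V2" "x = a' v" by (rule imageE)
        then have "v \<in> topspace X" using Vt by auto
        then show "x \<in> topspace X' \<and> a x \<in> V1 \<union> V2" using aa' v by simp
      qed
      finally show "x \<in> {x \<in> topspace X'. b (p (a x)) \<in> b ` U} \<longleftrightarrow> x \<in> a' ` V1 \<union> a' ` V2"
        by (simp add: image_Un)
    qed
    show "homeomorphic_map (subtopology X' (a' ` V1)) (subtopology Y' (b ` U)) (\<lambda>x. b (p (a x)))"
      "homeomorphic_map (subtopology X' (a' ` V2)) (subtopology Y' (b ` U)) (\<lambda>x. b (p (a x)))"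
      by (rule hm[OF Vt(1) *(7)], rule hm[OF Vt(2) *(8)])
  qed
qed

section \<open>Principal bundles with a global trivialization\<close>

lemma trivial_principal_bundle:
  assumes T: "topspace T = carrier G" "continuous_map (prod_topology T T) T (\<lambda>(x, y). x \<otimes>\<^bsub>G\<^esub> y)"
    and G: "monoid G"
    and \<Phi>: "homeomorphic_maps (prod_topology Z T) P \<Phi> \<Psi>" and \<iota>: "homeomorphic_maps Z X \<iota> \<kappa>"
    and act: "\<And>x s h. x \<in> topspace Z \<Longrightarrow> s \<in> carrier G \<Longrightarrow> h \<in> carrier G \<Longrightarrow> act (\<Phi> (x, s)) h = \<Phi> (x, s \<otimes>\<^bsub>G\<^esub> h)"
    and proj: "\<And>x s. x \<in> topspace Z \<Longrightarrow> s \<in> carrier G \<Longrightarrow> proj (\<Phi> (x, s)) = \<iota> x"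
  shows "principal_bundle G T X P act proj"
proof -
  interpret monoid G by (rule G)
  have \<Phi>c: "continuous_map (prod_topology Z T) P \<Phi>" and \<Psi>c: "continuous_map P (prod_topology Z T) \<Psi>"
    and \<iota>c: "continuous_map Z X \<iota>" and \<Psi>\<Phi>: "\<And>z. z \<in> topspace (prod_topology Z T) \<Longrightarrow> \<Psi> (\<Phi> z) = z"
    using \<Phi> \<iota> unfolding homeomorphic_maps_def by blast+
  have ex: "\<exists>x s. x \<in> topspace Z \<and> s \<in> carrier G \<and> b = \<Phi> (x, s) \<and> \<Psi> b = (x, s)" if "b \<in> topspace P" for b
  proof -
    have "\<Psi> b \<in> topspace Z \<times> carrier G" using continuous_map_funspace[OF \<Psi>c] that T by auto
    moreover have "b = \<Phi> (\<Psi> b)" using \<Phi> that by (simp add: homeomorphic_maps_def)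
    ultimately show ?thesis by (metis mem_Times_iff prod.collapse)
  qed
  have \<Psi>1: "continuous_map P Z (\<lambda>b. fst (\<Psi> b))" and \<Psi>2: "continuous_map P T (\<lambda>b. snd (\<Psi> b))"
    using \<Psi>c by (simp_all add: continuous_map_pairwise o_def)
  have pc: "continuous_map P X proj"
  proof (rule continuous_map_eq)
    show "continuous_map P X (\<iota> \<circ> (\<lambda>b. fst (\<Psi> b)))" by (rule continuous_map_compose[OF \<Psi>1 \<iota>c])
    show "(\<iota> \<circ> (\<lambda>b. fst (\<Psi> b))) b = proj b" if "b \<in> topspace P" for b
      using ex[OF that] proj by auto
  qed
  have ac: "continuous_map (prod_topology P T) P (\<lambda>(b, h). act b h)"
  proof (rule continuous_map_eq)
    let ?Q = "prod_topology P T"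
    have 1: "continuous_map ?Q Z (\<lambda>z. fst (\<Psi> (fst z)))" and 2: "continuous_map ?Q T (\<lambda>z. snd (\<Psi> (fst z)))"
      using continuous_map_compose[OF continuous_map_fst[of P T] \<Psi>1] continuous_map_compose[OF continuous_map_fst[of P T] \<Psi>2]
      by (simp_all add: o_def)
    have "continuous_map ?Q (prod_topology T T) (\<lambda>z. (snd (\<Psi> (fst z)), snd z))"
      using 2 continuous_map_snd[of P T] by (simp add: continuous_map_pairwise o_def)
    from continuous_map_compose[OF this T(2)]
    have "continuous_map ?Q T (\<lambda>z. snd (\<Psi> (fst z)) \<otimes>\<^bsub>G\<^esub> snd z)" by (simp add: o_def)
    then have "continuous_map ?Q (prod_topology Z T) (\<lambda>z. (fst (\<Psi> (fst z)), snd (\<Psi> (fst z)) \<otimes>\<^bsub>G\<^esub> snd z))"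
      using 1 by (simp add: continuous_map_pairwise o_def)
    from continuous_map_compose[OF this \<Phi>c]
    show "continuous_map ?Q P (\<lambda>z. \<Phi> (fst (\<Psi> (fst z)), snd (\<Psi> (fst z)) \<otimes>\<^bsub>G\<^esub> snd z))" by (simp add: o_def)
    fix z assume "z \<in> topspace ?Q"
    then have z: "fst z \<in> topspace P" "snd z \<in> carrier G"
      by (simp_all add: mem_Times_iff T(1))
    obtain x s where xs: "x \<in> topspace Z" "s \<in> carrier G" "fst z = \<Phi> (x, s)" "\<Psi> (fst z) = (x, s)"
      using ex[OF z(1)] by blast
    have "(case z of (b, h) \<Rightarrow> act b h) = act (\<Phi> (x, s)) (snd z)"
      by (simp only: split_def xs(3))
    also have "\<dots> = \<Phi> (x, s \<otimes>\<^bsub>G\<^esub> snd z)" by (rule act[OF xs(1,2) z(2)])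
    finally show "\<Phi> (fst (\<Psi> (fst z)), snd (\<Psi> (fst z)) \<otimes>\<^bsub>G\<^esub> snd z) = (case z of (b, h) \<Rightarrow> act b h)"
      by (simp only: xs(4) fst_conv snd_conv)
  qed
  have alg: "act b \<one>\<^bsub>G\<^esub> = b \<and>
        (\<forall>h\<in>carrier G. proj (act b h) = proj b \<and>
           (\<forall>k\<in>carrier G. act (act b h) k = act b (h \<otimes>\<^bsub>G\<^esub> k)))" if b: "b \<in> topspace P" for b
  proof -
    obtain x s where "x \<in> topspace Z" "s \<in> carrier G" "b = \<Phi> (x, s)" using ex[OF b] by blast
    then show ?thesis by (simp add: act proj m_assoc)
  qed
  \<comment> \<open>One trivialization over all of \<open>X\<close> serves every point.\<close>
  define \<psi> where "\<psi> b = (proj b, snd (\<Psi> b))" for b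
  have "homeomorphic_map P (prod_topology X T) \<psi>"
  proof (rule homeomorphic_map_eq)
    have "homeomorphic_map P (prod_topology Z T) \<Psi>" using \<Phi> by (meson homeomorphic_maps_map)
    moreover have "homeomorphic_map (prod_topology Z T) (prod_topology X T) (\<lambda>(z, t). (\<iota> z, id t))"
    proof (rule homeomorphic_maps_imp_map)
      have "homeomorphic_maps T T id id" by (simp add: homeomorphic_maps_def)
      then show "homeomorphic_maps (prod_topology Z T) (prod_topology X T) (\<lambda>(z, t). (\<iota> z, id t)) (\<lambda>(z, t). (\<kappa> z, id t))"
        using \<iota> by (intro homeomorphic_maps_prod[THEN iffD2] disjI2 conjI)
    qed
    ultimately show "homeomorphic_map P (prod_topology X T) ((\<lambda>(z, t). (\<iota> z, id t)) \<circ> \<Psi>)"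
      by (rule homeomorphic_map_compose)
    show "((\<lambda>(z, t). (\<iota> z, id t)) \<circ> \<Psi>) b = \<psi> b" if "b \<in> topspace P" for b
      using ex[OF that] proj by (auto simp: \<psi>_def)
  qed
  moreover have "{b \<in> topspace P. proj b \<in> topspace X} = topspace P"
    using continuous_map_funspace[OF pc] by auto
  ultimately have tr: "homeomorphic_map (subtopology P {b \<in> topspace P. proj b \<in> topspace X})
          (prod_topology (subtopology X (topspace X)) T) \<psi>"
    by simp
  have fr: "fst (\<psi> b) = proj b \<and> (\<forall>h\<in>carrier G. \<psi> (act b h) = (proj b, snd (\<psi> b) \<otimes>\<^bsub>G\<^esub> h))"
    if b: "b \<in> topspace P" for b
  proof -
    obtain x s where xs: "x \<in> topspace Z" "s \<in> carrier G" "b = \<Phi> (x, s)" "\<Psi> b = (x, s)" using ex[OF b] by blast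
    then have "\<Psi> (\<Phi> (x, s \<otimes>\<^bsub>G\<^esub> h)) = (x, s \<otimes>\<^bsub>G\<^esub> h)" if "h \<in> carrier G" for h
      using that T by (intro \<Psi>\<Phi>) simp
    then show ?thesis using xs by (simp add: \<psi>_def act proj)
  qed
  show ?thesis
    unfolding principal_bundle_def
  proof (intro conjI ballI)
    fix x assume "x \<in> topspace X"
    then show "\<exists>U \<psi>. openin X U \<and> x \<in> U \<and>
        homeomorphic_map (subtopology P {b \<in> topspace P. proj b \<in> U})
          (prod_topology (subtopology X U) T) \<psi> \<and>
        (\<forall>b\<in>topspace P. proj b \<in> U \<longrightarrow> fst (\<psi> b) = proj b \<and>
           (\<forall>h\<in>carrier G. \<psi> (act b h) = (proj b, snd (\<psi> b) \<otimes>\<^bsub>G\<^esub> h)))"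
      using tr fr by (intro exI[of _ "topspace X"] exI[of _ \<psi>]) simp
  qed (use pc ac alg in blast)+
qed

section \<open>The Clifford module and the spinor representation\<close>

locale spin_context =
  fixes D :: "'h spin_data"
  assumes spin_setup: "spin_setup D"
begin

abbreviation "m \<equiv> sd_dim D"
abbreviation "N \<equiv> sd_rank D"
abbreviation "G \<equiv> sd_grp D"
abbreviation "\<gamma> \<equiv> sd_gam D"
abbreviation "\<rho> \<equiv> sd_rep D"
abbreviation "cov \<equiv> sd_cov D"
abbreviation "Spin \<equiv> spin_carrier D"

lemma m_ge_2: "2 \<le> m"
  using spin_setup by (simp add: spin_setup_def)

lemma clifford_module: "irreducible_clifford_module D" and spinor_rep: "spinor_representation D"
  using spin_setup by (auto simp: spin_setup_def)

lemma N_pos: "0 < N"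
  using clifford_module by (simp add: irreducible_clifford_module_def Let_def)

lemma gamma_carrier: "i < m \<Longrightarrow> \<gamma> i \<in> carrier_mat N N"
  using clifford_module by (simp add: irreducible_clifford_module_def Let_def)

lemma gamma_rel:
  "i < m \<Longrightarrow> j < m \<Longrightarrow> \<gamma> i * \<gamma> j + \<gamma> j * \<gamma> i = (if i = j then - 2 else 0) \<cdot>\<^sub>m 1\<^sub>m N"
  using clifford_module by (simp add: irreducible_clifford_module_def Let_def)

lemma gamma_irreducible:
  assumes "W \<subseteq> carrier_vec N" "0\<^sub>v N \<in> W"
    "\<And>u w. u \<in> W \<Longrightarrow> w \<in> W \<Longrightarrow> u + w \<in> W" "\<And>z u. u \<in> W \<Longrightarrow> z \<cdot>\<^sub>v u \<in> W"
    "\<And>i u. i < m \<Longrightarrow> u \<in> W \<Longrightarrow> \<gamma> i *\<^sub>v u \<in> W"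
  shows "W = {0\<^sub>v N} \<or> W = carrier_vec N"
proof -
  have "\<forall>W. W \<subseteq> carrier_vec N \<and> 0\<^sub>v N \<in> W \<and>
           (\<forall>u\<in>W. \<forall>w\<in>W. u + w \<in> W) \<and> (\<forall>z. \<forall>u\<in>W. z \<cdot>\<^sub>v u \<in> W) \<and>
           (\<forall>i<m. \<forall>u\<in>W. \<gamma> i *\<^sub>v u \<in> W)
         \<longrightarrow> W = {0\<^sub>v N} \<or> W = carrier_vec N"
    using clifford_module unfolding irreducible_clifford_module_def Let_def by (elim conjE)
  from spec[OF this, of W] show ?thesis
    by (rule mp) (use assms in auto)
qed

lemma cliff_carrier [simp]: "cliff_mat D x \<in> carrier_mat N N"
  by (simp add: cliff_mat_def)

lemma cliff_mult_entry:
  assumes "a < N" "b < N"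
  shows "(cliff_mat D x * cliff_mat D y) $$ (a, b) =
    (\<Sum>i<m. \<Sum>j<m. of_real (x i * y j) * (\<gamma> i * \<gamma> j) $$ (a, b))"
proof -
  have gd: "dim_row (\<gamma> i) = N" "dim_col (\<gamma> i) = N" if "i < m" for i
    using gamma_carrier[OF that] by auto
  have "(cliff_mat D x * cliff_mat D y) $$ (a, b) =
    (\<Sum>k<N. (\<Sum>i<m. of_real (x i) * \<gamma> i $$ (a,k)) * (\<Sum>j<m. of_real (y j) * \<gamma> j $$ (k,b)))"
    using assms by (simp add: cliff_mat_def scalar_prod_def atLeast0LessThan)
  also have "\<dots> = (\<Sum>k<N. \<Sum>i<m. \<Sum>j<m. of_real (x i * y j) * (\<gamma> i $$ (a,k) * \<gamma> j $$ (k,b)))"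
    by (simp add: sum_product algebra_simps)
  also have "\<dots> = (\<Sum>i<m. \<Sum>j<m. of_real (x i * y j) * (\<Sum>k<N. \<gamma> i $$ (a,k) * \<gamma> j $$ (k,b)))"
    by (subst sum.swap, rule sum.cong, simp, subst sum.swap) (simp add: sum_distrib_left)
  also have "\<dots> = (\<Sum>i<m. \<Sum>j<m. of_real (x i * y j) * (\<gamma> i * \<gamma> j) $$ (a, b))"
    using assms by (intro sum.cong refl) (simp add: gd scalar_prod_def atLeast0LessThan)
  finally show ?thesis .
qed

text \<open>The relation of the generators, extended bilinearly; exchanging the two summation
  indices in the second product aligns it with the first.\<close>

lemma cliff_rel:
  "cliff_mat D x * cliff_mat D y + cliff_mat D y * cliff_mat D x =
    (- 2 * of_real (\<Sum>i<m. x i * y i)) \<cdot>\<^sub>m 1\<^sub>m N"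
proof (rule eq_matI)
  fix a b assume "a < dim_row ((- 2 * of_real (\<Sum>i<m. x i * y i) :: complex) \<cdot>\<^sub>m 1\<^sub>m N)"
    "b < dim_col ((- 2 * of_real (\<Sum>i<m. x i * y i) :: complex) \<cdot>\<^sub>m 1\<^sub>m N)"
  then have ab: "a < N" "b < N" by auto
  have gd: "dim_row (\<gamma> i) = N" "dim_col (\<gamma> i) = N" if "i < m" for i
    using gamma_carrier[OF that] by auto
  have rel: "(\<gamma> i * \<gamma> j) $$ (a, b) + (\<gamma> j * \<gamma> i) $$ (a, b) =
      (if i = j then - 2 * (1\<^sub>m N $$ (a, b)) else 0)" if "i < m" "j < m" for i j
    using arg_cong[OF gamma_rel[OF that], of "\<lambda>M. M $$ (a, b)"] ab that
    by (simp add: gd split: if_splits)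
  have dims: "dim_row (cliff_mat D x) = N" "dim_col (cliff_mat D x) = N" for x
    by (simp_all add: cliff_mat_def)
  have "(cliff_mat D x * cliff_mat D y + cliff_mat D y * cliff_mat D x) $$ (a, b)
      = (\<Sum>i<m. \<Sum>j<m. of_real (x i * y j) * (\<gamma> i * \<gamma> j) $$ (a, b)) +
        (\<Sum>i<m. \<Sum>j<m. of_real (x i * y j) * (\<gamma> j * \<gamma> i) $$ (a, b))"
    using ab by (simp add: dims cliff_mult_entry[OF ab] del: index_mult_mat(1) of_real_mult)
       (subst (2) sum.swap, simp add: mult.commute)
  also have "\<dots> = (\<Sum>i<m. \<Sum>j<m. of_real (x i * y j) * (if i = j then - 2 * (1\<^sub>m N $$ (a, b)) else 0))"
    using rel by (simp add: sum.distrib[symmetric] distrib_left[symmetric] del: index_mult_mat(1) of_real_mult)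
  also have "\<dots> = (\<Sum>i<m. of_real (x i * y i) * (- 2 * (1\<^sub>m N $$ (a, b))))"
    by (intro sum.cong refl) (simp add: if_distrib[of "\<lambda>t. _ * t"] cong: if_cong)
  finally show "(cliff_mat D x * cliff_mat D y + cliff_mat D y * cliff_mat D x) $$ (a, b)
      = ((- 2 * of_real (\<Sum>i<m. x i * y i)) \<cdot>\<^sub>m 1\<^sub>m N) $$ (a, b)"
    using ab by (simp add: sum_distrib_left sum_distrib_right mult_ac)
qed (simp_all add: cliff_mat_def)

lemma cliff_swap:
  "cliff_mat D x * cliff_mat D y =
    (- 2 * of_real (\<Sum>i<m. x i * y i)) \<cdot>\<^sub>m 1\<^sub>m N - cliff_mat D y * cliff_mat D x"
  unfolding cliff_rel[symmetric, of x y]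
  by (rule eq_matI) (simp_all add: cliff_mat_def)

lemma cliff_sq:
  assumes "(\<Sum>i<m. (x i)\<^sup>2) = 1"
  shows "cliff_mat D x * cliff_mat D x = - 1\<^sub>m N"
proof (rule eq_matI)
  fix a b assume "a < dim_row (- 1\<^sub>m N :: complex mat)" "b < dim_col (- 1\<^sub>m N :: complex mat)"
  moreover have "(cliff_mat D x * cliff_mat D x + cliff_mat D x * cliff_mat D x) $$ (a, b) =
      ((- 2 * of_real (\<Sum>i<m. x i * x i)) \<cdot>\<^sub>m 1\<^sub>m N) $$ (a, b)"
    by (simp only: cliff_rel)
  ultimately have "2 * (cliff_mat D x * cliff_mat D x) $$ (a, b) = 2 * (- 1\<^sub>m N $$ (a, b))"
    using assms by (simp add: power2_eq_square[symmetric] cliff_mat_def del: index_mult_mat(1))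
  then show "(cliff_mat D x * cliff_mat D x) $$ (a, b) = (- 1\<^sub>m N) $$ (a, b)"
    using \<open>a < _\<close> \<open>b < _\<close> by (simp del: index_mult_mat(1))
qed (simp_all add: cliff_mat_def)

section \<open>Products of vectors in the Clifford algebra, their reversal and their traces\<close>

definition cprod :: "(nat \<Rightarrow> real) list \<Rightarrow> complex mat" where
  "cprod xs = foldr (\<lambda>x A. cliff_mat D x * A) xs (1\<^sub>m N)"

lemma cprod_carrier [simp]: "cprod xs \<in> carrier_mat N N"
  by (induction xs) (auto simp: cprod_def intro!: mult_carrier_mat[of _ N N])

lemma cprod_Nil [simp]: "cprod [] = 1\<^sub>m N"
  and cprod_Cons: "cprod (x # xs) = cliff_mat D x * cprod xs"
  by (simp_all add: cprod_def)

lemma cprod_append: "cprod (xs @ ys) = cprod xs * cprod ys"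
  by (induction xs)
    (auto simp: cprod_Cons assoc_mult_mat[OF cliff_carrier cprod_carrier cprod_carrier]
      left_mult_one_mat[OF cprod_carrier])

lemma cprod_single [simp]: "cprod [x] = cliff_mat D x"
  by (simp add: cprod_Cons right_mult_one_mat[OF cliff_carrier])

text \<open>Equal unit vectors meet in the middle and cancel from the inside outwards, each leaving
  a factor -1. For even length the reversed product is thus the inverse.\<close>

lemma cprod_rev_mult:
  assumes "\<forall>x\<in>set xs. (\<Sum>i<m. (x i)\<^sup>2) = 1"
  shows "cprod (rev xs) * cprod xs = (-1) ^ length xs \<cdot>\<^sub>m 1\<^sub>m N"
  using assms
proof (induction xs)
  case (Cons x xs)
  have "cprod (rev (x # xs)) = cprod (rev xs) * cliff_mat D x"
    by (simp add: cprod_append)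
  then have "cprod (rev (x # xs)) * cprod (x # xs) =
      cprod (rev xs) * ((cliff_mat D x * cliff_mat D x) * cprod xs)"
    by (simp only: cprod_Cons)
      (simp add: assoc_mult_mat[of _ N N _ N _ N] mult_carrier_mat[of _ N N _ N])
  also have "(cliff_mat D x * cliff_mat D x) * cprod xs = - cprod xs"
    using Cons.prems
    by (simp add: cliff_sq left_mult_one_mat[of _ N N] carrier_matD(1)[OF cprod_carrier])
  also have "cprod (rev xs) * - cprod xs = - (cprod (rev xs) * cprod xs)"
    by (simp add: carrier_matD(1)[OF cprod_carrier] carrier_matD(2)[OF cprod_carrier])
  also have "\<dots> = - ((-1) ^ length xs \<cdot>\<^sub>m 1\<^sub>m N)"
    using Cons by simp
  also have "\<dots> = (-1) ^ length (x # xs) \<cdot>\<^sub>m 1\<^sub>m N"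
    by (rule eq_matI) auto
  finally show ?case .
qed (auto intro!: eq_matI)

definition tr :: "complex mat \<Rightarrow> complex" where
  "tr A = (\<Sum>i<N. A $$ (i, i))"

lemma tr_comm:
  assumes "A \<in> carrier_mat N N" "B \<in> carrier_mat N N"
  shows "tr (A * B) = tr (B * A)"
proof -
  have "tr (A * B) = (\<Sum>i<N. \<Sum>k<N. A $$ (i, k) * B $$ (k, i))"
    using assms by (simp add: tr_def scalar_prod_def atLeast0LessThan)
  also have "\<dots> = (\<Sum>k<N. \<Sum>i<N. B $$ (k, i) * A $$ (i, k))"
    by (subst sum.swap) (simp add: mult.commute)
  also have "\<dots> = tr (B * A)"
    using assms by (simp add: tr_def scalar_prod_def atLeast0LessThan)
  finally show ?thesis .
qed

lemma tr_minus: "A \<in> carrier_mat N N \<Longrightarrow> B \<in> carrier_mat N N \<Longrightarrow> tr (A - B) = tr A - tr B"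
  and tr_smult: "A \<in> carrier_mat N N \<Longrightarrow> tr (z \<cdot>\<^sub>m A) = z * tr A"
  by (auto simp: tr_def sum_subtractf sum_distrib_left sum_negf)

text \<open>Moving one factor through a Clifford product to the other end costs a sign and shorter products;
  the correction terms are the same for a product and for its reversal.\<close>

lemma tr_move:
  "\<exists>L. (\<forall>(a, l)\<in>set L. Suc (length l) = length ys) \<and>
     (\<forall>A\<in>carrier_mat N N. tr (A * (cliff_mat D x * cprod ys)) =
        (-1) ^ length ys * tr (A * (cprod ys * cliff_mat D x)) + (\<Sum>(a, l)\<leftarrow>L. a * tr (A * cprod l))) \<and>
     (\<forall>A\<in>carrier_mat N N. tr ((cprod (rev ys) * cliff_mat D x) * A) =
        (-1) ^ length ys * tr ((cliff_mat D x * cprod (rev ys)) * A) +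
        (\<Sum>(a, l)\<leftarrow>L. a * tr (cprod (rev l) * A)))"
proof (induction ys)
  case Nil
  show ?case by (rule exI[of _ "[]"]) (auto simp: left_mult_one_mat[OF cliff_carrier] right_mult_one_mat[OF cliff_carrier])
next
  case (Cons y ys)
  then obtain L where L: "\<forall>(a, l)\<in>set L. Suc (length l) = length ys"
    and L1: "\<And>A. A \<in> carrier_mat N N \<Longrightarrow> tr (A * (cliff_mat D x * cprod ys)) =
        (-1) ^ length ys * tr (A * (cprod ys * cliff_mat D x)) + (\<Sum>(a, l)\<leftarrow>L. a * tr (A * cprod l))"
    and L2: "\<And>A. A \<in> carrier_mat N N \<Longrightarrow> tr ((cprod (rev ys) * cliff_mat D x) * A) =
        (-1) ^ length ys * tr ((cliff_mat D x * cprod (rev ys)) * A) +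
        (\<Sum>(a, l)\<leftarrow>L. a * tr (cprod (rev l) * A))"
    by blast
  define c where "c = (- 2 * of_real (\<Sum>i<m. x i * y i) :: complex)"
  \<comment> \<open>The scalar part of exchanging x with y leaves the product over
    \<open>ys\<close>; the corrections of the tail acquire y in front, and the sign of the
    exchange.\<close>
  let ?L = "(c, ys) # map (\<lambda>(a, l). (- a, y # l)) L"
  let ?x = "cliff_mat D x" and ?y = "cliff_mat D y"
  have xy: "?x * ?y = c \<cdot>\<^sub>m 1\<^sub>m N - ?y * ?x"
    by (simp add: c_def cliff_swap[of x y])
  have yx: "?y * ?x = c \<cdot>\<^sub>m 1\<^sub>m N - ?x * ?y"
    by (simp add: c_def cliff_swap[of y x] mult.commute)
  note as = assoc_mult_mat[of _ N N _ N _ N]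
  note [simp] = mult_carrier_mat[of _ N N _ N] left_mult_one_mat[of _ N N] right_mult_one_mat[of _ N N]
  have smd: "(c \<cdot>\<^sub>m 1\<^sub>m N - P) * R = c \<cdot>\<^sub>m R - P * R"
    "R * (c \<cdot>\<^sub>m 1\<^sub>m N - P) = c \<cdot>\<^sub>m R - R * P"
    if "P \<in> carrier_mat N N" "R \<in> carrier_mat N N" for P R :: "complex mat"
    using that by (simp_all add: minus_mult_distrib_mat[of _ N N] mult_minus_distrib_mat[of _ N N _ N]
        left_mult_one_mat[of _ N N] right_mult_one_mat[of _ N N]
        mult_smult_distrib[of _ N N _ N] mult_smult_assoc_mat[of _ N N _ N])
  have smd2: "R * (c \<cdot>\<^sub>m Q - P) = c \<cdot>\<^sub>m (R * Q) - R * P"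
     "(c \<cdot>\<^sub>m Q - P) * R = c \<cdot>\<^sub>m (Q * R) - P * R"
    if "P \<in> carrier_mat N N" "Q \<in> carrier_mat N N" "R \<in> carrier_mat N N" for P Q R :: "complex mat"
    using that by (simp_all add: minus_mult_distrib_mat[of _ N N] mult_minus_distrib_mat[of _ N N _ N]
        mult_smult_distrib[of _ N N _ N] mult_smult_assoc_mat[of _ N N _ N])
  show ?case
  proof (intro exI[of _ ?L] conjI ballI)
    show "case p of (a, l) \<Rightarrow> Suc (length l) = length (y # ys)" if "p \<in> set ?L" for p
      using that L by auto
  next
    fix A :: "complex mat" assume A: "A \<in> carrier_mat N N"
    have "tr (A * (?x * cprod (y # ys))) = tr (A * ((?x * ?y) * cprod ys))"
      using A by (simp add: cprod_Cons as)
    also have "\<dots> = c * tr (A * cprod ys) - tr ((A * ?y) * (?x * cprod ys))"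
      using A by (simp add: xy smd smd2 tr_minus tr_smult as)
    \<comment> \<open>The quantifier over \<open>A\<close> pays off here: the factor of y is
      absorbed into it before the induction hypothesis is applied.\<close>
    also have "tr ((A * ?y) * (?x * cprod ys)) =
      (-1) ^ length ys * tr ((A * ?y) * (cprod ys * ?x)) + (\<Sum>(a, l)\<leftarrow>L. a * tr ((A * ?y) * cprod l))"
      using A by (intro L1) simp
    also have "(A * ?y) * (cprod ys * ?x) = A * (cprod (y # ys) * ?x)"
      using A by (simp add: cprod_Cons as)
    also have "(\<Sum>(a, l)\<leftarrow>L. a * tr ((A * ?y) * cprod l)) = - (\<Sum>(a, l)\<leftarrow>map (\<lambda>(a, l). (- a, y # l)) L. a * tr (A * cprod l))"
      using A by (simp add: o_def split_def cprod_Cons as uminus_sum_list_map)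
    finally show "tr (A * (?x * cprod (y # ys))) =
        (-1) ^ length (y # ys) * tr (A * (cprod (y # ys) * ?x)) + (\<Sum>(a, l)\<leftarrow>?L. a * tr (A * cprod l))"
      by simp
  next
    fix A :: "complex mat" assume A: "A \<in> carrier_mat N N"
    have "tr ((cprod (rev (y # ys)) * ?x) * A) = tr ((cprod (rev ys) * (?y * ?x)) * A)"
      using A by (simp add: cprod_append as)
    also have "\<dots> = c * tr (cprod (rev ys) * A) - tr ((cprod (rev ys) * ?x) * (?y * A))"
      using A by (simp add: yx smd smd2 tr_minus tr_smult as)
    also have "tr ((cprod (rev ys) * ?x) * (?y * A)) =
      (-1) ^ length ys * tr ((?x * cprod (rev ys)) * (?y * A)) + (\<Sum>(a, l)\<leftarrow>L. a * tr (cprod (rev l) * (?y * A)))"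
      using A by (intro L2) simp
    also have "(?x * cprod (rev ys)) * (?y * A) = (?x * cprod (rev (y # ys))) * A"
      using A by (simp add: cprod_append as)
    also have "(\<Sum>(a, l)\<leftarrow>L. a * tr (cprod (rev l) * (?y * A))) = - (\<Sum>(a, l)\<leftarrow>map (\<lambda>(a, l). (- a, y # l)) L. a * tr (cprod (rev l) * A))"
      using A by (simp add: o_def split_def cprod_append as uminus_sum_list_map)
    finally show "tr ((cprod (rev (y # ys)) * ?x) * A) =
        (-1) ^ length (y # ys) * tr ((?x * cprod (rev (y # ys))) * A) + (\<Sum>(a, l)\<leftarrow>?L. a * tr (cprod (rev l) * A))"
      by simp
  qed
qed

text \<open>With even length the moved factor faces an odd tail, so by cyclicity of the trace twice
  the trace is a sum over shorter products, with the same coefficients before and after reversal.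
  Evenness matters: for \<open>m = 3\<close> the product of the three generators acts as a sign and
  its reversal as the opposite sign.\<close>

lemma tr_cprod_rev: "even (length xs) \<Longrightarrow> tr (cprod (rev xs)) = tr (cprod xs)"
proof (induction "length xs" arbitrary: xs rule: less_induct)
  case less
  show ?case
  proof (cases xs)
    case (Cons x ys)
    then have odd: "odd (length ys)" using less.prems by simp
    from tr_move[of ys x] obtain L where L: "\<forall>(a, l)\<in>set L. Suc (length l) = length ys"
      and L1: "\<And>A. A \<in> carrier_mat N N \<Longrightarrow> tr (A * (cliff_mat D x * cprod ys)) =
        (-1) ^ length ys * tr (A * (cprod ys * cliff_mat D x)) + (\<Sum>(a, l)\<leftarrow>L. a * tr (A * cprod l))"
      and L2: "\<And>A. A \<in> carrier_mat N N \<Longrightarrow> tr ((cprod (rev ys) * cliff_mat D x) * A) =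
        (-1) ^ length ys * tr ((cliff_mat D x * cprod (rev ys)) * A) +
        (\<Sum>(a, l)\<leftarrow>L. a * tr (cprod (rev l) * A))"
      by blast
    note [simp] = mult_carrier_mat[of _ N N _ N] left_mult_one_mat[of _ N N] right_mult_one_mat[of _ N N]
    \<comment> \<open>The corrections are shorter by two, so their length is even again.\<close>
    have IH: "tr (cprod (rev l)) = tr (cprod l)" if "(a, l) \<in> set L" for a l
    proof -
      have "Suc (length l) = length ys" using L that by auto
      then show ?thesis using odd less.hyps[of l] Cons by (cases ys) auto
    qed
    have "2 * tr (cprod xs) = (\<Sum>(a, l)\<leftarrow>L. a * tr (cprod l))"
      using L1[of "1\<^sub>m N"] odd tr_comm[of "cprod ys" "cliff_mat D x"] Cons by (simp add: cprod_Cons)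
    also have "\<dots> = (\<Sum>(a, l)\<leftarrow>L. a * tr (cprod (rev l)))"
      using IH by (intro arg_cong[of _ _ sum_list] map_cong) auto
    also have "\<dots> = 2 * tr (cprod (rev xs))"
      using L2[of "1\<^sub>m N"] odd tr_comm[of "cprod (rev ys)" "cliff_mat D x"] Cons by (simp add: cprod_append)
    finally show ?thesis by simp
  qed simp
qed

section \<open>Schur's lemma and scalar Clifford products\<close>

lemma cliff_commutant:
  assumes Q: "Q \<in> carrier_mat N N" and comm: "\<And>i. i < m \<Longrightarrow> Q * \<gamma> i = \<gamma> i * Q"
  shows "\<exists>z. Q = z \<cdot>\<^sub>m 1\<^sub>m N"
proof -
  from spectrum_non_empty[OF Q N_pos] obtain z where "eigenvalue Q z"
    by (auto simp: spectrum_def)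
  then obtain v where v: "v \<in> carrier_vec N" "v \<noteq> 0\<^sub>v N" "Q *\<^sub>v v = z \<cdot>\<^sub>v v"
    using Q by (auto simp: eigenvalue_def eigenvector_def)
  \<comment> \<open>An eigenspace of an operator commuting with the generators is invariant under
    them; it is not zero, so irreducibility makes it everything.\<close>
  define W where "W = {w \<in> carrier_vec N. Q *\<^sub>v w = z \<cdot>\<^sub>v w}"
  have "W = {0\<^sub>v N} \<or> W = carrier_vec N"
  proof (rule gamma_irreducible)
    show "0\<^sub>v N \<in> W" using Q by (auto simp: W_def intro!: eq_vecI)
    show "u + w \<in> W" if "u \<in> W" "w \<in> W" for u w
      using that Q by (auto simp: W_def mult_add_distrib_mat_vec smult_add_distrib_vec)
    show "a \<cdot>\<^sub>v u \<in> W" if "u \<in> W" for a u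
      using that Q by (auto simp: W_def mult_mat_vec smult_smult_assoc mult.commute)
    show "\<gamma> i *\<^sub>v u \<in> W" if "i < m" "u \<in> W" for i u
    proof -
      have u: "u \<in> carrier_vec N" "Q *\<^sub>v u = z \<cdot>\<^sub>v u" using that by (auto simp: W_def)
      have "Q *\<^sub>v (\<gamma> i *\<^sub>v u) = (Q * \<gamma> i) *\<^sub>v u"
        using Q gamma_carrier[OF that(1)] u by (simp add: assoc_mult_mat_vec[of _ N N _ N])
      also have "\<dots> = \<gamma> i *\<^sub>v (Q *\<^sub>v u)"
        using Q gamma_carrier[OF that(1)] u by (simp add: comm[OF that(1)] assoc_mult_mat_vec[of _ N N _ N])
      finally show ?thesis
        using u gamma_carrier[OF that(1)] by (auto simp: W_def mult_mat_vec mult_mat_vec_carrier[of _ N N])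
    qed
  qed (auto simp: W_def)
  moreover have "v \<in> W" using v by (simp add: W_def)
  ultimately have W: "W = carrier_vec N" using v by auto
  have "Q = z \<cdot>\<^sub>m 1\<^sub>m N"
  proof (rule eq_matI)
    fix i j assume "i < dim_row (z \<cdot>\<^sub>m 1\<^sub>m N)" "j < dim_col (z \<cdot>\<^sub>m 1\<^sub>m N)"
    then have ij: "i < N" "j < N" by auto
    have "unit_vec N j \<in> W" using W by simp
    then have "Q *\<^sub>v unit_vec N j = z \<cdot>\<^sub>v unit_vec N j" by (simp add: W_def)
    then have "vec_index (Q *\<^sub>v unit_vec N j) i = vec_index (z \<cdot>\<^sub>v unit_vec N j) i" by simp
    then show "Q $$ (i, j) = (z \<cdot>\<^sub>m 1\<^sub>m N) $$ (i, j)"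
      using ij Q by (simp add: scalar_prod_right_unit)
  qed (use Q in auto)
  then show ?thesis ..
qed

text \<open>The reversed product is the inverse, here 1/z, and has the same trace, so 1/z = z.
  Comparing traces bypasses the question whether reversal is well defined on the operators of the
  module.\<close>

lemma cprod_scalar_sq:
  assumes "even (length xs)" "\<forall>x\<in>set xs. (\<Sum>i<m. (x i)\<^sup>2) = 1" "cprod xs = z \<cdot>\<^sub>m 1\<^sub>m N"
  shows "z\<^sup>2 = 1"
proof -
  note [simp] = left_mult_one_mat[of _ N N] right_mult_one_mat[of _ N N]
  have one: "1 \<cdot>\<^sub>m 1\<^sub>m N = (1\<^sub>m N :: complex mat)" by (rule eq_matI) auto
  have tr1: "tr (1\<^sub>m N) = of_nat N" by (simp add: tr_def)
  have "cprod (rev xs) * (z \<cdot>\<^sub>m 1\<^sub>m N) = 1\<^sub>m N"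
    using cprod_rev_mult[OF assms(2)] assms(1,3) one by simp
  then have "z \<cdot>\<^sub>m cprod (rev xs) = 1\<^sub>m N"
    by (simp add: mult_smult_distrib[of _ N N _ N])
  then have "z * tr (cprod (rev xs)) = of_nat N"
    by (metis tr1 tr_smult cprod_carrier)
  moreover have "tr (cprod (rev xs)) = z * of_nat N"
    using tr_cprod_rev[OF assms(1)] assms(3) by (simp add: tr_smult tr1)
  ultimately have "z * (z * of_nat N) = of_nat N" by simp
  then show ?thesis using N_pos by (simp add: power2_eq_square)
qed

section \<open>The double covering group, its subgroup Spin and the spinor representation\<close>

lemma group_G: "group G"
  and cov_hom: "cov \<in> hom G (GL_pos m)"
  using spin_setup by (auto simp: spin_setup_def topological_group_def)

lemma cov_carrier: "h \<in> carrier G \<Longrightarrow> cov h \<in> carrier_mat m m"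
  and cov_det: "h \<in> carrier G \<Longrightarrow> 0 < Determinant.det (cov h)"
  and cov_mult: "h \<in> carrier G \<Longrightarrow> k \<in> carrier G \<Longrightarrow> cov (h \<otimes>\<^bsub>G\<^esub> k) = cov h * cov k"
  using cov_hom by (auto simp: hom_def GL_pos_def Pi_iff)

text \<open>Multiplicativity only makes the image of the unit idempotent; its positive determinant
  makes it invertible, and an invertible idempotent is the identity.\<close>

lemma cov_one: "cov \<one>\<^bsub>G\<^esub> = 1\<^sub>m m"
proof -
  interpret group G by (rule group_G)
  let ?A = "cov \<one>\<^bsub>G\<^esub>"
  have A: "?A \<in> carrier_mat m m" and d: "Determinant.det ?A \<noteq> 0"
    using cov_carrier[of "\<one>\<^bsub>G\<^esub>"] cov_det[of "\<one>\<^bsub>G\<^esub>"] by auto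
  have "?A \<in> Units (ring_mat TYPE(real) m ())"
    by (rule det_non_zero_imp_unit[OF A d])
  then obtain B where B: "B \<in> carrier_mat m m" "B * ?A = 1\<^sub>m m"
    by (auto simp: Units_def ring_mat_def)
  have "?A = (B * ?A) * ?A" using A B by simp
  also have "\<dots> = B * (?A * ?A)" by (rule assoc_mult_mat[OF B(1) A A])
  also have "?A * ?A = ?A" using cov_mult[of "\<one>\<^bsub>G\<^esub>" "\<one>\<^bsub>G\<^esub>"] by simp
  finally show ?thesis using B by simp
qed

lemma Spin_subset: "h \<in> Spin \<Longrightarrow> h \<in> carrier G"
  by (simp add: spin_carrier_def)

lemma SO_mult: "A \<in> SO_mats m \<Longrightarrow> B \<in> SO_mats m \<Longrightarrow> A * B \<in> SO_mats m"
proof -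
  assume AB: "A \<in> SO_mats m" "B \<in> SO_mats m"
  then have c: "A \<in> carrier_mat m m" "B \<in> carrier_mat m m" by (auto simp: SO_mats_def)
  have "transpose_mat (A * B) * (A * B) = transpose_mat B * ((transpose_mat A * A) * B)"
    using c by (simp add: transpose_mult[of _ m m _ m] assoc_mult_mat[of _ m m _ m _ m] mult_carrier_mat[of _ m m _ m])
  also have "\<dots> = transpose_mat B * B"
    using AB c by (simp only: SO_mats_def mem_Collect_eq left_mult_one_mat[OF c(2)])
  finally show ?thesis
    using AB c by (auto simp: SO_mats_def det_mult[of _ m])
qed

lemma Spin_one: "\<one>\<^bsub>G\<^esub> \<in> Spin"
  using group.is_monoid[OF group_G] by (auto simp: spin_carrier_def cov_one SO_mats_def monoid.one_closed)

lemma Spin_mult: "h \<in> Spin \<Longrightarrow> k \<in> Spin \<Longrightarrow> h \<otimes>\<^bsub>G\<^esub> k \<in> Spin"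
  using group.is_monoid[OF group_G]
  by (auto simp: spin_carrier_def cov_mult SO_mult monoid.m_closed)

lemma cov_inv:
  assumes "h \<in> carrier G"
  shows "cov (inv\<^bsub>G\<^esub> h) * cov h = 1\<^sub>m m" "cov h * cov (inv\<^bsub>G\<^esub> h) = 1\<^sub>m m"
  using cov_mult[of h "inv\<^bsub>G\<^esub> h"] cov_mult[of "inv\<^bsub>G\<^esub> h" h] assms group_G cov_one
  by (simp_all add: group.l_inv group.r_inv group.inv_closed)

lemma Spin_inv: assumes "h \<in> Spin" shows "inv\<^bsub>G\<^esub> h \<in> Spin"
proof -
  have h: "h \<in> carrier G" and SO: "cov h \<in> SO_mats m" using assms by (auto simp: spin_carrier_def)
  have i: "inv\<^bsub>G\<^esub> h \<in> carrier G" using group_G h by (simp add: group.inv_closed)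
  have c: "cov h \<in> carrier_mat m m" "cov (inv\<^bsub>G\<^esub> h) \<in> carrier_mat m m"
    using h i cov_carrier by auto
  let ?T = "transpose_mat (cov h)"
  have T: "?T * cov h = 1\<^sub>m m" "?T \<in> carrier_mat m m" "Determinant.det (cov h) = 1"
    using SO by (auto simp: SO_mats_def)
  have "cov (inv\<^bsub>G\<^esub> h) = (?T * cov h) * cov (inv\<^bsub>G\<^esub> h)" using T c by simp
  also have "\<dots> = ?T * (cov h * cov (inv\<^bsub>G\<^esub> h))" by (rule assoc_mult_mat[OF T(2) c])
  finally have eq: "cov (inv\<^bsub>G\<^esub> h) = ?T" using T cov_inv(2)[OF h] by simp
  have "transpose_mat ?T * ?T = 1\<^sub>m m"
    using cov_inv(2)[OF h] by (simp add: eq)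
  then show ?thesis using T i
    by (auto simp: spin_carrier_def SO_mats_def eq det_transpose[OF c(1)])
qed

lemma rho_mult: "h \<in> Spin \<Longrightarrow> k \<in> Spin \<Longrightarrow> \<rho> (h \<otimes>\<^bsub>G\<^esub> k) = \<rho> h * \<rho> k"
  using spinor_rep by (simp add: spinor_representation_def Let_def)

lemma rho_cprod:
  assumes "h \<in> Spin"
  obtains xs where "even (length xs)" "\<forall>x\<in>set xs. (\<Sum>i<m. (x i)\<^sup>2) = 1" "\<rho> h = cprod xs"
  using spinor_rep assms by (auto simp: spinor_representation_def Let_def cprod_def)

lemma rho_cliff:
  assumes "h \<in> Spin"
  shows "\<rho> h * cliff_mat D x = cliff_mat D (\<lambda>i. \<Sum>j<m. cov h $$ (i, j) * x j) * \<rho> h"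
  using spinor_rep assms by (auto simp: spinor_representation_def Let_def)

lemma rho_carrier: "h \<in> Spin \<Longrightarrow> \<rho> h \<in> carrier_mat N N"
  by (metis rho_cprod cprod_carrier)

text \<open>Again an invertible idempotent: the left inverse is the reversed product of the unit
  vectors.\<close>

lemma rho_one: "\<rho> \<one>\<^bsub>G\<^esub> = 1\<^sub>m N"
proof -
  let ?R = "\<rho> \<one>\<^bsub>G\<^esub>"
  obtain xs where xs: "even (length xs)" "\<forall>x\<in>set xs. (\<Sum>i<m. (x i)\<^sup>2) = 1" "?R = cprod xs"
    using rho_cprod[OF Spin_one] .
  have R: "?R \<in> carrier_mat N N" by (rule rho_carrier[OF Spin_one])
  have B: "cprod (rev xs) * ?R = 1\<^sub>m N"
    using cprod_rev_mult[OF xs(2)] xs(1,3) by (auto intro!: eq_matI)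
  have "?R = (cprod (rev xs) * ?R) * ?R" using R B by simp
  also have "\<dots> = cprod (rev xs) * (?R * ?R)" using R by (simp add: assoc_mult_mat[of _ N N _ N _ N])
  also have "?R * ?R = ?R"
    using rho_mult[OF Spin_one Spin_one] group.is_monoid[OF group_G] by (simp add: monoid.l_one monoid.one_closed)
  finally show ?thesis using B by simp
qed

lemma rho_inv:
  assumes "h \<in> Spin"
  shows "\<rho> (inv\<^bsub>G\<^esub> h) * \<rho> h = 1\<^sub>m N" "\<rho> h * \<rho> (inv\<^bsub>G\<^esub> h) = 1\<^sub>m N"
  using assms rho_mult[OF assms Spin_inv[OF assms]] rho_mult[OF Spin_inv[OF assms] assms] rho_one
    Spin_subset[OF assms] group_G
  by (simp_all add: group.l_inv group.r_inv)

section \<open>Conjugation of vectors by unit vectors and by half-angle operators\<close>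

definition basis_fun :: "nat \<Rightarrow> nat \<Rightarrow> real" where
  "basis_fun i = (\<lambda>j. if j = i then 1 else 0)"

lemma cliff_unit: assumes "i < m" shows "cliff_mat D (basis_fun i) = \<gamma> i"
proof (rule eq_matI)
  show "dim_row (cliff_mat D (basis_fun i)) = dim_row (\<gamma> i)" "dim_col (cliff_mat D (basis_fun i)) = dim_col (\<gamma> i)"
    using gamma_carrier[OF assms] by (auto simp: cliff_mat_def)
  fix a b assume "a < dim_row (\<gamma> i)" "b < dim_col (\<gamma> i)"
  then have "a < N" "b < N" using gamma_carrier[OF assms] by auto
  then show "cliff_mat D (basis_fun i) $$ (a, b) = \<gamma> i $$ (a, b)"
    using assms by (simp add: cliff_mat_def basis_fun_def if_distrib[of "\<lambda>t. of_real t * _"] cong: if_cong)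
qed

lemma cliff_cong: "(\<And>i. i < m \<Longrightarrow> x i = y i) \<Longrightarrow> cliff_mat D x = cliff_mat D y"
  by (auto simp: cliff_mat_def intro!: eq_matI sum.cong)

text \<open>Conjugation by a unit vector acts on vectors as minus the reflection in its orthogonal
  hyperplane.\<close>

lemma cliff_reflect:
  assumes "(\<Sum>i<m. (y i)\<^sup>2) = 1"
  shows "cliff_mat D y * cliff_mat D x =
    cliff_mat D (\<lambda>i. 2 * (\<Sum>j<m. x j * y j) * y i - x i) * cliff_mat D y"
proof -
  let ?a = "\<Sum>j<m. x j * y j"
  have lin: "cliff_mat D (\<lambda>i. 2 * ?a * y i - x i) = complex_of_real (2 * ?a) \<cdot>\<^sub>m cliff_mat D y - cliff_mat D x"
    by (rule eq_matI) (auto simp: cliff_mat_def sum_distrib_left sum_subtractf algebra_simps)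
  have "cliff_mat D (\<lambda>i. 2 * ?a * y i - x i) * cliff_mat D y =
      complex_of_real (2 * ?a) \<cdot>\<^sub>m (cliff_mat D y * cliff_mat D y) - cliff_mat D x * cliff_mat D y"
    unfolding lin
    by (subst minus_mult_distrib_mat[of _ N N _ _ N], simp_all del: of_real_mult of_real_sum)
      (subst mult_smult_assoc_mat[of _ N N _ N], simp_all del: of_real_mult of_real_sum)
  also have "\<dots> = (- 2 * of_real ?a) \<cdot>\<^sub>m 1\<^sub>m N - cliff_mat D x * cliff_mat D y"
    unfolding cliff_sq[OF assms] by (auto intro!: eq_matI simp: cliff_mat_def)
  also have "\<dots> = cliff_mat D y * cliff_mat D x"
    by (subst (2) cliff_swap) (simp add: mult.commute)
  finally show ?thesis by simp
qed

text \<open>The half-angle operator \<open>C + S \<gamma>\<^sub>0 \<gamma>\<^sub>1\<close> implements the rotation by \<open>(c, s)\<close>, so \<open>\<rho> h\<close> is a scalar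
  multiple of it; the scalar is a sign because its multiple of \<open>1\<close> is an even product of unit vectors.\<close>

lemma rho_rotation:
  assumes h: "h \<in> Spin" and cs: "c\<^sup>2 + s\<^sup>2 = 1" "- 1 < c"
    and cov0: "\<And>i. i < m \<Longrightarrow> cov h $$ (i, 0) = (if i = 0 then c else if i = 1 then s else 0)"
    and cov1: "\<And>i. i < m \<Longrightarrow> cov h $$ (i, 1) = (if i = 0 then - s else if i = 1 then c else 0)"
    and cov2: "\<And>i j. i < m \<Longrightarrow> 2 \<le> j \<Longrightarrow> j < m \<Longrightarrow> cov h $$ (i, j) = (if i = j then 1 else 0)"
  shows "\<exists>k. k\<^sup>2 = complex_of_real (2 + 2 * c) \<and> \<rho> h + \<rho> (inv\<^bsub>G\<^esub> h) = k \<cdot>\<^sub>m 1\<^sub>m N"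
proof -
  \<comment> \<open>Cosine and sine of the half angle. The assumption \<open>- 1 < c\<close> keeps
    \<open>C\<close> positive, so that \<open>S\<close> can be recovered from
    \<open>s = 2 * S * C\<close>.\<close>
  define C where "C = sqrt ((1 + c) / 2)"
  define S where "S = s / (2 * C)"
  have Cpos: "0 < C" and C2: "C\<^sup>2 = (1 + c) / 2" using cs(2) by (auto simp: C_def)
  have SC: "s = 2 * S * C" using Cpos by (simp add: S_def)
  have "s\<^sup>2 = (1 - c) * (1 + c)" using cs(1) by (simp add: power2_eq_square algebra_simps)
  moreover have "s\<^sup>2 = 4 * S\<^sup>2 * C\<^sup>2" by (simp add: SC power_mult_distrib)
  moreover have "1 + c = 2 * C\<^sup>2" by (simp add: C2)
  ultimately have "4 * S\<^sup>2 * C\<^sup>2 = 2 * (1 - c) * C\<^sup>2"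
    by (metis mult.assoc mult.left_commute)
  moreover have "C\<^sup>2 \<noteq> 0" using Cpos by simp
  ultimately have "4 * S\<^sup>2 = 2 * (1 - c)" by (metis mult_right_cancel)
  then have S2: "S\<^sup>2 = (1 - c) / 2" by simp
  have c_eq: "c = C\<^sup>2 - S\<^sup>2" and CS1: "C\<^sup>2 + S\<^sup>2 = 1" using C2 S2 by (simp_all add: field_simps)
  \<comment> \<open>Up to orientation, e and -y enclose half the angle. The Clifford product of e
    and y is the half-angle operator, and the product in the opposite order is its inverse.\<close>
  let ?e = "basis_fun 0" and ?y = "\<lambda>j. if j = 0 then - C else if j = 1 then S else (0 :: real)"
  have m2: "0 < m" "1 < m" using m_ge_2 by auto
  note as = assoc_mult_mat[of _ N N _ N _ N]
  note [simp] = mult_carrier_mat[of _ N N _ N] left_mult_one_mat[of _ N N] right_mult_one_mat[of _ N N]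
  have g0: "\<gamma> 0 \<in> carrier_mat N N" and g1: "\<gamma> 1 \<in> carrier_mat N N" using m2 gamma_carrier by auto
  have sum01: "(\<Sum>i<m. f i) = f 0 + f 1" if "\<And>i. 2 \<le> i \<Longrightarrow> i < m \<Longrightarrow> f i = 0" for f :: "nat \<Rightarrow> 'b::comm_monoid_add"
  proof -
    have "(\<Sum>i<m. f i) = (\<Sum>i\<in>{0, 1}. f i)"
      by (rule sum.mono_neutral_right) (use m2 in \<open>auto intro!: that\<close>)
    then show ?thesis by simp
  qed
  have ue: "(\<Sum>i<m. (?e i)\<^sup>2) = 1" "(\<Sum>i<m. (?y i)\<^sup>2) = 1"
    using CS1 by (subst sum01; simp add: basis_fun_def)+
  define R where "R = cprod [?e, ?y]"
  define R' where "R' = cprod [?y, ?e]"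
  have Rc: "R \<in> carrier_mat N N" "R' \<in> carrier_mat N N" by (simp_all add: R_def R'_def)
  have R'R: "R' * R = 1\<^sub>m N" and RR': "R * R' = 1\<^sub>m N"
    using cprod_rev_mult[of "[?e, ?y]"] cprod_rev_mult[of "[?y, ?e]"] ue
    by (auto simp: R_def R'_def intro!: eq_matI)
  have "cliff_mat D ?e * cliff_mat D ?y + cliff_mat D ?y * cliff_mat D ?e = complex_of_real (2 * C) \<cdot>\<^sub>m 1\<^sub>m N"
    unfolding cliff_rel by (subst sum01) (auto simp: basis_fun_def)
  then have RR: "R + R' = complex_of_real (2 * C) \<cdot>\<^sub>m 1\<^sub>m N"
    by (simp add: R_def R'_def cprod_Cons right_mult_one_mat[OF cliff_carrier])
  \<comment> \<open>Two reflections compose to the rotation by twice the angle between their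
    normals; the two signs from \<open>cliff_reflect\<close> cancel.\<close>
  have Rconj: "R * cliff_mat D x = cliff_mat D (\<lambda>i. \<Sum>j<m. cov h $$ (i, j) * x j) * R" for x
  proof -
    let ?z = "\<lambda>i. 2 * (\<Sum>j<m. x j * ?y j) * ?y i - x i"
    let ?w = "\<lambda>i. 2 * (\<Sum>j<m. ?z j * ?e j) * ?e i - ?z i"
    have "R * cliff_mat D x = cliff_mat D ?e * (cliff_mat D ?y * cliff_mat D x)"
      by (simp add: R_def cprod_Cons as right_mult_one_mat[OF cliff_carrier])
    also have "\<dots> = (cliff_mat D ?e * cliff_mat D ?z) * cliff_mat D ?y"
      unfolding cliff_reflect[OF ue(2)] by (simp add: as)
    also have "\<dots> = cliff_mat D ?w * R"
      unfolding cliff_reflect[OF ue(1)] by (simp add: R_def cprod_Cons as right_mult_one_mat[OF cliff_carrier])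
    also have "cliff_mat D ?w = cliff_mat D (\<lambda>i. \<Sum>j<m. cov h $$ (i, j) * x j)"
    proof (rule cliff_cong)
      fix i assume i: "i < m"
      have xy: "(\<Sum>j<m. x j * ?y j) = S * x 1 - C * x 0" by (subst sum01) auto
      have ze: "(\<Sum>j<m. ?z j * ?e j) = ?z 0" by (subst sum01) (auto simp: basis_fun_def)
      show "?w i = (\<Sum>j<m. cov h $$ (i, j) * x j)"
      proof (cases "i < 2")
        case True
        have *: "(\<Sum>j<m. cov h $$ (i, j) * x j) = cov h $$ (i, 0) * x 0 + cov h $$ (i, 1) * x 1"
          using True cov2[OF i] by (subst sum01) auto
        have "i = 0 \<or> i = 1" using True by auto
        then show ?thesis
        proof
          assume [simp]: "i = 0"
          have "2 * (S * x 1 - C * x 0) * - C - x 0 = c * x 0 + - s * x 1"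
          proof -
            have c: "c = 2 * C * C - 1" using C2 by (simp add: field_simps power2_eq_square)
            show ?thesis unfolding c SC by (simp add: algebra_simps)
          qed
          then show ?thesis
            unfolding * ze unfolding xy using cov0[OF i] cov1[OF i] by (simp add: basis_fun_def)
        next
          assume [simp]: "i = 1"
          have "- (2 * (S * x 1 - C * x 0) * S - x 1) = s * x 0 + c * x 1"
          proof -
            have c: "c = 1 - 2 * S * S" using S2 by (simp add: field_simps power2_eq_square)
            show ?thesis unfolding c SC by (simp add: algebra_simps)
          qed
          then show ?thesis
            unfolding * ze unfolding xy using cov0[OF i] cov1[OF i] by (simp add: basis_fun_def)
        qed
      next
        case False
        have "(\<Sum>j<m. cov h $$ (i, j) * x j) = (\<Sum>j<m. if j = i then x j else 0)"
        proof (intro sum.cong refl)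
          fix j assume "j \<in> {..<m}"
          then show "cov h $$ (i, j) * x j = (if j = i then x j else 0)"
            using False cov0[OF i] cov1[OF i] cov2[OF i, of j] by (cases "j = 0 \<or> j = 1") auto
        qed
        then show ?thesis using False i unfolding ze unfolding xy by (auto simp: basis_fun_def)
      qed
    qed
    finally show ?thesis .
  qed
  obtain xs where xs: "even (length xs)" "\<forall>x\<in>set xs. (\<Sum>i<m. (x i)\<^sup>2) = 1" "\<rho> h = cprod xs"
    using rho_cprod[OF h] .
  have Q: "\<rho> h \<in> carrier_mat N N" by (rule rho_carrier[OF h])
  \<comment> \<open>\<open>R\<close> and \<open>\<rho> h\<close> induce the same conjugation on
    vectors, so their quotient commutes with every generator.\<close>
  have "\<exists>z. R' * \<rho> h = z \<cdot>\<^sub>m 1\<^sub>m N"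
  proof (rule cliff_commutant)
    fix i assume i: "i < m"
    let ?g = "\<gamma> i" and ?g' = "cliff_mat D (\<lambda>l. \<Sum>j<m. cov h $$ (l, j) * basis_fun i j)"
    have gc: "?g \<in> carrier_mat N N" using gamma_carrier[OF i] .
    have e1: "R * ?g = ?g' * R" using Rconj[of "basis_fun i"] by (simp add: cliff_unit[OF i])
    have e2: "\<rho> h * ?g = ?g' * \<rho> h" using rho_cliff[OF h, of "basis_fun i"] by (simp add: cliff_unit[OF i])
    have "R' * ?g' = R' * ?g' * (R * R')" using RR' Rc by simp
    also have "\<dots> = R' * (?g' * R) * R'" using Rc gc by (simp add: as)
    also have "\<dots> = (R' * R) * ?g * R'" using Rc gc by (simp add: as e1[symmetric])
    finally have R'g': "R' * ?g' = ?g * R'" using R'R gc Rc by simp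
    have "R' * \<rho> h * ?g = R' * (?g' * \<rho> h)"
      using Rc gc Q by (simp add: e2)
    also have "\<dots> = R' * ?g' * \<rho> h"
      using assoc_mult_mat[OF Rc(2) cliff_carrier Q] by simp
    also have "\<dots> = ?g * (R' * \<rho> h)"
      unfolding R'g' by (rule assoc_mult_mat[OF gc Rc(2) Q])
    finally show "R' * \<rho> h * ?g = ?g * (R' * \<rho> h)" .
  qed (use Rc Q in simp)
  then obtain z where z: "R' * \<rho> h = z \<cdot>\<^sub>m 1\<^sub>m N" ..
  have "cprod ([?y, ?e] @ xs) = z \<cdot>\<^sub>m 1\<^sub>m N" using z by (simp add: cprod_append[of "[?y, ?e]"] R'_def[symmetric] xs(3) del: append_Cons)
  then have z2: "z\<^sup>2 = 1" by (rule cprod_scalar_sq[rotated 2]) (use xs ue in auto)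
  have "\<rho> h = R * (R' * \<rho> h)" unfolding assoc_mult_mat[OF Rc Q, symmetric] RR' using Q by simp
  then have rh: "\<rho> h = z \<cdot>\<^sub>m R" using z Rc by (simp add: mult_smult_distrib[of _ N N _ N])
  \<comment> \<open>As z is its own inverse, the same sign occurs in the operator of the inverse
    element, and only the scalar parts survive in the sum.\<close>
  have zR': "(z \<cdot>\<^sub>m R') * \<rho> h = 1\<^sub>m N"
    using z z2 Rc Q mult_smult_assoc_mat[of R' N N "\<rho> h" N z] by (auto intro!: eq_matI simp: power2_eq_square)
  have i: "\<rho> (inv\<^bsub>G\<^esub> h) \<in> carrier_mat N N" using rho_carrier[OF Spin_inv[OF h]] .
  have "\<rho> (inv\<^bsub>G\<^esub> h) = ((z \<cdot>\<^sub>m R') * \<rho> h) * \<rho> (inv\<^bsub>G\<^esub> h)" using zR' i by simp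
  also have "\<dots> = (z \<cdot>\<^sub>m R') * (\<rho> h * \<rho> (inv\<^bsub>G\<^esub> h))" by (rule assoc_mult_mat) (use i Q Rc in auto)
  finally have ri: "\<rho> (inv\<^bsub>G\<^esub> h) = z \<cdot>\<^sub>m R'" using rho_inv[OF h] Rc by simp
  have "\<rho> h + \<rho> (inv\<^bsub>G\<^esub> h) = z \<cdot>\<^sub>m (R + R')"
    unfolding rh ri using Rc by (simp add: add_smult_distrib_left_mat[of _ N N])
  also have "\<dots> = (z * of_real (2 * C)) \<cdot>\<^sub>m 1\<^sub>m N" unfolding RR by (auto intro!: eq_matI)
  moreover have "(z * of_real (2 * C))\<^sup>2 = complex_of_real (2 + 2 * c)"
  proof -
    have "(2 * C)\<^sup>2 = 2 + 2 * c" using C2 by (simp add: power_mult_distrib)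
    then show ?thesis by (metis power_mult_distrib z2 mult_1 of_real_power)
  qed
  ultimately show ?thesis by metis
qed

section \<open>Matrices acting on the first two coordinates\<close>

definition mat2 :: "real \<Rightarrow> real \<Rightarrow> real \<Rightarrow> real \<Rightarrow> real mat" where
  "mat2 a b c d = four_block_mat (Matrix.mat 1 1 (\<lambda>_. a)) (Matrix.mat 1 1 (\<lambda>_. b))
     (Matrix.mat 1 1 (\<lambda>_. c)) (Matrix.mat 1 1 (\<lambda>_. d))"

text \<open>The block form reduces products, units and determinants to the two by two case through
  the laws for \<open>four_block_mat\<close>.\<close>

definition blk :: "real \<Rightarrow> real \<Rightarrow> real \<Rightarrow> real \<Rightarrow> real mat" where
  "blk a b c d = four_block_mat (mat2 a b c d) (0\<^sub>m 2 (m - 2)) (0\<^sub>m (m - 2) 2) (1\<^sub>m (m - 2))"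

lemma mat2_carrier [simp]: "mat2 a b c d \<in> carrier_mat 2 2"
  using four_block_carrier_mat[of "Matrix.mat 1 1 (\<lambda>_. a)" 1 1 "Matrix.mat 1 1 (\<lambda>_. d)" 1 1]
  by (simp add: mat2_def numeral_2_eq_2)

lemma mat2_entries:
  "mat2 a b c d $$ (0, 0) = a" "mat2 a b c d $$ (0, Suc 0) = b"
  "mat2 a b c d $$ (Suc 0, 0) = c" "mat2 a b c d $$ (Suc 0, Suc 0) = d"
  by (simp_all add: mat2_def)

lemma mat2_mult:
  "mat2 a b c d * mat2 a' b' c' d' =
    mat2 (a * a' + b * c') (a * b' + b * d') (c * a' + d * c') (c * b' + d * d')"
proof (rule eq_matI)
  fix i j assume "i < dim_row (mat2 (a * a' + b * c') (a * b' + b * d') (c * a' + d * c') (c * b' + d * d'))"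
    "j < dim_col (mat2 (a * a' + b * c') (a * b' + b * d') (c * a' + d * c') (c * b' + d * d'))"
  then have "i < 2" "j < 2" using carrier_matD[OF mat2_carrier] by metis+
  then have "i = 0 \<or> i = Suc 0" "j = 0 \<or> j = Suc 0" by auto
  moreover have dims: "dim_row (mat2 a b c d) = 2" "dim_col (mat2 a b c d) = 2" for a b c d
    using carrier_matD[OF mat2_carrier] by metis+
  ultimately show "(mat2 a b c d * mat2 a' b' c' d') $$ (i, j) =
      mat2 (a * a' + b * c') (a * b' + b * d') (c * a' + d * c') (c * b' + d * d') $$ (i, j)"
    by (auto simp: dims mat2_entries scalar_prod_def numeral_2_eq_2)
qed (use carrier_matD[OF mat2_carrier] in \<open>metis index_mult_mat(2,3)\<close>)+

lemma blk_carrier [simp]: "blk a b c d \<in> carrier_mat m m"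
proof -
  have "blk a b c d \<in> carrier_mat (2 + (m - 2)) (2 + (m - 2))"
    unfolding blk_def by (intro four_block_carrier_mat mat2_carrier one_carrier_mat)
  then show ?thesis by (metis le_add_diff_inverse m_ge_2)
qed

lemma blk_mult:
  "blk a b c d * blk a' b' c' d' =
    blk (a * a' + b * c') (a * b' + b * d') (c * a' + d * c') (c * b' + d * d')"
  unfolding blk_def
  by (subst mult_four_block_mat[of _ 2 2 _ "m - 2" _ "m - 2" _ _ 2 _ "m - 2"])
     (auto simp: mat2_mult right_add_zero_mat[of _ 2 2] left_mult_zero_mat[OF mat2_carrier] right_mult_zero_mat[OF mat2_carrier])

lemma blk_one: "blk 1 0 0 1 = 1\<^sub>m m"
proof -
  have "mat2 1 0 0 1 = 1\<^sub>m 2"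
  proof (rule eq_matI)
    fix i j assume "i < dim_row (1\<^sub>m 2 :: real mat)" "j < dim_col (1\<^sub>m 2 :: real mat)"
    then have "i = 0 \<or> i = Suc 0" "j = 0 \<or> j = Suc 0" by auto
    then show "mat2 1 0 0 1 $$ (i, j) = 1\<^sub>m 2 $$ (i, j)" by (auto simp: mat2_entries)
  qed (use carrier_matD[OF mat2_carrier] in auto)
  then show ?thesis unfolding blk_def by (metis four_block_one_mat le_add_diff_inverse m_ge_2)
qed

lemma det_blk: "Determinant.det (blk a b c d) = a * d - b * c"
proof -
  have "Matrix.mat 1 1 (\<lambda>_. a) * Matrix.mat 1 1 (\<lambda>_. d) - Matrix.mat 1 1 (\<lambda>_. b) * Matrix.mat 1 1 (\<lambda>_. c)
      = Matrix.mat 1 1 (\<lambda>_. a * d - b * c)"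
    by (rule eq_matI) (auto simp: scalar_prod_def)
  moreover have "Determinant.det (Matrix.mat 1 1 (\<lambda>_. a * d - b * c)) = a * d - b * c"
    by (subst det_single) auto
  ultimately have "Determinant.det (mat2 a b c d) = a * d - b * c"
    unfolding mat2_def
    by (subst det_four_block_mat[of _ 1])
      (auto intro!: eq_matI simp: scalar_prod_def)
  then show ?thesis
    unfolding blk_def
    by (subst det_four_block_mat_lower_left_zero[of _ 2 _ "m - 2"]) auto
qed

lemma blk_entries:
  "i < m \<Longrightarrow> blk a b c d $$ (i, 0) = (if i = 0 then a else if i = 1 then c else 0)"
  "i < m \<Longrightarrow> blk a b c d $$ (i, 1) = (if i = 0 then b else if i = 1 then d else 0)"
  "i < m \<Longrightarrow> 2 \<le> j \<Longrightarrow> j < m \<Longrightarrow> blk a b c d $$ (i, j) = (if i = j then 1 else 0)"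
proof -
  have dims: "dim_row (mat2 a b c d) = 2" "dim_col (mat2 a b c d) = 2"
    using carrier_matD[OF mat2_carrier] by metis+
  have two: "n < 2 \<longleftrightarrow> n = 0 \<or> n = Suc 0" for n :: nat by auto
  show "i < m \<Longrightarrow> blk a b c d $$ (i, 0) = (if i = 0 then a else if i = 1 then c else 0)"
    "i < m \<Longrightarrow> blk a b c d $$ (i, 1) = (if i = 0 then b else if i = 1 then d else 0)"
    "i < m \<Longrightarrow> 2 \<le> j \<Longrightarrow> j < m \<Longrightarrow> blk a b c d $$ (i, j) = (if i = j then 1 else 0)"
    using m_ge_2 by (auto simp: blk_def dims mat2_entries two not_less)
qed

lemma transpose_blk: "transpose_mat (blk a b c d) = blk a c b d"
proof (rule eq_matI)
  fix i j assume "i < dim_row (blk a c b d)" "j < dim_col (blk a c b d)"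
  then have ij: "i < m" "j < m" using carrier_matD[OF blk_carrier[of a c b d]] by auto
  have "i = 0 \<or> i = 1 \<or> 2 \<le> i" "j = 0 \<or> j = 1 \<or> 2 \<le> j" by auto
  then show "transpose_mat (blk a b c d) $$ (i, j) = blk a c b d $$ (i, j)"
    using ij carrier_matD[OF blk_carrier[of a b c d]] m_ge_2
    by (elim disjE) (simp_all add: blk_entries del: One_nat_def)
qed (use carrier_matD[OF blk_carrier] in auto)

lemma blk_SO: "c\<^sup>2 + s\<^sup>2 = 1 \<Longrightarrow> blk c (- s) s c \<in> SO_mats m"
  by (simp add: SO_mats_def transpose_blk blk_mult det_blk power2_eq_square add.commute flip: blk_one)

lemma rotation_sum:
  assumes h: "h \<in> carrier G" "cov h = blk c (- s) s c" and cs: "c\<^sup>2 + s\<^sup>2 = 1" "- 1 < c"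
  shows "h \<in> Spin \<and> (\<exists>k. k\<^sup>2 = complex_of_real (2 + 2 * c) \<and> \<rho> h + \<rho> (inv\<^bsub>G\<^esub> h) = k \<cdot>\<^sub>m 1\<^sub>m N)"
proof -
  have "h \<in> Spin" using h blk_SO[OF cs(1)] by (simp add: spin_carrier_def)
  moreover have "\<exists>k. k\<^sup>2 = complex_of_real (2 + 2 * c) \<and> \<rho> h + \<rho> (inv\<^bsub>G\<^esub> h) = k \<cdot>\<^sub>m 1\<^sub>m N"
    by (rule rho_rotation[OF \<open>h \<in> Spin\<close> cs]) (simp_all only: h(2) blk_entries)
  ultimately show ?thesis by blast
qed

lemma cov_surj:
  assumes "A \<in> carrier_mat m m" "0 < Determinant.det A"
  shows "\<exists>h\<in>carrier G. cov h = A"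
proof -
  have "double_covering (sd_top D) (subtopology (mat_top m) (carrier (GL_pos m))) cov"
    and "topspace (sd_top D) = carrier G"
    using spin_setup by (auto simp: spin_setup_def topological_group_def)
  from double_covering_surj[OF this(1), of A] this(2) assms show ?thesis
    by (auto simp: GL_pos_def)
qed

end

section \<open>Impossibility of extending the spinor representation\<close>

locale rep_extension = spin_context D for D :: "'h spin_data" +
  fixes T :: "'h \<Rightarrow> complex Matrix.vec \<Rightarrow> complex Matrix.vec"
  assumes T: "h \<in> carrier G \<Longrightarrow> v \<in> carrier_vec N \<Longrightarrow> T h v \<in> carrier_vec N"
    and T_add: "h \<in> carrier G \<Longrightarrow> v \<in> carrier_vec N \<Longrightarrow> w \<in> carrier_vec N \<Longrightarrow> T h (v + w) = T h v + T h w"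
    and T_smult: "h \<in> carrier G \<Longrightarrow> v \<in> carrier_vec N \<Longrightarrow> T h (z \<cdot>\<^sub>v v) = z \<cdot>\<^sub>v T h v"
    and T_mult: "h \<in> carrier G \<Longrightarrow> k \<in> carrier G \<Longrightarrow> v \<in> carrier_vec N \<Longrightarrow> T (h \<otimes>\<^bsub>G\<^esub> k) v = T h (T k v)"
    and T_rho: "h \<in> Spin \<Longrightarrow> v \<in> carrier_vec N \<Longrightarrow> T h v = \<rho> h *\<^sub>v v"
begin

text \<open>An elliptic matrix of determinant 1 with \<open>0 < c\<close> is conjugate within
  \<open>GL_pos\<close> to a rotation with positive sine; the sign of \<open>c\<close> is what lets
  the conjugating matrix preserve the orientation. A scalar operator is unchanged by conjugation
  with \<open>T u\<close>.\<close>

lemma elliptic_sum: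
  assumes h: "h \<in> carrier G" "cov h = blk a b c d" and M: "a * d - b * c = 1" "0 < c" "\<bar>a + d\<bar> < 2"
  shows "\<exists>k. k\<^sup>2 = complex_of_real (2 + (a + d)) \<and>
    (\<forall>v\<in>carrier_vec N. T h v + T (inv\<^bsub>G\<^esub> h) v = k \<cdot>\<^sub>v v)"
proof -
  interpret group G by (rule group_G)
  \<comment> \<open>Cosine and sine of the rotation angle: the eigenvalues of the two by two block
    are x \<plusminus> i s.\<close>
  define x where "x = (a + d) / 2"
  define s where "s = sqrt (1 - x\<^sup>2)"
  have x: "- 1 < x" "x < 1" using M(3) by (auto simp: x_def)
  then have "x\<^sup>2 < 1" by (simp add: abs_square_less_1)
  then have s: "0 < s" "x\<^sup>2 + s\<^sup>2 = 1" by (auto simp: s_def)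
  \<comment> \<open>Write M for the two by two block. The columns are the first basis vector and its
    image under (M - x) / s. Since (M - x)^2 = - s^2, M is a rotation in this basis; the determinant
    \<open>c / s\<close> is positive.\<close>
  obtain u where u: "u \<in> carrier G" "cov u = blk 1 ((a - x) / s) 0 (c / s)"
    using cov_surj[OF blk_carrier, of 1 "(a - x) / s" 0 "c / s"] s M(2) by (auto simp: det_blk)
  define r where "r = inv\<^bsub>G\<^esub> u \<otimes>\<^bsub>G\<^esub> (h \<otimes>\<^bsub>G\<^esub> u)"
  have r: "r \<in> carrier G" using u h by (simp add: r_def)
  have ur: "u \<otimes>\<^bsub>G\<^esub> r = h \<otimes>\<^bsub>G\<^esub> u" using u h by (simp add: r_def m_assoc[symmetric])
  have sx: "s * s = 1 - x * x" using s by (simp add: power2_eq_square)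
  have e: "a * (a - x) / s + b * (c / s) = - s + (a - x) / s * x"
  proof -
    have "d = 2 * x - a" by (simp add: x_def field_simps)
    then have bc: "b * c = a * (2 * x - a) - 1" using M(1) by simp
    have "s * (a * (a - x) / s + b * (c / s)) = a * (a - x) + b * c" using s by (simp add: field_simps)
    also have "\<dots> = - (s * s) + (a - x) * x" unfolding bc sx by (simp add: algebra_simps)
    also have "\<dots> = s * (- s + (a - x) / s * x)" using s by (simp add: field_simps)
    finally show ?thesis using s by simp
  qed
  have d: "c * ((a - x) / s) + d * (c / s) = c / s * x"
  proof -
    have d: "d = 2 * x - a" by (simp add: x_def field_simps)
    show ?thesis unfolding d using s by (simp add: field_simps)
  qed
  have "blk a b c d * blk 1 ((a - x) / s) 0 (c / s) = blk 1 ((a - x) / s) 0 (c / s) * blk x (- s) s x"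
    unfolding blk_mult using s e d by (simp add: mult.commute)
  then have "cov u * cov r = cov u * blk x (- s) s x"
    using cov_mult[OF u(1) r] cov_mult[OF h(1) u(1)] by (simp add: ur u h)
  then have "cov (inv\<^bsub>G\<^esub> u) * (cov u * cov r) = cov (inv\<^bsub>G\<^esub> u) * (cov u * blk x (- s) s x)"
    by simp
  moreover have "cov (inv\<^bsub>G\<^esub> u) * (cov u * B) = B" if B: "B \<in> carrier_mat m m" for B
    using assoc_mult_mat[OF cov_carrier[OF inv_closed[OF u(1)]] cov_carrier[OF u(1)] B] cov_inv(1)[OF u(1)] B
    by simp
  ultimately have "cov r = blk x (- s) s x"
    using cov_carrier[OF r] by simp
  then have rS: "r \<in> Spin" and "\<exists>k. k\<^sup>2 = complex_of_real (2 + 2 * x) \<and> \<rho> r + \<rho> (inv\<^bsub>G\<^esub> r) = k \<cdot>\<^sub>m 1\<^sub>m N"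
    using rotation_sum[OF r _ s(2) x(1)] by auto
  then obtain k where k: "k\<^sup>2 = complex_of_real (2 + 2 * x)" "\<rho> r + \<rho> (inv\<^bsub>G\<^esub> r) = k \<cdot>\<^sub>m 1\<^sub>m N"
    by blast
  have "T h v + T (inv\<^bsub>G\<^esub> h) v = k \<cdot>\<^sub>v v" if v: "v \<in> carrier_vec N" for v
  proof -
    define w where "w = T (inv\<^bsub>G\<^esub> u) v"
    have w: "w \<in> carrier_vec N" using T u v by (simp add: w_def)
    have T1: "T \<one>\<^bsub>G\<^esub> v = v" using T_rho[OF Spin_one v] v by (simp add: rho_one)
    have uw: "T u w = v" using T_mult[of u "inv\<^bsub>G\<^esub> u" v] u v T1 by (simp add: w_def)
    have hu: "T h (T u w) = T u (T r w)"
      using T_mult[OF h(1) u(1) w] T_mult[OF u(1) r w] by (simp add: ur)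
    have "inv\<^bsub>G\<^esub> r = inv\<^bsub>G\<^esub> u \<otimes>\<^bsub>G\<^esub> (inv\<^bsub>G\<^esub> h \<otimes>\<^bsub>G\<^esub> u)"
      using u h by (simp add: r_def inv_mult_group m_assoc)
    then have ui: "u \<otimes>\<^bsub>G\<^esub> inv\<^bsub>G\<^esub> r = inv\<^bsub>G\<^esub> h \<otimes>\<^bsub>G\<^esub> u"
      using u h m_assoc[of u "inv\<^bsub>G\<^esub> u" "inv\<^bsub>G\<^esub> h \<otimes>\<^bsub>G\<^esub> u"] by simp
    have hiu: "T (inv\<^bsub>G\<^esub> h) (T u w) = T u (T (inv\<^bsub>G\<^esub> r) w)"
      using T_mult[OF inv_closed[OF h(1)] u(1) w] T_mult[OF u(1) inv_closed[OF r] w] by (simp add: ui)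
    have rc: "\<rho> r \<in> carrier_mat N N" "\<rho> (inv\<^bsub>G\<^esub> r) \<in> carrier_mat N N"
      using rho_carrier[OF rS] rho_carrier[OF Spin_inv[OF rS]] by auto
    have "T r w + T (inv\<^bsub>G\<^esub> r) w = (\<rho> r + \<rho> (inv\<^bsub>G\<^esub> r)) *\<^sub>v w"
      using T_rho[OF rS w] T_rho[OF Spin_inv[OF rS] w] rc w by (simp add: add_mult_distrib_mat_vec[of _ N N])
    also have "\<dots> = k \<cdot>\<^sub>v w"
      unfolding k using w by (auto intro!: eq_vecI)
    finally have "T r w + T (inv\<^bsub>G\<^esub> r) w = k \<cdot>\<^sub>v w" .
    \<comment> \<open>\<open>T u\<close> carries the identity for \<open>r\<close> over to
      \<open>h\<close>, because h u = u r and likewise for the inverses.\<close>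
    then have "T u (T r w) + T u (T (inv\<^bsub>G\<^esub> r) w) = k \<cdot>\<^sub>v T u w"
      using T_add[OF u(1) T[OF r w] T[OF inv_closed[OF r] w]] T_smult[OF u(1) w] by simp
    then show ?thesis using hu hiu uw by simp
  qed
  moreover have "2 + 2 * x = 2 + (a + d)" by (simp add: x_def)
  ultimately show ?thesis using k(1) by metis
qed

text \<open>For elliptic \<open>a, b, ab, ab\<^sup>-\<^sup>1\<close> the sums \<open>T h + T h\<^sup>-\<^sup>1\<close> are scalars \<open>k\<close> with \<open>k\<^sub>a\<^sub>b + k' = k\<^sub>a k\<^sub>b\<close>.
  The squares \<open>2 + trace\<close> of the scalars are \<open>1/4, 15/4, 2, 3\<close>, which is impossible.\<close>

lemma no_extension: False
proof -
  interpret group G by (rule group_G)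
  obtain a where a: "a \<in> carrier G" "cov a = blk 0 (- 1) 1 0"
    using cov_surj[OF blk_carrier, of 0 "- 1" 1 0] by (auto simp: det_blk)
  \<comment> \<open>Chosen such that b, ab and ab^-1 all satisfy the hypotheses of
    \<open>elliptic_sum\<close>: determinant 1, positive lower left entry, and traces 1, -7/4 and
    7/4 of modulus below 2.\<close>
  obtain b where b: "b \<in> carrier G" "cov b = blk (1/2) (- 1) (3/4) (1/2)"
    using cov_surj[OF blk_carrier, of "1/2" "- 1" "3/4" "1/2"] by (auto simp: det_blk)
  let ?a = "inv\<^bsub>G\<^esub> a" and ?b = "inv\<^bsub>G\<^esub> b"
  have "cov ?b = cov ?b * (blk (1/2) (- 1) (3/4) (1/2) * blk (1/2) 1 (- 3/4) (1/2))"
    using cov_carrier[OF inv_closed[OF b(1)]] by (simp add: blk_mult blk_one)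
  also have "\<dots> = (cov ?b * cov b) * blk (1/2) 1 (- 3/4) (1/2)"
    unfolding b(2) by (rule assoc_mult_mat[symmetric, OF cov_carrier[OF inv_closed[OF b(1)]] blk_carrier blk_carrier])
  finally have cb: "cov ?b = blk (1/2) 1 (- 3/4) (1/2)" using cov_inv(1)[OF b(1)] left_mult_one_mat[OF blk_carrier] by simp
  have ab: "a \<otimes>\<^bsub>G\<^esub> b \<in> carrier G" "cov (a \<otimes>\<^bsub>G\<^esub> b) = blk (- 3/4) (- 1/2) (1/2) (- 1)"
    using a b cov_mult[OF a(1) b(1)] by (simp_all add: blk_mult)
  have ab': "a \<otimes>\<^bsub>G\<^esub> ?b \<in> carrier G" "cov (a \<otimes>\<^bsub>G\<^esub> ?b) = blk (3/4) (- 1/2) (1/2) 1"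
    using a b cov_mult[OF a(1) inv_closed[OF b(1)]] by (simp_all add: blk_mult cb)
  obtain ka where ka: "ka\<^sup>2 = complex_of_real (2 + (0 + 0))"
      "\<And>v. v \<in> carrier_vec N \<Longrightarrow> T a v + T ?a v = ka \<cdot>\<^sub>v v"
    using elliptic_sum[OF a] by auto
  obtain kb where kb: "kb\<^sup>2 = complex_of_real (2 + (1/2 + 1/2))"
      "\<And>v. v \<in> carrier_vec N \<Longrightarrow> T b v + T ?b v = kb \<cdot>\<^sub>v v"
    using elliptic_sum[OF b] by auto
  obtain k where k: "k\<^sup>2 = complex_of_real (2 + (- 3/4 + - 1))"
      "\<And>v. v \<in> carrier_vec N \<Longrightarrow> T (a \<otimes>\<^bsub>G\<^esub> b) v + T (inv\<^bsub>G\<^esub> (a \<otimes>\<^bsub>G\<^esub> b)) v = k \<cdot>\<^sub>v v"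
    using elliptic_sum[OF ab] by auto
  obtain k' where k': "k'\<^sup>2 = complex_of_real (2 + (3/4 + 1))"
      "\<And>v. v \<in> carrier_vec N \<Longrightarrow> T (a \<otimes>\<^bsub>G\<^esub> ?b) v + T (inv\<^bsub>G\<^esub> (a \<otimes>\<^bsub>G\<^esub> ?b)) v = k' \<cdot>\<^sub>v v"
    using elliptic_sum[OF ab'] by auto
  let ?v = "unit_vec N 0 :: complex Matrix.vec"
  have v: "?v \<in> carrier_vec N" by simp
  note c = T[OF a(1)] T[OF b(1)] T[OF inv_closed[OF a(1)]] T[OF inv_closed[OF b(1)]] v
  \<comment> \<open>The inverses of ab and ab^-1 are b^-1 a^-1 and b a^-1, so the four terms regroup
    into the product of the sums for a and for b.\<close>
  have lhs: "k \<cdot>\<^sub>v ?v + k' \<cdot>\<^sub>v ?v =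
      (T a (T b ?v) + T ?b (T ?a ?v)) + (T a (T ?b ?v) + T b (T ?a ?v))"
    using k(2)[OF v, symmetric] k'(2)[OF v, symmetric] a b v
    by (simp add: T_mult inv_mult_group)
  have shuffle: "(p + q) + (r + s) = (p + r) + (s + q)"
    if "p \<in> carrier_vec N" "q \<in> carrier_vec N" "r \<in> carrier_vec N" "s \<in> carrier_vec N"
    for p q r s :: "complex Matrix.vec"
    using that by (intro eq_vecI) auto
  have "(T a (T b ?v) + T ?b (T ?a ?v)) + (T a (T ?b ?v) + T b (T ?a ?v)) =
      T a (T b ?v + T ?b ?v) + (T b (T ?a ?v) + T ?b (T ?a ?v))"
    unfolding T_add[OF a(1) T[OF b(1) v] T[OF inv_closed[OF b(1)] v]]
    by (rule shuffle) (intro c)+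
  also have "\<dots> = kb \<cdot>\<^sub>v (T a ?v + T ?a ?v)"
    using kb(2)[OF v] kb(2)[OF T[OF inv_closed[OF a(1)] v]] T_smult[OF a(1) v] c
    by (simp add: smult_add_distrib_vec[of _ N])
  also have "\<dots> = (kb * ka) \<cdot>\<^sub>v ?v" using ka(2)[OF v] by (simp add: smult_smult_assoc)
  finally have "k \<cdot>\<^sub>v ?v + k' \<cdot>\<^sub>v ?v = (kb * ka) \<cdot>\<^sub>v ?v" using lhs by simp
  then have "vec_index (k \<cdot>\<^sub>v ?v + k' \<cdot>\<^sub>v ?v) 0 = vec_index ((kb * ka) \<cdot>\<^sub>v ?v) 0" by simp
  then have eq: "k + k' = kb * ka" using N_pos by simp
  \<comment> \<open>Only squares are known, so the cross term is isolated: 1/4 + 15/4 + 2 k k' =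
    6.\<close>
  have "(k + k')\<^sup>2 = kb\<^sup>2 * ka\<^sup>2" by (simp add: eq power_mult_distrib)
  then have "k\<^sup>2 + k'\<^sup>2 + 2 * (k * k') = 6" using ka(1) kb(1) by (simp add: power2_sum mult.assoc)
  then have kk: "k * k' = 1" using k(1) k'(1) by (simp add: field_simps)
  have "k\<^sup>2 * k'\<^sup>2 = 1" by (metis kk one_power2 power_mult_distrib)
  then have "complex_of_real (15 / 16) = 1" unfolding k k' by (simp flip: of_real_mult)
  then show False by (metis of_real_eq_1_iff divide_eq_1_iff numeral_eq_iff semiring_norm(86,89,87,88,90) zero_neq_numeral)
qed

end

section \<open>Smooth functions on open subsets of Euclidean space\<close>

abbreviation "E n \<equiv> topspace (Euclidean_space n)"

lemma E_iff: "x \<in> E n \<longleftrightarrow> (\<forall>i\<ge>n. x i = 0)"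
  by (simp add: topspace_Euclidean_space)

lemma E_upd: "x \<in> E n \<Longrightarrow> i < n \<Longrightarrow> x(i := t) \<in> E n"
  by (auto simp: E_iff)

text \<open>On \<open>E n\<close> the coordinates from \<open>n\<close> on are zero, which leaves
  finitely many to test.\<close>

lemma continuous_map_into_E:
  "continuous_map X (Euclidean_space n) f \<longleftrightarrow>
     (\<forall>i<n. continuous_map X euclideanreal (\<lambda>x. f x i)) \<and> f \<in> topspace X \<rightarrow> E n"
    (is "?L \<longleftrightarrow> ?R")
proof -
  have L: "?L \<longleftrightarrow> (\<forall>i. continuous_map X euclideanreal (\<lambda>x. f x i)) \<and> f \<in> topspace X \<rightarrow> E n"
    unfolding topspace_Euclidean_space
    by (simp only: Euclidean_space_def continuous_map_in_subtopology continuous_map_componentwise_UNIV)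
  have "continuous_map X euclideanreal (\<lambda>x. f x i)" if "f \<in> topspace X \<rightarrow> E n" "n \<le> i" for i
  proof (rule continuous_map_eq)
    show "continuous_map X euclideanreal (\<lambda>_. 0)" by simp
    show "0 = f x i" if "x \<in> topspace X" for x
    proof -
      have "f x \<in> E n" using \<open>f \<in> topspace X \<rightarrow> E n\<close> that by (rule funcset_mem)
      then show ?thesis using \<open>n \<le> i\<close> by (simp add: E_iff)
    qed
  qed
  then show ?thesis unfolding L by (meson not_le)
qed

lemma continuous_map_E_coord: "continuous_map (Euclidean_space n) euclideanreal (\<lambda>x. x i)"
  unfolding Euclidean_space_def
  by (intro continuous_map_from_subtopology continuous_map_product_coordinates UNIV_I)

text \<open>A basic open set of the product topology restricts finitely many coordinates. Those from
  \<open>n\<close> on vanish on \<open>E n\<close> anyway, so one radius for the others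
  suffices.\<close>

lemma open_E_box:
  assumes "openin (Euclidean_space n) V" "x \<in> V"
  obtains e where "e > 0" "\<forall>z\<in>E n. (\<forall>i<n. \<bar>z i - x i\<bar> < e) \<longrightarrow> z \<in> V"
proof -
  obtain W where W: "openin (powertop_real UNIV) W" "V = W \<inter> E n"
    using assms(1) by (auto simp: Euclidean_space_def openin_subtopology)
  have xn: "x \<in> E n" using W assms by auto
  obtain U where U: "finite {i. U i \<noteq> UNIV}" "\<And>i. open (U i)" "x \<in> Pi\<^sub>E UNIV U" "Pi\<^sub>E UNIV U \<subseteq> W"
    using W assms(2) by (fastforce simp: openin_product_topology_alt)
  have "\<forall>i. \<exists>e>0. \<forall>y. \<bar>y - x i\<bar> < e \<longrightarrow> y \<in> U i"
    using U(2,3) by (auto simp: open_dist dist_real_def PiE_iff)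
  then obtain e where e: "\<And>i. e i > 0" "\<And>i y. \<bar>y - x i\<bar> < e i \<Longrightarrow> y \<in> U i" by metis
  \<comment> \<open>The element 1 keeps the set nonempty when \<open>n = 0\<close>.\<close>
  define d where "d = Min (insert 1 (e ` {..<n}))"
  have d: "d > 0" "\<And>i. i < n \<Longrightarrow> d \<le> e i" by (auto simp: d_def e)
  show thesis
  proof (rule that[OF d(1)])
    have "z \<in> V" if z: "z \<in> E n" "\<forall>i<n. \<bar>z i - x i\<bar> < d" for z
    proof -
    have "z i \<in> U i" for i
    proof (cases "i < n")
      case True then show ?thesis using z(2) d(2) e(2) by (meson less_le_trans)
    next
      case False then have "z i = x i" using z(1) xn by (auto simp: E_iff)
      then show ?thesis using e by simp
    qed
      then show "z \<in> V" using U(4) W z(1) by auto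
    qed
    then show "\<forall>z\<in>E n. (\<forall>i<n. \<bar>z i - x i\<bar> < d) \<longrightarrow> z \<in> V" by blast
  qed
qed

text \<open>Coordinate lines through a point of an open set stay in it for a while; this is what
  makes \<open>partial\<close> depend on values in \<open>U\<close> only.\<close>

lemma eventually_upd:
  assumes "openin (Euclidean_space n) U" "x \<in> U" "i < n"
  shows "\<forall>\<^sub>F t in nhds (x i). x(i := t) \<in> U"
proof -
  obtain e where e: "e > 0" "\<forall>z\<in>E n. (\<forall>j<n. \<bar>z j - x j\<bar> < e) \<longrightarrow> z \<in> U"
    using open_E_box[OF assms(1,2)] .
  have x: "x \<in> E n" using assms openin_subset by blast
  show ?thesis
    unfolding eventually_nhds_metric
    by (intro exI[of _ e]) (use e x assms(3) in \<open>auto simp: dist_real_def intro!: e(2)[rule_format] E_upd\<close>)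
qed

lemma Rn_Ck_continuous: "Rn_Ck k n U f \<Longrightarrow> continuous_map (subtopology (Euclidean_space n) U) euclideanreal f"
  by (cases k) auto

lemma Rn_Ck_DERIV:
  assumes "Rn_Ck (Suc k) n U f" "i < n" "x \<in> U"
  shows "((\<lambda>t. f (x(i := t))) has_real_derivative partial i f x) (at (x i))"
  using assms by (simp add: partial_def DERIV_deriv_iff_field_differentiable)

lemma partial_cong:
  assumes "openin (Euclidean_space n) U" "x \<in> U" "i < n" "\<And>y. y \<in> U \<Longrightarrow> f y = g y"
  shows "partial i f x = partial i g x"
  unfolding partial_def
  by (rule deriv_cong_ev) (use eventually_upd[OF assms(1-3)] assms(4) in \<open>auto elim: eventually_mono\<close>)

text \<open>Equality on the open set \<open>U\<close> is inherited by the partial derivatives, which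
  take the place of \<open>f\<close> and \<open>g\<close> in the induction step.\<close>

lemma Rn_Ck_cong:
  assumes "openin (Euclidean_space n) U" "\<And>y. y \<in> U \<Longrightarrow> f y = g y" "Rn_Ck k n U f"
  shows "Rn_Ck k n U g"
  using assms(2,3)
proof (induction k arbitrary: f g)
  case 0
  then show ?case by (auto intro: continuous_map_eq)
next
  case (Suc k)
  have c: "continuous_map (subtopology (Euclidean_space n) U) euclideanreal g"
    using Suc.prems by (auto intro: continuous_map_eq)
  have "(\<lambda>t. g (x(i := t))) field_differentiable at (x i)" if "i < n" "x \<in> U" for i x
  proof -
    have e: "\<forall>\<^sub>F t in nhds (x i). f (x(i := t)) = g (x(i := t))"
      using eventually_upd[OF assms(1) that(2,1)] by (rule eventually_mono) (rule Suc.prems(1))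
    from DERIV_cong_ev[OF refl e refl, THEN iffD1, OF Rn_Ck_DERIV[OF Suc.prems(2) that]]
    show ?thesis unfolding field_differentiable_def by (rule exI)
  qed
  moreover have "Rn_Ck k n U (partial i g)" if "i < n" for i
  proof (rule Suc.IH)
    show "partial i f y = partial i g y" if "y \<in> U" for y
      by (rule partial_cong[OF assms(1) that \<open>i < n\<close> Suc.prems(1)])
    show "Rn_Ck k n U (partial i f)" using Suc.prems(2) that by simp
  qed
  ultimately show ?case using c by simp
qed

lemma Rn_Ck_mono: "Rn_Ck (Suc k) n U f \<Longrightarrow> Rn_Ck k n U f"
  by (induction k arbitrary: f) auto

lemma Rn_Ck_subset: "Rn_Ck k n U f \<Longrightarrow> V \<subseteq> U \<Longrightarrow> Rn_Ck k n V f"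
  by (induction k arbitrary: f) (auto intro: continuous_map_from_subtopology_mono)

lemma Rn_Ck_const: "Rn_Ck k n U (\<lambda>_. c)"
proof (induction k arbitrary: c)
  case (Suc k)
  have "partial i (\<lambda>_. c) = (\<lambda>_. 0)" for i by (simp add: partial_def fun_eq_iff)
  then show ?case using Suc by simp
qed simp

text \<open>Allows the derivatives to be given by any expression that is correct on
  \<open>U\<close>, where alone \<open>partial\<close> is controlled.\<close>

lemma Rn_Ck_SucI:
  assumes U: "openin (Euclidean_space n) U"
    and c: "continuous_map (subtopology (Euclidean_space n) U) euclideanreal f"
    and d: "\<And>i x. i < n \<Longrightarrow> x \<in> U \<Longrightarrow> ((\<lambda>t. f (x(i := t))) has_real_derivative f' i x) (at (x i))"
    and k: "\<And>i. i < n \<Longrightarrow> Rn_Ck k n U (f' i)"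
  shows "Rn_Ck (Suc k) n U f"
proof -
  have "partial i f x = f' i x" if "i < n" "x \<in> U" for i x
    unfolding partial_def using d[OF that] by (rule DERIV_imp_deriv)
  then have "Rn_Ck k n U (partial i f)" if "i < n" for i
    using Rn_Ck_cong[OF U _ k[OF that]] that by auto
  then show ?thesis using c d by (auto simp: field_differentiable_def)
qed

lemma Rn_Ck_coord:
  assumes "openin (Euclidean_space n) U"
  shows "Rn_Ck k n U (\<lambda>x. x j)"
proof (cases k)
  case 0
  then show ?thesis by (simp add: continuous_map_E_coord continuous_map_from_subtopology)
next
  case (Suc l)
  have "Rn_Ck (Suc l) n U (\<lambda>x. x j)"
    by (rule Rn_Ck_SucI[OF assms, where f' = "\<lambda>i x. if i = j then 1 else 0"])
      (auto simp: continuous_map_E_coord continuous_map_from_subtopology Rn_Ck_const)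
  then show ?thesis using Suc by simp
qed

lemma Rn_Ck_add:
  assumes U: "openin (Euclidean_space n) U"
  shows "Rn_Ck k n U f \<Longrightarrow> Rn_Ck k n U g \<Longrightarrow> Rn_Ck k n U (\<lambda>x. f x + g x)"
proof (induction k arbitrary: f g)
  case (Suc k)
  show ?case
    by (rule Rn_Ck_SucI[OF U, where f' = "\<lambda>i x. partial i f x + partial i g x"])
      (use Suc in \<open>auto intro!: continuous_map_add DERIV_add Rn_Ck_DERIV simp del: fun_upd_apply\<close>)
qed (auto intro: continuous_map_add)

lemma Rn_Ck_mult:
  assumes U: "openin (Euclidean_space n) U"
  shows "Rn_Ck k n U f \<Longrightarrow> Rn_Ck k n U g \<Longrightarrow> Rn_Ck k n U (\<lambda>x. f x * g x)"
proof (induction k arbitrary: f g)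
  case (Suc k)
  show ?case
  proof (rule Rn_Ck_SucI[OF U, where f' = "\<lambda>i x. f x * partial i g x + partial i f x * g x"])
    show "continuous_map (subtopology (Euclidean_space n) U) euclideanreal (\<lambda>x. f x * g x)"
      using Suc.prems by (auto intro: continuous_map_real_mult)
    show "((\<lambda>t. f (x(i := t)) * g (x(i := t))) has_real_derivative
        f x * partial i g x + partial i f x * g x) (at (x i))" if "i < n" "x \<in> U" for i x
      by (rule DERIV_cong[OF DERIV_mult'[OF Rn_Ck_DERIV[OF Suc.prems(1) that] Rn_Ck_DERIV[OF Suc.prems(2) that]]])
        (simp only: fun_upd_triv)
    show "Rn_Ck k n U (\<lambda>x. f x * partial i g x + partial i f x * g x)" if "i < n" for i
      using Suc.prems that Rn_Ck_mono[OF Suc.prems(1)] Rn_Ck_mono[OF Suc.prems(2)]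
      by (intro Rn_Ck_add[OF U] Suc.IH) auto
  qed
qed (auto intro: continuous_map_real_mult)

lemma Rn_Ck_sum:
  assumes U: "openin (Euclidean_space n) U" and "\<And>j. j \<in> J \<Longrightarrow> Rn_Ck k n U (f j)"
  shows "Rn_Ck k n U (\<lambda>x. \<Sum>j\<in>J. f j x)"
proof (cases "finite J")
  case True
  then show ?thesis using assms(2)
    by (induction J) (auto intro: Rn_Ck_const Rn_Ck_add[OF U])
qed (simp add: Rn_Ck_const)

text \<open>Chain rule along curves: coordinates are moved one at a time, each move being estimated by
  the mean value theorem.\<close>

lemma DERIV_curve:
  assumes V: "openin (Euclidean_space n) V" and f: "Rn_Ck (Suc 0) n V f"
    and y0: "y t0 \<in> V" and yE: "\<And>t. y t \<in> E n"
    and d: "\<And>j. j < n \<Longrightarrow> ((\<lambda>t. y t j) has_real_derivative d j) (at t0)"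
  shows "((\<lambda>t. f (y t)) has_real_derivative (\<Sum>j<n. partial j f (y t0) * d j)) (at t0)"
proof -
  let ?x = "y t0"
  \<comment> \<open>Interpolates between the base point at \<open>k = 0\<close> and
    \<open>y t\<close> at \<open>k = n\<close>, changing one coordinate at each step.\<close>
  define z where "z k t = (\<lambda>i. if i < k then y t i else ?x i)" for k t
  have xE: "?x \<in> E n" by (rule yE)
  obtain e where e: "e > 0" "\<forall>w\<in>E n. (\<forall>i<n. \<bar>w i - ?x i\<bar> < e) \<longrightarrow> w \<in> V"
    using open_E_box[OF V y0] .
  have ylim: "((\<lambda>t. y t j) \<longlongrightarrow> ?x j) (at t0)" if "j < n" for j
    using DERIV_isCont[OF d[OF that]] by (simp add: isCont_def)
  then have near: "\<forall>\<^sub>F t in at t0. \<forall>j<n. \<bar>y t j - ?x j\<bar> < e"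
    using e(1) eventually_ball_finite[of "{..<n}" "\<lambda>t j. \<bar>y t j - ?x j\<bar> < e" "at t0"]
    by (simp add: tendsto_iff dist_real_def Ball_def)
  have step: "((\<lambda>t. f (z (Suc k) t) - f (z k t)) has_real_derivative partial k f ?x * d k) (at t0)"
    if k: "k < n" for k
  proof -
    have ex: "\<forall>\<^sub>F t in at t0. \<exists>s. \<bar>s - ?x k\<bar> \<le> \<bar>y t k - ?x k\<bar> \<and>
        f (z (Suc k) t) - f (z k t) = (y t k - ?x k) * partial k f ((z k t)(k := s))"
      using near
    proof eventually_elim
      case (elim t)
      have zE: "(z k t)(k := s) \<in> E n" for s using k xE yE[of t] by (auto simp: z_def E_iff)
      have inV: "(z k t)(k := s) \<in> V" if "\<bar>s - ?x k\<bar> < e" for s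
        using that elim e(1) by (intro e(2)[rule_format] zE) (auto simp: z_def)
      have zk: "z k t = (z k t)(k := ?x k)" "z (Suc k) t = (z k t)(k := y t k)"
        by (auto simp: z_def fun_eq_iff less_Suc_eq)
      have D: "((\<lambda>s. f ((z k t)(k := s))) has_real_derivative partial k f ((z k t)(k := s))) (at s)"
        if "\<bar>s - ?x k\<bar> < e" for s
        using Rn_Ck_DERIV[OF f k inV[OF that]] by simp
      have ek: "\<bar>y t k - ?x k\<bar> < e" using elim k by simp
      consider "y t k = ?x k" | "?x k < y t k" | "y t k < ?x k" by linarith
      then show ?case
      proof cases
        case 1 then show ?thesis using zk by (intro exI[of _ "?x k"]) simp
      next
        case 2
        obtain s where "?x k < s" "s < y t k"
          "f ((z k t)(k := y t k)) - f ((z k t)(k := ?x k)) = (y t k - ?x k) * partial k f ((z k t)(k := s))"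
          using MVT2[OF 2, of "\<lambda>s. f ((z k t)(k := s))" "\<lambda>s. partial k f ((z k t)(k := s))"] D ek by force
        then show ?thesis using zk by (intro exI[of _ s]) auto
      next
        case 3
        obtain s where "y t k < s" "s < ?x k"
          "f ((z k t)(k := ?x k)) - f ((z k t)(k := y t k)) = (?x k - y t k) * partial k f ((z k t)(k := s))"
          using MVT2[OF 3, of "\<lambda>s. f ((z k t)(k := s))" "\<lambda>s. partial k f ((z k t)(k := s))"] D ek by force
        then show ?thesis using zk by (intro exI[of _ s]) (auto simp: algebra_simps)
      qed
    qed
    \<comment> \<open>A mean value point, meaningful for \<open>t\<close> near \<open>t0\<close>
      only; elsewhere the choice is arbitrary.\<close>
    define s where "s t = (SOME s. \<bar>s - ?x k\<bar> \<le> \<bar>y t k - ?x k\<bar> \<and>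
        f (z (Suc k) t) - f (z k t) = (y t k - ?x k) * partial k f ((z k t)(k := s)))" for t
    have s: "\<forall>\<^sub>F t in at t0. \<bar>s t - ?x k\<bar> \<le> \<bar>y t k - ?x k\<bar> \<and>
        f (z (Suc k) t) - f (z k t) = (y t k - ?x k) * partial k f ((z k t)(k := s t))"
      using ex by (rule eventually_mono) (unfold s_def, rule someI_ex)
    have sb: "\<forall>\<^sub>F t in at t0. \<bar>s t - ?x k\<bar> \<le> \<bar>y t k - ?x k\<bar>"
      using s by (rule eventually_mono) simp
    have "((\<lambda>t. y t k - ?x k) \<longlongrightarrow> 0) (at t0)"
      using ylim[OF k] by (simp add: LIM_zero)
    then have "((\<lambda>t. s t - ?x k) \<longlongrightarrow> 0) (at t0)"
      by (rule Lim_null_comparison[rotated, OF tendsto_rabs_zero]) (use sb in simp)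
    then have slim: "(s \<longlongrightarrow> ?x k) (at t0)"
      by (simp add: LIM_zero_iff)
    have wE: "(z k t)(k := s t) \<in> E n" for t using k xE yE[of t] by (auto simp: z_def E_iff)
    have "\<forall>\<^sub>F t in at t0. (z k t)(k := s t) \<in> V"
      using near sb
    proof eventually_elim
      case (elim t)
      have "\<bar>s t - ?x k\<bar> < e" using elim k by force
      then show ?case using elim e(1) by (intro e(2)[rule_format] wE) (auto simp: z_def)
    qed
    moreover have "((\<lambda>t. ((z k t)(k := s t)) i) \<longlongrightarrow> ?x i) (at t0)" for i
      using slim ylim[of i] k by (cases "i = k"; cases "i < k") (auto simp: z_def)
    \<comment> \<open>The mean value points converge to the base point inside \<open>V\<close>,
      which is what continuity of \<open>partial k f\<close> on \<open>V\<close> requires.\<close>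
    ultimately have wlim: "limitin (subtopology (Euclidean_space n) V) (\<lambda>t. (z k t)(k := s t)) ?x (at t0)"
      using wE y0 yE
      by (auto simp: limitin_subtopology Euclidean_space_def limitin_componentwise topspace_Euclidean_space E_iff
          elim: eventually_mono)
    have "((\<lambda>t. partial k f ((z k t)(k := s t))) \<longlongrightarrow> partial k f ?x) (at t0)"
      using continuous_map_limit[OF _ wlim, of euclideanreal "partial k f"] f k by (simp add: o_def)
    moreover have "((\<lambda>t. (y t k - ?x k) / (t - t0)) \<longlongrightarrow> d k) (at t0)"
      using d[OF k] by (simp add: has_field_derivative_iff)
    ultimately have "((\<lambda>t. partial k f ((z k t)(k := s t)) * ((y t k - ?x k) / (t - t0))) \<longlongrightarrow> partial k f ?x * d k) (at t0)"
      by (rule tendsto_mult)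
    moreover have "\<forall>\<^sub>F t in at t0. partial k f ((z k t)(k := s t)) * ((y t k - ?x k) / (t - t0)) =
        ((f (z (Suc k) t) - f (z k t)) - (f (z (Suc k) t0) - f (z k t0))) / (t - t0)"
      using s by eventually_elim (auto simp: z_def)
    ultimately show ?thesis
      unfolding has_field_derivative_iff by (rule Lim_transform_eventually)
  qed
  have "((\<lambda>t. \<Sum>k<n. f (z (Suc k) t) - f (z k t)) has_real_derivative (\<Sum>k<n. partial k f ?x * d k)) (at t0)"
    by (intro DERIV_sum step) simp
  moreover have "(\<Sum>k<n. f (z (Suc k) t) - f (z k t)) = f (y t) - f ?x" for t
  proof -
    have "(\<Sum>k<n. f (z (Suc k) t) - f (z k t)) = f (z n t) - f (z 0 t)"
      by (rule sum_lessThan_telescope)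
    moreover have "z n t = y t" "z 0 t = ?x"
      using yE[of t] xE by (auto simp: z_def fun_eq_iff E_iff)
    ultimately show ?thesis by simp
  qed
  ultimately have "((\<lambda>t. f (y t) - f ?x) has_real_derivative (\<Sum>k<n. partial k f ?x * d k)) (at t0)"
    by simp
  then show ?thesis using DERIV_add[OF _ DERIV_const[of "f ?x"]] by fastforce
qed

lemma DERIV_line_compose:
  assumes U: "openin (Euclidean_space n) U" and V: "openin (Euclidean_space l) V"
    and hV: "\<And>x. x \<in> U \<Longrightarrow> h x \<in> V" and f: "Rn_Ck (Suc 0) l V f"
    and h: "\<And>j. j < l \<Longrightarrow> Rn_Ck (Suc 0) n U (\<lambda>x. h x j)" and x: "i < n" "x \<in> U"
  shows "((\<lambda>t. f (h (x(i := t)))) has_real_derivative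
        (\<Sum>j<l. partial j f (h x) * partial i (\<lambda>x. h x j) x)) (at (x i))"
proof -
  \<comment> \<open>\<open>DERIV_curve\<close> asks for points of \<open>E l\<close> at every
    parameter, so the curve is frozen at \<open>h x\<close> wherever the line leaves
    \<open>U\<close>.\<close>
  define y where "y t = (if x(i := t) \<in> U then h (x(i := t)) else h x)" for t
  have ev: "\<forall>\<^sub>F t in nhds (x i). y t = h (x(i := t))"
    using eventually_upd[OF U x(2,1)] by (rule eventually_mono) (simp add: y_def)
  have yx: "y (x i) = h x" by (simp add: y_def)
  have d: "((\<lambda>t. f (y t)) has_real_derivative
      (\<Sum>j<l. partial j f (y (x i)) * partial i (\<lambda>x. h x j) x)) (at (x i))"
  proof (rule DERIV_curve[OF V f])
    show "y (x i) \<in> V" using yx hV x by simp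
    show "y t \<in> E l" for t using hV x openin_subset[OF V] by (auto simp: y_def)
    show "((\<lambda>t. y t j) has_real_derivative partial i (\<lambda>x. h x j) x) (at (x i))" if "j < l" for j
    proof -
      have "\<forall>\<^sub>F t in nhds (x i). y t j = h (x(i := t)) j"
        using ev by (rule eventually_mono) simp
      then show ?thesis
        using Rn_Ck_DERIV[OF h[OF that] x] by (rule DERIV_cong_ev[OF refl _ refl, THEN iffD2])
    qed
  qed
  have "\<forall>\<^sub>F t in nhds (x i). f (y t) = f (h (x(i := t)))"
    using ev by (rule eventually_mono) simp
  from DERIV_cong_ev[OF refl this refl, THEN iffD1, OF d] show ?thesis by (simp only: yx)
qed

text \<open>The chain rule expresses the first derivatives through compositions of lower order with
  the same inner map, so only \<open>f\<close> has to vary in the induction.\<close>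

lemma Rn_Ck_compose:
  assumes U: "openin (Euclidean_space n) U" and V: "openin (Euclidean_space l) V"
    and hV: "\<And>x. x \<in> U \<Longrightarrow> h x \<in> V"
  shows "Rn_Ck k l V f \<Longrightarrow> (\<And>j. j < l \<Longrightarrow> Rn_Ck k n U (\<lambda>x. h x j)) \<Longrightarrow> Rn_Ck k n U (\<lambda>x. f (h x))"
proof (induction k arbitrary: f)
  case 0
  have "continuous_map (subtopology (Euclidean_space n) U) (subtopology (Euclidean_space l) V) h"
    using 0 hV openin_subset[OF V] by (auto simp: continuous_map_in_subtopology continuous_map_into_E)
  then show ?case
    using 0 continuous_map_compose[of _ _ h _ f] by (auto simp: o_def)
next
  case (Suc k)
  have hk: "Rn_Ck k n U (\<lambda>x. h x j)" if "j < l" for j using Suc.prems(2)[OF that] by (rule Rn_Ck_mono)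
  have f1: "Rn_Ck (Suc 0) l V f" using Suc.prems(1) by (auto intro: Rn_Ck_continuous)
  show ?case
  proof (rule Rn_Ck_SucI[OF U, where f' = "\<lambda>i x. \<Sum>j<l. partial j f (h x) * partial i (\<lambda>x. h x j) x"])
    have "Rn_Ck k n U (\<lambda>x. f (h x))" using Suc.IH[OF Rn_Ck_mono[OF Suc.prems(1)] hk] .
    then show "continuous_map (subtopology (Euclidean_space n) U) euclideanreal (\<lambda>x. f (h x))"
      by (rule Rn_Ck_continuous)
    show "((\<lambda>t. f (h (x(i := t)))) has_real_derivative
        (\<Sum>j<l. partial j f (h x) * partial i (\<lambda>x. h x j) x)) (at (x i))" if "i < n" "x \<in> U" for i x
      by (rule DERIV_line_compose[OF U V hV f1 _ that]) (use Suc.prems(2) in \<open>auto dest: Rn_Ck_continuous\<close>)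
    show "Rn_Ck k n U (\<lambda>x. \<Sum>j<l. partial j f (h x) * partial i (\<lambda>x. h x j) x)" if "i < n" for i
    proof (rule Rn_Ck_sum[OF U], rule Rn_Ck_mult[OF U])
      fix j assume "j \<in> {..<l}"
      then have j: "j < l" by simp
      have "Rn_Ck k l V (partial j f)" using Suc.prems(1) j by simp
      then show "Rn_Ck k n U (\<lambda>x. partial j f (h x))" by (rule Suc.IH[OF _ hk])
      show "Rn_Ck k n U (partial i (\<lambda>x. h x j))" using Suc.prems(2)[OF j] that by simp
    qed
  qed
qed

lemma partial_compose:
  assumes U: "openin (Euclidean_space n) U" and V: "openin (Euclidean_space l) V"
    and hV: "\<And>x. x \<in> U \<Longrightarrow> h x \<in> V"
    and f: "Rn_Ck (Suc 0) l V f" and h: "\<And>j. j < l \<Longrightarrow> Rn_Ck (Suc 0) n U (\<lambda>x. h x j)"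
    and x: "x \<in> U" "i < n"
  shows "partial i (\<lambda>x. f (h x)) x = (\<Sum>j<l. partial j f (h x) * partial i (\<lambda>x. h x j) x)"
  unfolding partial_def[of i "\<lambda>x. f (h x)"]
  using DERIV_line_compose[OF U V hV f h x(2,1)] by (rule DERIV_imp_deriv)

lemma Rn_smooth_cong:
  "openin (Euclidean_space n) U \<Longrightarrow> (\<And>y. y \<in> U \<Longrightarrow> f y = g y) \<Longrightarrow> Rn_smooth n U f \<Longrightarrow> Rn_smooth n U g"
  unfolding Rn_smooth_def using Rn_Ck_cong[of n U f g] by simp

lemma Rn_smooth_subset: "Rn_smooth n U f \<Longrightarrow> V \<subseteq> U \<Longrightarrow> Rn_smooth n V f"
  unfolding Rn_smooth_def using Rn_Ck_subset[of _ n U f V] by simp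

lemma Rn_smooth_coord: "openin (Euclidean_space n) U \<Longrightarrow> Rn_smooth n U (\<lambda>x. x j)"
  unfolding Rn_smooth_def by (simp add: Rn_Ck_coord)

lemma Rn_smooth_const: "Rn_smooth n U (\<lambda>x. c)"
  unfolding Rn_smooth_def by (simp add: Rn_Ck_const)

lemma Rn_smooth_mult:
  "openin (Euclidean_space n) U \<Longrightarrow> Rn_smooth n U f \<Longrightarrow> Rn_smooth n U g \<Longrightarrow> Rn_smooth n U (\<lambda>x. f x * g x)"
  unfolding Rn_smooth_def by (simp add: Rn_Ck_mult)

lemma Rn_smooth_sum:
  "openin (Euclidean_space n) U \<Longrightarrow> (\<And>j. j \<in> J \<Longrightarrow> Rn_smooth n U (f j)) \<Longrightarrow> Rn_smooth n U (\<lambda>x. \<Sum>j\<in>J. f j x)"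
  unfolding Rn_smooth_def by (simp add: Rn_Ck_sum)

lemma Rn_smooth_partial: "Rn_smooth n U f \<Longrightarrow> i < n \<Longrightarrow> Rn_smooth n U (partial i f)"
  unfolding Rn_smooth_def by (metis Rn_Ck.simps(2))

lemma Rn_smooth_compose:
  assumes "openin (Euclidean_space n) U" "openin (Euclidean_space l) V" "\<And>x. x \<in> U \<Longrightarrow> h x \<in> V"
    "Rn_smooth l V f" "\<And>j. j < l \<Longrightarrow> Rn_smooth n U (\<lambda>x. h x j)"
  shows "Rn_smooth n U (\<lambda>x. f (h x))"
  unfolding Rn_smooth_def
proof
  fix k
  show "Rn_Ck k n U (\<lambda>x. f (h x))"
    by (rule Rn_Ck_compose[OF assms(1-3)]) (use assms(4,5) in \<open>simp_all add: Rn_smooth_def\<close>)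
qed

section \<open>Jacobian matrices\<close>

lemma jac_mat_carrier [simp]: "jac_mat n h x \<in> carrier_mat n n"
  by (simp add: jac_mat_def)

lemma jac_mat_cong:
  assumes "openin (Euclidean_space n) U" "x \<in> U" "\<And>y i. y \<in> U \<Longrightarrow> i < n \<Longrightarrow> h y i = g y i"
  shows "jac_mat n h x = jac_mat n g x"
proof (rule eq_matI)
  fix i j assume "i < dim_row (jac_mat n g x)" "j < dim_col (jac_mat n g x)"
  then have ij: "i < n" "j < n" by (simp_all add: jac_mat_def)
  have "partial j (\<lambda>y. h y i) x = partial j (\<lambda>y. g y i) x"
    by (rule partial_cong[OF assms(1,2) ij(2)]) (rule assms(3)[OF _ ij(1)])
  then show "jac_mat n h x $$ (i, j) = jac_mat n g x $$ (i, j)"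
    using ij by (simp add: jac_mat_def)
qed (simp_all add: jac_mat_def)

lemma jac_mat_compose:
  assumes "openin (Euclidean_space n) U" "openin (Euclidean_space n) V" "\<And>x. x \<in> U \<Longrightarrow> h x \<in> V"
    "Rn_smooth_map n V f" "Rn_smooth_map n U h" "x \<in> U"
  shows "jac_mat n (\<lambda>x. f (h x)) x = jac_mat n f (h x) * jac_mat n h x"
proof (rule eq_matI)
  fix i j assume "i < dim_row (jac_mat n f (h x) * jac_mat n h x)" "j < dim_col (jac_mat n f (h x) * jac_mat n h x)"
  then have ij: "i < n" "j < n" by (auto simp: jac_mat_def)
  have "Rn_Ck (Suc 0) n V (\<lambda>y. f y i)" "\<And>j. Rn_Ck (Suc 0) n U (\<lambda>x. h x j)"
    using assms(4,5) unfolding Rn_smooth_map_def Rn_smooth_def by auto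
  then have "partial j (\<lambda>y. f (h y) i) x = (\<Sum>l<n. partial l (\<lambda>y. f y i) (h x) * partial j (\<lambda>x. h x l) x)"
    by (intro partial_compose[OF assms(1,2,3) _ _ assms(6) ij(2)])
  then show "jac_mat n (\<lambda>x. f (h x)) x $$ (i, j) = (jac_mat n f (h x) * jac_mat n h x) $$ (i, j)"
    using ij by (simp add: jac_mat_def scalar_prod_def atLeast0LessThan)
qed (auto simp: jac_mat_def)

lemma jac_mat_id:
  assumes "openin (Euclidean_space n) U" "x \<in> U" "\<And>y i. y \<in> U \<Longrightarrow> i < n \<Longrightarrow> h y i = y i"
  shows "jac_mat n h x = 1\<^sub>m n"
proof -
  have "jac_mat n h x = jac_mat n (\<lambda>y. y) x"
    by (rule jac_mat_cong[OF assms])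
  also have "\<dots> = 1\<^sub>m n"
    by (rule eq_matI) (auto simp: jac_mat_def partial_def)
  finally show ?thesis .
qed

definition mulv :: "real mat \<Rightarrow> (nat \<Rightarrow> real) \<Rightarrow> nat \<Rightarrow> real" where
  "mulv A w = (\<lambda>i. if i < dim_row A then \<Sum>j<dim_col A. A $$ (i, j) * w j else 0)"

lemma mulv_E: "A \<in> carrier_mat n n \<Longrightarrow> mulv A w \<in> E n"
  by (auto simp: mulv_def E_iff)

lemma mulv_one: "w \<in> E n \<Longrightarrow> mulv (1\<^sub>m n) w = w"
  by (auto simp: mulv_def E_iff fun_eq_iff if_distrib[of "\<lambda>t. t * _"] cong: if_cong)

lemma mulv_mult:
  assumes "A \<in> carrier_mat n n" "B \<in> carrier_mat n n"
  shows "mulv (A * B) w = mulv A (mulv B w)"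
proof
  fix i
  show "mulv (A * B) w i = mulv A (mulv B w) i"
  proof (cases "i < n")
    case True
    have "mulv (A * B) w i = (\<Sum>j<n. (\<Sum>k<n. A $$ (i, k) * B $$ (k, j)) * w j)"
      using True assms by (simp add: mulv_def scalar_prod_def atLeast0LessThan)
    also have "\<dots> = (\<Sum>k<n. A $$ (i, k) * (\<Sum>j<n. B $$ (k, j) * w j))"
      by (simp add: sum_distrib_left sum_distrib_right mult.assoc) (rule sum.swap)
    also have "\<dots> = mulv A (mulv B w) i"
      using True assms by (simp add: mulv_def)
    finally show ?thesis .
  qed (use assms in \<open>simp add: mulv_def\<close>)
qed

lemma mulv_zero: "mulv A (\<lambda>i. 0) = (\<lambda>i. 0)"
  by (simp add: mulv_def fun_eq_iff)

text \<open>\<open>jac\<close> has a sum at every index, whereas \<open>mulv\<close> is 0 from the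
  dimension on. They agree because the components of \<open>h\<close> from \<open>n\<close> on
  vanish on \<open>U\<close>, and so do their derivatives.\<close>

lemma jac_mulv:
  assumes "openin (Euclidean_space n) U" "x \<in> U" "\<And>y. y \<in> U \<Longrightarrow> h y \<in> E n"
  shows "jac n h x w = mulv (jac_mat n h x) w"
proof
  fix i
  show "jac n h x w i = mulv (jac_mat n h x) w i"
  proof (cases "i < n")
    case False
    have "partial j (\<lambda>y. h y i) x = 0" if "j < n" for j
      using partial_cong[OF assms(1,2) that, of "\<lambda>y. h y i" "\<lambda>_. 0"] assms(3) False
      by (auto simp: E_iff partial_def)
    then show ?thesis using False by (simp add: jac_def mulv_def jac_mat_def)
  qed (simp add: jac_def mulv_def jac_mat_def)
qed

section \<open>Charts and their inverses\<close>

lemma is_chart_inj: "is_chart X n c \<Longrightarrow> inj_on (snd c) (fst c)"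
proof -
  assume c: "is_chart X n c"
  then have "openin X (fst c)" and
    h: "homeomorphic_map (subtopology X (fst c)) (subtopology (Euclidean_space n) (snd c ` fst c)) (snd c)"
    by (auto simp: is_chart_def)
  then show ?thesis
    using homeomorphic_imp_injective_map[OF h] openin_subset[of X "fst c"] by (simp add: inf_absorb2)
qed

lemma chart_inv_left: "is_chart X n c \<Longrightarrow> p \<in> fst c \<Longrightarrow> chart_inv c (snd c p) = p"
  by (simp add: chart_inv_def inv_into_f_f is_chart_inj)

lemma chart_inv_right: "x \<in> snd c ` fst c \<Longrightarrow> snd c (chart_inv c x) = x \<and> chart_inv c x \<in> fst c"
  by (simp add: chart_inv_def f_inv_into_f inv_into_into)

lemma is_chart_image_open:
  assumes c: "is_chart X n c" and W: "openin X W" "W \<subseteq> fst c"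
  shows "openin (Euclidean_space n) (snd c ` W)"
proof -
  have o: "openin X (fst c)" "openin (Euclidean_space n) (snd c ` fst c)" and
    h: "homeomorphic_map (subtopology X (fst c)) (subtopology (Euclidean_space n) (snd c ` fst c)) (snd c)"
    using c by (auto simp: is_chart_def)
  have "openin (subtopology X (fst c)) W" using W o by (simp add: openin_open_subtopology)
  then have "openin (subtopology (Euclidean_space n) (snd c ` fst c)) (snd c ` W)"
    using homeomorphic_imp_open_map[OF h] by (simp add: open_map_def)
  then show ?thesis using o(2) by (simp add: openin_open_subtopology)
qed

lemma is_chart_E: "is_chart X n c \<Longrightarrow> p \<in> fst c \<Longrightarrow> snd c p \<in> E n"
  using openin_subset[of "Euclidean_space n" "snd c ` fst c"] by (auto simp: is_chart_def)

lemma second_countable_Euclidean_space: "second_countable (Euclidean_space n)"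
proof -
  have "second_countable (euclidean :: (nat \<Rightarrow> real) topology)"
  proof -
    obtain B :: "(nat \<Rightarrow> real) set set" where B: "countable B" "topological_basis B"
      using ex_countable_basis[where 'a="nat \<Rightarrow> real"] by auto
    have "\<exists>V\<in>B. x \<in> V \<and> V \<subseteq> U" if U: "openin euclidean U \<and> x \<in> U" for U :: "(nat \<Rightarrow> real) set" and x
    proof -
      have "open U" "x \<in> U" using U by simp_all
      then obtain V where "V \<in> B" "x \<in> V" "V \<subseteq> U" by (rule topological_basisE[OF B(2)])
      then show ?thesis by (intro bexI conjI)
    qed
    moreover have "openin euclidean V" if "V \<in> B" for V
      using topological_basis_open[OF B(2) that] by simp
    ultimately show ?thesis
      unfolding second_countable_def
      by (intro exI[of _ B] conjI allI impI ballI B(1))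
  qed
  then show ?thesis
    by (simp add: Euclidean_space_def second_countable_subtopology euclidean_product_topology)
qed

section \<open>A copy of Euclidean space as a smooth manifold\<close>

text \<open>The points of a manifold come from a prescribed type, so Euclidean space has to be
  copied into it along an injection.\<close>

locale euclidean_copy =
  fixes n :: nat and \<iota> :: "(nat \<Rightarrow> real) \<Rightarrow> 'a"
  assumes inj_iota: "inj_on \<iota> (E n)"
begin

definition pts :: "'a set" where "pts = \<iota> ` E n"

text \<open>The restriction is there because charts have to be extensional.\<close>

definition \<kappa> :: "'a \<Rightarrow> nat \<Rightarrow> real" where "\<kappa> = restrict (inv_into (E n) \<iota>) pts"

abbreviation c0 :: "'a chart" where "c0 \<equiv> (pts, \<kappa>)"

definition Mtop :: "'a topology" where "Mtop = pullback_topology pts \<kappa> (Euclidean_space n)"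

definition M :: "'a manifold" where
  "M = \<lparr>mtop = Mtop, atlas = max_atlas Mtop n {c0}, mdim = n\<rparr>"

lemma M_simps [simp]: "mtop M = Mtop" "atlas M = max_atlas Mtop n {c0}" "mdim M = n"
  by (simp_all add: M_def)

lemma iota_pts: "x \<in> E n \<Longrightarrow> \<iota> x \<in> pts"
  by (simp add: pts_def)

lemma kappa_iota [simp]: "x \<in> E n \<Longrightarrow> \<kappa> (\<iota> x) = x"
  by (simp add: \<kappa>_def iota_pts inv_into_f_f inj_iota)

lemma kappa_E: "p \<in> pts \<Longrightarrow> \<kappa> p \<in> E n"
  and iota_kappa [simp]: "p \<in> pts \<Longrightarrow> \<iota> (\<kappa> p) = p"
  by (auto simp: pts_def)

lemma Mtop_topspace [simp]: "topspace Mtop = pts"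
  using kappa_E by (auto simp: Mtop_def topspace_pullback_topology)

lemma kappa_homeo: "homeomorphic_maps Mtop (Euclidean_space n) \<kappa> \<iota>"
proof -
  have "continuous_map Mtop (Euclidean_space n) (id \<circ> \<kappa>)"
    unfolding Mtop_def by (rule continuous_map_pullback) simp
  moreover have "continuous_map (Euclidean_space n) Mtop \<iota>"
    unfolding Mtop_def
  proof (rule continuous_map_pullback')
    show "continuous_map (Euclidean_space n) (Euclidean_space n) (\<kappa> \<circ> \<iota>)"
      by (rule continuous_map_eq[OF continuous_map_id]) simp
  qed (auto intro: iota_pts)
  ultimately show ?thesis
    by (simp add: homeomorphic_maps_def)
qed

lemma kappa_image: "\<kappa> ` pts = E n"
  by (force simp: pts_def)

lemma chart_inv_c0: "x \<in> E n \<Longrightarrow> chart_inv c0 x = \<iota> x"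
proof -
  assume x: "x \<in> E n"
  have "inj_on \<kappa> pts" by (rule inj_on_inverseI[of _ \<iota>]) simp
  then have "inv_into pts \<kappa> (\<kappa> (\<iota> x)) = \<iota> x" by (rule inv_into_f_f) (rule iota_pts[OF x])
  then show ?thesis using x by (simp add: chart_inv_def)
qed

lemma c0_chart: "is_chart Mtop n c0"
proof -
  have "homeomorphic_map Mtop (Euclidean_space n) \<kappa>"
    using kappa_homeo homeomorphic_map_maps by blast
  moreover have "openin Mtop pts" by (metis Mtop_topspace openin_topspace)
  moreover have "subtopology Mtop pts = Mtop" by (metis Mtop_topspace subtopology_topspace)
  ultimately show ?thesis
    by (simp add: is_chart_def kappa_image) (simp add: \<kappa>_def)
qed

lemma c0_compatible: "compatible n c0 c0"
proof -
  have "Rn_smooth n (E n) (\<lambda>x. \<kappa> (chart_inv c0 x) i)" for i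
    by (rule Rn_smooth_cong[OF openin_topspace _ Rn_smooth_coord[OF openin_topspace]])
      (simp add: chart_inv_c0)
  then show ?thesis
    by (simp add: compatible_def Rn_smooth_map_def local_rep_def kappa_image)
qed

lemma atlas_iff: "c \<in> max_atlas Mtop n {c0} \<longleftrightarrow> is_chart Mtop n c \<and> compatible n c c0"
  by (simp add: max_atlas_def)

lemma c0_atlas [simp]: "c0 \<in> max_atlas Mtop n {c0}"
  using c0_chart c0_compatible by (simp add: atlas_iff)

context
  fixes c assumes c: "c \<in> max_atlas Mtop n {c0}"
begin

lemma atlas_chart: "is_chart Mtop n c"
  using c by (simp add: atlas_iff)

lemma chart_open: "openin Mtop (fst c)" "fst c \<subseteq> pts"
  using atlas_chart openin_subset[of Mtop "fst c"] by (auto simp: is_chart_def)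

lemma to_c0_smooth: "Rn_smooth_map n (snd c ` fst c) (local_rep c (\<lambda>q. q) c0)"
  and from_c0_smooth: "Rn_smooth_map n (\<kappa> ` fst c) (local_rep c0 (\<lambda>q. q) c)"
proof -
  have "fst c \<inter> pts = fst c" using chart_open by auto
  then show "Rn_smooth_map n (snd c ` fst c) (local_rep c (\<lambda>q. q) c0)"
    "Rn_smooth_map n (\<kappa> ` fst c) (local_rep c0 (\<lambda>q. q) c)"
    using c by (simp_all add: atlas_iff compatible_def)
qed

lemma kappa_open: "openin (Euclidean_space n) (\<kappa> ` fst c)"
  using is_chart_image_open[OF c0_chart, of "fst c"] chart_open by simp

lemma chart_image_open: "openin (Euclidean_space n) (snd c ` fst c)"
  using atlas_chart by (simp add: is_chart_def)

lemma to_c0: "p \<in> fst c \<Longrightarrow> local_rep c (\<lambda>q. q) c0 (snd c p) = \<kappa> p"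
  by (simp add: local_rep_def chart_inv_left[OF atlas_chart])

lemma from_c0: "p \<in> fst c \<Longrightarrow> local_rep c0 (\<lambda>q. q) c (\<kappa> p) = snd c p"
  using chart_open by (simp add: local_rep_def chart_inv_c0 kappa_E subset_iff)

end

section \<open>Smoothness and Jacobians tested in the global chart\<close>

definition c0_smooth :: "('a \<Rightarrow> 'a) \<Rightarrow> bool" where
  "c0_smooth f \<longleftrightarrow> f \<in> pts \<rightarrow> pts \<and> Rn_smooth_map n (E n) (\<lambda>y. \<kappa> (f (\<iota> y)))"

lemma c0_smooth_id: "c0_smooth (\<lambda>q. q)"
  unfolding c0_smooth_def Rn_smooth_map_def
  by (auto intro: Rn_smooth_cong[OF openin_topspace _ Rn_smooth_coord[OF openin_topspace]])

lemma c0_smooth_pts: "c0_smooth f \<Longrightarrow> p \<in> pts \<Longrightarrow> f p \<in> pts"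
  by (auto simp: c0_smooth_def)

lemma c0_smooth_continuous:
  assumes f: "c0_smooth f" shows "continuous_map Mtop Mtop f"
proof -
  have "continuous_map (Euclidean_space n) euclideanreal (\<lambda>y. \<kappa> (f (\<iota> y)) i)" for i
  proof -
    have "Rn_Ck 0 n (E n) (\<lambda>y. \<kappa> (f (\<iota> y)) i)"
      using f by (simp add: c0_smooth_def Rn_smooth_map_def Rn_smooth_def)
    then show ?thesis by simp
  qed
  then have "continuous_map (Euclidean_space n) (Euclidean_space n) (\<lambda>y. \<kappa> (f (\<iota> y)))"
    using c0_smooth_pts[OF f] by (auto simp: continuous_map_into_E intro: iota_pts kappa_E)
  moreover have "continuous_map Mtop (Euclidean_space n) \<kappa>" "continuous_map (Euclidean_space n) Mtop \<iota>"
    using kappa_homeo by (simp_all add: homeomorphic_maps_def)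
  ultimately have "continuous_map Mtop Mtop (\<iota> \<circ> ((\<lambda>y. \<kappa> (f (\<iota> y))) \<circ> \<kappa>))"
    by (intro continuous_map_compose)
  then show ?thesis
    by (rule continuous_map_eq) (use c0_smooth_pts[OF f] in simp)
qed

context
  fixes c c' :: "'a chart" and f :: "'a \<Rightarrow> 'a"
  assumes c: "c \<in> max_atlas Mtop n {c0}" and c': "c' \<in> max_atlas Mtop n {c0}" and f: "c0_smooth f"
begin

abbreviation "ovl \<equiv> {q \<in> fst c. f q \<in> fst c'}"

lemma ovl_open: "openin (Euclidean_space n) (snd c ` ovl)"
proof (rule is_chart_image_open[OF atlas_chart[OF c]])
  have "openin Mtop (f -` fst c' \<inter> topspace Mtop)"
    by (rule continuous_map_open[OF c0_smooth_continuous[OF f] chart_open(1)[OF c']])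
  then have "openin Mtop (fst c \<inter> (f -` fst c' \<inter> topspace Mtop))"
    by (rule openin_Int[OF chart_open(1)[OF c]])
  moreover have "fst c \<inter> (f -` fst c' \<inter> topspace Mtop) = ovl"
    using chart_open(2)[OF c] by auto
  ultimately show "openin Mtop ovl" by simp
qed auto

text \<open>Every local representation passes through \<open>c0\<close> on both sides. Smoothness
  and Jacobians in arbitrary charts thus reduce to those in \<open>c0\<close> and those of the chart
  changes.\<close>

lemma local_rep_factor:
  assumes "x \<in> snd c ` ovl"
  shows "local_rep c f c' x = local_rep c0 (\<lambda>q. q) c' (\<kappa> (f (\<iota> (local_rep c (\<lambda>q. q) c0 x))))"
proof -
  obtain p where p: "x = snd c p" "p \<in> fst c" "f p \<in> fst c'" using assms by auto
  then have "p \<in> pts" using chart_open(2)[OF c] by auto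
  then show ?thesis
    using p by (simp add: to_c0[OF c] from_c0[OF c']) (simp add: local_rep_def chart_inv_left[OF atlas_chart[OF c]])
qed

abbreviation "h1 \<equiv> local_rep c (\<lambda>q. q) c0"
abbreviation "h2 \<equiv> \<lambda>y. \<kappa> (f (\<iota> y))"
abbreviation "h3 \<equiv> local_rep c0 (\<lambda>q. q) c'"

lemma h1_smooth: "Rn_smooth_map n (snd c ` ovl) h1"
  using to_c0_smooth[OF c] unfolding Rn_smooth_map_def
  by (auto intro: Rn_smooth_subset)

lemma h1_E: "x \<in> snd c ` ovl \<Longrightarrow> h1 x \<in> E n"
  using to_c0[OF c] chart_open(2)[OF c] kappa_E by auto

lemma h2_smooth: "Rn_smooth_map n (E n) h2"
  using f by (simp add: c0_smooth_def)

lemma h21_smooth: "Rn_smooth_map n (snd c ` ovl) (\<lambda>x. h2 (h1 x))"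
  unfolding Rn_smooth_map_def
proof
  fix i
  show "Rn_smooth n (snd c ` ovl) (\<lambda>x. h2 (h1 x) i)"
    by (rule Rn_smooth_compose[OF ovl_open openin_topspace h1_E])
      (use h1_smooth h2_smooth in \<open>simp_all add: Rn_smooth_map_def\<close>)
qed

lemma h21_dom: "x \<in> snd c ` ovl \<Longrightarrow> h2 (h1 x) \<in> \<kappa> ` fst c'"
proof -
  assume "x \<in> snd c ` ovl"
  then obtain p where p: "x = snd c p" "p \<in> fst c" "f p \<in> fst c'" by auto
  then have "p \<in> pts" using chart_open(2)[OF c] by auto
  then show ?thesis using p by (simp add: to_c0[OF c])
qed

lemma local_rep_smooth: "Rn_smooth_map n (snd c ` ovl) (local_rep c f c')"
  unfolding Rn_smooth_map_def
proof
  fix i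
  have "Rn_smooth n (snd c ` ovl) (\<lambda>x. h3 (h2 (h1 x)) i)"
    by (rule Rn_smooth_compose[OF ovl_open kappa_open[OF c'] h21_dom])
      (use h21_smooth from_c0_smooth[OF c'] in \<open>simp_all add: Rn_smooth_map_def\<close>)
  then show "Rn_smooth n (snd c ` ovl) (\<lambda>x. local_rep c f c' x i)"
    by (rule Rn_smooth_cong[OF ovl_open, rotated]) (simp only: local_rep_factor)
qed

lemma jac_mat_local_rep:
  assumes p: "p \<in> fst c" "f p \<in> fst c'"
  shows "jac_mat n (local_rep c f c') (snd c p) =
    jac_mat n (local_rep c0 (\<lambda>q. q) c') (\<kappa> (f p)) *
      (jac_mat n (\<lambda>y. \<kappa> (f (\<iota> y))) (\<kappa> p) * jac_mat n (local_rep c (\<lambda>q. q) c0) (snd c p))"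
proof -
  have x: "snd c p \<in> snd c ` ovl" using p by auto
  have pp: "p \<in> pts" using chart_open(2)[OF c] p by auto
  have "jac_mat n (local_rep c f c') (snd c p) = jac_mat n (\<lambda>x. h3 (h2 (h1 x))) (snd c p)"
    by (rule jac_mat_cong[OF ovl_open x]) (simp only: local_rep_factor)
  also have "\<dots> = jac_mat n h3 (h2 (h1 (snd c p))) * jac_mat n (\<lambda>x. h2 (h1 x)) (snd c p)"
    by (rule jac_mat_compose[OF ovl_open kappa_open[OF c'] h21_dom from_c0_smooth[OF c'] h21_smooth x])
  also have "jac_mat n (\<lambda>x. h2 (h1 x)) (snd c p) = jac_mat n h2 (h1 (snd c p)) * jac_mat n h1 (snd c p)"
    by (rule jac_mat_compose[OF ovl_open openin_topspace h1_E h2_smooth h1_smooth x])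
  finally show ?thesis using pp p by (simp add: to_c0[OF c])
qed

lemma jac_local_rep:
  assumes p: "p \<in> fst c" "f p \<in> fst c'"
  shows "jac n (local_rep c f c') (snd c p) w = mulv (jac_mat n (local_rep c f c') (snd c p)) w"
proof (rule jac_mulv[OF ovl_open])
  show "snd c p \<in> snd c ` ovl" using p by auto
  fix y assume "y \<in> snd c ` ovl"
  then obtain q where q: "y = snd c q" "q \<in> fst c" "f q \<in> fst c'" by auto
  then show "local_rep c f c' y \<in> E n"
    using is_chart_E[OF atlas_chart[OF c']] by (simp add: local_rep_def chart_inv_left[OF atlas_chart[OF c]])
qed

end

text \<open>The Jacobians at a point of the change from \<open>c0\<close> to \<open>c\<close>, of its inverse, and of a map seen in \<open>c0\<close>.\<close>

definition S :: "'a chart \<Rightarrow> 'a \<Rightarrow> real mat" where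
  "S c p = jac_mat n (local_rep c0 (\<lambda>q. q) c) (\<kappa> p)"

definition T :: "'a chart \<Rightarrow> 'a \<Rightarrow> real mat" where
  "T c p = jac_mat n (local_rep c (\<lambda>q. q) c0) (snd c p)"

definition F :: "('a \<Rightarrow> 'a) \<Rightarrow> 'a \<Rightarrow> real mat" where
  "F f p = jac_mat n (\<lambda>y. \<kappa> (f (\<iota> y))) (\<kappa> p)"

lemma S_carrier [simp]: "S c p \<in> carrier_mat n n"
  and T_carrier [simp]: "T c p \<in> carrier_mat n n"
  and F_carrier [simp]: "F f p \<in> carrier_mat n n"
  by (simp_all add: S_def T_def F_def)

lemma F_id: "p \<in> pts \<Longrightarrow> F (\<lambda>q. q) p = 1\<^sub>m n"
  unfolding F_def by (rule jac_mat_id[OF openin_topspace]) (simp_all add: kappa_E)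

lemma jac_chart:
  assumes "c \<in> max_atlas Mtop n {c0}" "c' \<in> max_atlas Mtop n {c0}" "c0_smooth f" "p \<in> fst c" "f p \<in> fst c'"
  shows "jac_mat n (local_rep c f c') (snd c p) = S c' (f p) * (F f p * T c p)"
  using jac_mat_local_rep[OF assms] by (simp add: S_def T_def F_def)

lemma jac_chart_id:
  assumes c: "c \<in> max_atlas Mtop n {c0}" "c' \<in> max_atlas Mtop n {c0}" "p \<in> fst c" "p \<in> fst c'"
  shows "jac_mat n (local_rep c (\<lambda>q. q) c') (snd c p) = S c' p * T c p"
proof -
  have "p \<in> pts" using chart_open(2)[OF c(1)] c by auto
  then show ?thesis
    using jac_chart[OF c(1,2) c0_smooth_id c(3,4)] F_id[of p] left_mult_one_mat[OF T_carrier] by simp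
qed

lemma S_c0: "p \<in> pts \<Longrightarrow> S c0 p = 1\<^sub>m n"
  unfolding S_def
  by (rule jac_mat_id[OF openin_topspace]) (auto simp: kappa_E local_rep_def chart_inv_c0)

lemma ST:
  assumes c: "c \<in> max_atlas Mtop n {c0}" "p \<in> fst c"
  shows "S c p * T c p = 1\<^sub>m n" "T c p * S c p = 1\<^sub>m n"
proof -
  have id: "jac_mat n (local_rep c (\<lambda>q. q) c) (snd c p) = 1\<^sub>m n"
  proof (rule jac_mat_id[OF chart_image_open[OF c(1)]])
    show "local_rep c (\<lambda>q. q) c y i = y i" if "y \<in> snd c ` fst c" for y i
      using chart_inv_right[OF that] by (simp add: local_rep_def)
  qed (use c in simp)
  then show ST: "S c p * T c p = 1\<^sub>m n" using jac_chart_id[OF c(1,1,2,2)] by simp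
  show "T c p * S c p = 1\<^sub>m n"
    by (rule mat_mult_left_right_inverse[OF S_carrier T_carrier ST])
qed

lemma smooth_manifold_M: "smooth_manifold M"
proof -
  have sp: "Mtop homeomorphic_space Euclidean_space n"
    using kappa_homeo homeomorphic_space_def by blast
  have "Hausdorff_space Mtop"
    using homeomorphic_Hausdorff_space[OF sp] Hausdorff_Euclidean_space by blast
  moreover have "second_countable Mtop"
    using homeomorphic_space_second_countability[OF sp] second_countable_Euclidean_space by blast
  \<comment> \<open>Two charts compatible with \<open>c0\<close> are compatible with each other,
    since the change between them factors through \<open>c0\<close>; hence the atlas is
    maximal.\<close>
  moreover have "compatible n c c'" if "c \<in> max_atlas Mtop n {c0}" "c' \<in> max_atlas Mtop n {c0}" for c c'
  proof -
    have "{q \<in> fst c. q \<in> fst c'} = fst c \<inter> fst c'" "{q \<in> fst c'. q \<in> fst c} = fst c \<inter> fst c'" by auto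
    then show ?thesis
      using local_rep_smooth[OF that c0_smooth_id] local_rep_smooth[OF that(2,1) c0_smooth_id]
      by (simp add: compatible_def)
  qed
  then have "max_atlas Mtop n {c0} = max_atlas Mtop n (max_atlas Mtop n {c0})"
    using c0_atlas by (auto simp: max_atlas_def)
  moreover have "c0 \<in> {c \<in> max_atlas Mtop n {c0}. p \<in> fst c}" if "p \<in> pts" for p
    using c0_atlas that by simp
  ultimately show ?thesis
    unfolding smooth_manifold_def M_simps Mtop_topspace by (intro conjI ballI) (assumption | blast)+
qed

section \<open>Tangent vectors and differentials in the global chart\<close>

abbreviation tv :: "'a \<Rightarrow> (nat \<Rightarrow> real) \<Rightarrow> 'a tvec" where
  "tv p w \<equiv> tvec_of M c0 p w"

lemma fst_tv [simp]: "fst (tv p w) = p"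
  by (simp add: tvec_of_def)

lemma pair_tv: "(p, snd (tv p w)) = tv p w"
  by (simp add: prod_eq_iff)

lemma snd_tv:
  assumes "p \<in> pts"
  shows "snd (tv p w) c = (if c \<in> max_atlas Mtop n {c0} \<and> p \<in> fst c then mulv (S c p) w else (\<lambda>_. 0))"
  using jac_local_rep[OF c0_atlas _ c0_smooth_id, of c p] assms
  by (auto simp: tvec_of_def S_def)

lemma snd_tv_c0 [simp]: "p \<in> pts \<Longrightarrow> w \<in> E n \<Longrightarrow> snd (tv p w) c0 = w"
  by (simp add: snd_tv S_c0 mulv_one)

lemma tv_tangent:
  assumes p: "p \<in> pts" and w: "w \<in> E n"
  shows "tv p w \<in> tangent M p"
proof -
  have "snd (tv p w) c' = jac n (local_rep c (\<lambda>q. q) c') (snd c p) (snd (tv p w) c)"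
    if c: "c \<in> max_atlas Mtop n {c0}" "p \<in> fst c" and c': "c' \<in> max_atlas Mtop n {c0}" "p \<in> fst c'" for c c'
  proof -
    have "jac n (local_rep c (\<lambda>q. q) c') (snd c p) (snd (tv p w) c) =
        mulv (S c' p * T c p) (mulv (S c p) w)"
      using c c' p by (simp add: jac_local_rep[OF _ _ c0_smooth_id] jac_chart_id snd_tv)
    also have "\<dots> = mulv (S c' p) (mulv (T c p * S c p) w)"
      by (simp add: mulv_mult[of _ n])
    also have "\<dots> = snd (tv p w) c'"
      using c c' p w by (simp add: ST mulv_one snd_tv)
    finally show ?thesis by simp
  qed
  moreover have "snd (tv p w) c \<in> E n" for c
    using p mulv_E[OF S_carrier] by (auto simp: snd_tv E_iff)
  moreover have "snd (tv p w) c = (\<lambda>_. 0)" if "c \<notin> {c \<in> max_atlas Mtop n {c0}. p \<in> fst c}" for c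
    unfolding snd_tv[OF p] by (rule if_not_P) (use that in blast)
  ultimately have "(p, snd (tv p w)) \<in> tangent M p"
    unfolding tangent_def mem_Collect_eq case_prod_conv M_simps
    by (intro conjI allI impI ballI) (blast | simp)+
  then show ?thesis by (metis fst_tv prod.collapse)
qed

text \<open>The domain of \<open>c0\<close> is the whole space, so the \<open>c0\<close>-coordinates
  determine those in all other charts.\<close>

lemma tangent_tv:
  assumes p: "p \<in> pts" and v: "(q, v) \<in> tangent M p"
  shows "q = p" "v c0 \<in> E n" "v = snd (tv p (v c0))"
proof -
  have t: "q = p \<and> (\<forall>c. c \<notin> charts_at M p \<longrightarrow> v c = (\<lambda>_. 0)) \<and>
     (\<forall>c\<in>charts_at M p. v c \<in> E n) \<and>
     (\<forall>c\<in>charts_at M p. \<forall>c'\<in>charts_at M p. v c' = jac n (local_rep c (\<lambda>q. q) c') (snd c p) (v c))"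
    using v unfolding tangent_def mem_Collect_eq case_prod_conv M_simps .
  from t have q: "q = p" by (rule conjunct1)
  from t have v0: "v c = (\<lambda>_. 0)" if "c \<notin> charts_at M p" for c
    by (elim conjE allE[of _ c]) (rule mp, assumption, rule that)
  from t have vE: "v c \<in> E n" if "c \<in> charts_at M p" for c
    by (elim conjE) (rule bspec[OF _ that])
  from t have vc: "v c' = jac n (local_rep c (\<lambda>q. q) c') (snd c p) (v c)"
    if "c \<in> charts_at M p" "c' \<in> charts_at M p" for c c'
    by (elim conjE) (rule bspec[OF bspec[OF _ that(1)] that(2)])
  have c0p: "c0 \<in> charts_at M p" using p by simp
  show "q = p" by (rule q)
  show "v c0 \<in> E n" by (rule vE[OF c0p])
  show "v = snd (tv p (v c0))"
  proof
    fix c show "v c = snd (tv p (v c0)) c"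
    proof (cases "c \<in> charts_at M p")
      case True
      then have c: "c \<in> max_atlas Mtop n {c0}" "p \<in> fst c" by simp_all
      have "v c = jac n (local_rep c0 (\<lambda>q. q) c) (\<kappa> p) (v c0)" using vc[OF c0p True] by simp
      also have "\<dots> = mulv (S c p) (v c0)"
        using jac_local_rep[OF c0_atlas c(1) c0_smooth_id, of p] c(2) p by (simp add: S_def)
      finally show ?thesis using c by (simp add: snd_tv[OF p])
    next
      case False
      then have "\<not> (c \<in> max_atlas Mtop n {c0} \<and> p \<in> fst c)" by auto
      then show ?thesis unfolding v0[OF False] snd_tv[OF p] by (rule if_not_P[symmetric])
    qed
  qed
qed

text \<open>\<open>dmap\<close> computes in an unspecified chart at \<open>p\<close>. The choice is
  immaterial because \<open>T c p\<close> and \<open>S c p\<close> cancel.\<close>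

lemma dmap_tv:
  assumes f: "c0_smooth f" and p: "p \<in> pts" and w: "w \<in> E n"
  shows "dmap M M f (tv p w) = tv (f p) (mulv (F f p) w)"
proof -
  define c where "c = (SOME c. c \<in> charts_at M p)"
  have "c0 \<in> charts_at M p" using p by simp
  then have "c \<in> charts_at M p" unfolding c_def by (rule someI)
  then have c: "c \<in> max_atlas Mtop n {c0}" "p \<in> fst c" by auto
  have fp: "f p \<in> pts" using c0_smooth_pts[OF f p] .
  have eq: "jac n (local_rep c f c') (snd c p) (snd (tv p w) c) = mulv (S c' (f p)) (mulv (F f p) w)"
    if c': "c' \<in> max_atlas Mtop n {c0}" "f p \<in> fst c'" for c'
  proof -
    have "jac n (local_rep c f c') (snd c p) (snd (tv p w) c) =
        mulv (S c' (f p) * (F f p * T c p)) (mulv (S c p) w)"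
      using c c' p f by (simp add: jac_local_rep jac_chart snd_tv)
    also have "\<dots> = mulv (S c' (f p)) (mulv (F f p) (mulv (T c p * S c p) w))"
      by (simp add: mulv_mult[of _ n] mult_carrier_mat[of _ n n])
    also have "\<dots> = mulv (S c' (f p)) (mulv (F f p) w)"
      using c w by (simp add: ST mulv_one)
    finally show ?thesis .
  qed
  have "dmap M M f (p, v) = (f p, \<lambda>c'. if c' \<in> charts_at M (f p)
      then jac n (local_rep c f c') (snd c p) (v c) else (\<lambda>_. 0))" for v
    by (simp only: dmap_def case_prod_conv Let_def M_simps(3) c_def)
  from this[of "snd (tv p w)"] have "dmap M M f (tv p w) = (f p, \<lambda>c'. if c' \<in> charts_at M (f p)
      then jac n (local_rep c f c') (snd c p) (snd (tv p w) c) else (\<lambda>_. 0))"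
    by (simp only: pair_tv)
  also have "\<dots> = (f p, snd (tv (f p) (mulv (F f p) w)))"
  proof (rule arg_cong[of _ _ "Pair (f p)"], rule ext)
    fix c'
    show "(if c' \<in> charts_at M (f p) then jac n (local_rep c f c') (snd c p) (snd (tv p w) c) else (\<lambda>_. 0)) =
        snd (tv (f p) (mulv (F f p) w)) c'"
      unfolding snd_tv[OF fp] M_simps mem_Collect_eq by (rule if_cong[OF refl _ refl], rule eq) blast+
  qed
  finally show ?thesis by (simp add: prod_eq_iff)
qed

section \<open>Frames and the standard orientation\<close>

definition colf :: "real mat \<Rightarrow> nat \<Rightarrow> nat \<Rightarrow> real" where
  "colf X j = (\<lambda>i. if i < n then X $$ (i, j) else 0)"

lemma colf_E [simp]: "colf X j \<in> E n"
  by (simp add: colf_def E_iff)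

lemma mulv_colf:
  assumes "A \<in> carrier_mat n n" "X \<in> carrier_mat n n" "j < n"
  shows "mulv A (colf X j) = colf (A * X) j"
  using assms by (auto simp: mulv_def colf_def fun_eq_iff scalar_prod_def atLeast0LessThan)

text \<open>The frame at \<open>p\<close> whose matrix in the chart \<open>c0\<close> is \<open>X\<close>.\<close>

definition fr :: "'a \<Rightarrow> real mat \<Rightarrow> 'a frame" where
  "fr p X = (p, \<lambda>j. if j < n then snd (tv p (colf X j)) else (\<lambda>_ _. 0))"

lemma fst_fr [simp]: "fst (fr p X) = p"
  by (simp add: fr_def)

lemma frame_mat_fr:
  assumes "c \<in> max_atlas Mtop n {c0}" "p \<in> fst c" "X \<in> carrier_mat n n"
  shows "frame_mat M c (fr p X) = S c p * X"
proof (rule eq_matI)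
  fix i j assume "i < dim_row (S c p * X)" "j < dim_col (S c p * X)"
  then have ij: "i < n" "j < n" using assms carrier_matD(1)[OF S_carrier] by auto
  have p: "p \<in> pts" using chart_open(2)[OF assms(1)] assms(2) by auto
  show "frame_mat M c (fr p X) $$ (i, j) = (S c p * X) $$ (i, j)"
    using ij assms by (simp add: frame_mat_def fr_def snd_tv[OF p] mulv_colf del: index_mult_mat(1)) (simp add: colf_def)
qed (use assms carrier_matD(1)[OF S_carrier] in \<open>auto simp: frame_mat_def\<close>)

lemma frame_mat_fr_c0: "p \<in> pts \<Longrightarrow> X \<in> carrier_mat n n \<Longrightarrow> frame_mat M c0 (fr p X) = X"
  using frame_mat_fr[OF c0_atlas, of p X] by (simp add: S_c0)

text \<open>Explicit form of the orientation generated by \<open>c0\<close>. The sign is required at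
  every point, as the domain of a chart may be disconnected.\<close>

definition Or :: "'a chart set" where
  "Or = {c \<in> max_atlas Mtop n {c0}. \<forall>p\<in>fst c. 0 < Determinant.det (S c p)}"

lemma c0_Or: "c0 \<in> Or"
  by (simp add: Or_def S_c0)

lemma det_T:
  assumes "c \<in> max_atlas Mtop n {c0}" "p \<in> fst c"
  shows "Determinant.det (S c p) * Determinant.det (T c p) = 1"
  using ST(1)[OF assms] det_mult[OF S_carrier T_carrier, of c p c p] by simp

lemma orientation_Or: "orientation M Or"
proof -
  have key: "Determinant.det (jac_mat n (local_rep c (\<lambda>q. q) c') (snd c p)) =
      Determinant.det (S c' p) * Determinant.det (T c p)"
    if "c \<in> max_atlas Mtop n {c0}" "c' \<in> max_atlas Mtop n {c0}" "p \<in> fst c" "p \<in> fst c'" for c c' p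
    using that by (simp add: jac_chart_id det_mult[OF S_carrier T_carrier])
  have pos: "0 < Determinant.det (T c p) \<longleftrightarrow> 0 < Determinant.det (S c p)"
    if "c \<in> max_atlas Mtop n {c0}" "p \<in> fst c" for c p
  proof -
    have "0 < Determinant.det (S c p) * Determinant.det (T c p)" by (simp only: det_T[OF that] zero_less_one)
    then show ?thesis by (auto simp only: zero_less_mult_iff)
  qed
  have "c \<in> Or \<longleftrightarrow> (\<forall>c'\<in>Or. \<forall>p\<in>fst c \<inter> fst c'.
        0 < Determinant.det (jac_mat n (local_rep c (\<lambda>q. q) c') (snd c p)))"
    if c: "c \<in> max_atlas Mtop n {c0}" for c
  proof
    assume "c \<in> Or"
    then show "\<forall>c'\<in>Or. \<forall>p\<in>fst c \<inter> fst c'. 0 < Determinant.det (jac_mat n (local_rep c (\<lambda>q. q) c') (snd c p))"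
      using c by (auto simp: Or_def key pos)
  next
    assume *: "\<forall>c'\<in>Or. \<forall>p\<in>fst c \<inter> fst c'. 0 < Determinant.det (jac_mat n (local_rep c (\<lambda>q. q) c') (snd c p))"
    have "0 < Determinant.det (S c p)" if p: "p \<in> fst c" for p
    proof -
      have pp: "p \<in> pts" using chart_open(2)[OF c] p by auto
      \<comment> \<open>As \<open>c0\<close> belongs to the orientation and covers everything,
        testing against it alone recovers the sign of \<open>S c p\<close>.\<close>
      then have "0 < Determinant.det (jac_mat n (local_rep c (\<lambda>q. q) c0) (snd c p))"
        using * c0_Or p by auto
      then show ?thesis using key[OF c c0_atlas p] pp pos[OF c p] by (simp add: S_c0)
    qed
    then show "c \<in> Or" using c by (simp add: Or_def)
  qed
  moreover have "\<exists>c\<in>Or. p \<in> fst c" if "p \<in> pts" for p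
    using c0_Or that by (intro bexI[of _ c0]) simp_all
  ultimately show ?thesis
    unfolding orientation_def by (auto simp: Or_def)
qed

lemma fr_pos_frames:
  assumes "p \<in> pts" "X \<in> carrier_mat n n" "0 < Determinant.det X"
  shows "fr p X \<in> pos_frames M Or"
proof -
  have "(p, snd (tv p (colf X j))) \<in> tangent M p" for j
    using tv_tangent[OF assms(1) colf_E] by (metis fst_tv prod.collapse)
  moreover have "0 < Determinant.det (frame_mat M c (fr p X))" if "c \<in> Or" "p \<in> fst c" for c
    using that assms det_mult[OF S_carrier assms(2), of c p] by (simp add: Or_def frame_mat_fr)
  ultimately show ?thesis
    using assms(1) unfolding pos_frames_def fr_def by simp
qed

lemma pos_frames_fr:
  assumes "b \<in> pos_frames M Or"
  shows "fst b \<in> pts" "0 < Determinant.det (frame_mat M c0 b)" "fr (fst b) (frame_mat M c0 b) = b"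
proof -
  obtain p B where b: "b = (p, B)" by (cases b)
  have p: "p \<in> pts" and t: "\<And>j. j < n \<Longrightarrow> (p, B j) \<in> tangent M p" and z: "\<And>j. n \<le> j \<Longrightarrow> B j = (\<lambda>_ _. 0)"
    and d: "0 < Determinant.det (frame_mat M c0 b)"
    using assms c0_Or unfolding pos_frames_def b by auto
  show "fst b \<in> pts" using p b by simp
  show "0 < Determinant.det (frame_mat M c0 b)" by (rule d)
  have "B j = snd (tv p (colf (frame_mat M c0 b) j))" if "j < n" for j
  proof -
    have "colf (frame_mat M c0 b) j = B j c0"
      using tangent_tv(2)[OF p t[OF that]] that by (auto simp: colf_def frame_mat_def b E_iff fun_eq_iff)
    then show ?thesis using tangent_tv(3)[OF p t[OF that]] by simp
  qed
  then show "fr (fst b) (frame_mat M c0 b) = b"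
    using z by (auto simp: fr_def b fun_eq_iff)
qed

lemma frame_mat_carrier [simp]: "frame_mat M c b \<in> carrier_mat n n"
  by (simp add: frame_mat_def)

text \<open>The group multiplies frame matrices from the right and therefore commutes with the
  factor \<open>S c p\<close>, by which a change of chart multiplies from the left.\<close>

lemma frame_act_fr:
  assumes p: "p \<in> pts" and X: "X \<in> carrier_mat n n" and A: "A \<in> carrier_mat n n"
  shows "frame_act n (fr p X) A = fr p (X * A)"
proof -
  have "(\<Sum>k<n. A $$ (k, j) * snd (tv p (colf X k)) c i) = snd (tv p (colf (X * A) j)) c i"
    if j: "j < n" for j c i
  proof (cases "c \<in> max_atlas Mtop n {c0} \<and> p \<in> fst c")
    case True
    have "(\<Sum>k<n. A $$ (k, j) * colf (S c p * X) k i) = colf (S c p * X * A) j i"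
    proof (cases "i < n")
      case True
      then show ?thesis
        using j X A carrier_matD(1)[OF S_carrier, of c p] carrier_matD(2)[OF S_carrier, of c p]
        by (simp add: colf_def index_mult_mat(1)[of i "S c p * X" j A] scalar_prod_def atLeast0LessThan mult.commute
            del: index_mult_mat(1) assoc_mult_mat)
    qed (simp add: colf_def)
    moreover have "S c p * X * A = S c p * (X * A)"
      by (rule assoc_mult_mat[OF S_carrier X A])
    ultimately show ?thesis
      using True X A j by (simp add: snd_tv[OF p] mulv_colf mult_carrier_mat[of _ n n])
  qed (use snd_tv[OF p] in auto)
  then show ?thesis
    by (auto simp: frame_act_def fr_def fun_eq_iff)
qed

lemma dframe_fr:
  assumes f: "c0_smooth f" and p: "p \<in> pts" and X: "X \<in> carrier_mat n n"
  shows "dframe M M f (fr p X) = fr (f p) (F f p * X)"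
proof -
  have "snd (dmap M M f (p, snd (tv p (colf X j)))) = snd (tv (f p) (colf (F f p * X) j))" if "j < n" for j
  proof -
    have "(p, snd (tv p (colf X j))) = tv p (colf X j)" by (simp add: prod_eq_iff)
    then show ?thesis using dmap_tv[OF f p colf_E] X that by (simp add: mulv_colf)
  qed
  then show ?thesis by (auto simp: dframe_def fr_def fun_eq_iff)
qed

end

section \<open>Continuity of matrix-valued maps and the trivial frame bundle\<close>

lemma continuous_map_mat_top:
  fixes f :: "'x \<Rightarrow> 'k::topological_space mat"
  shows "continuous_map X (mat_top n) f \<longleftrightarrow>
    f \<in> topspace X \<rightarrow> carrier_mat n n \<and> (\<forall>i<n. \<forall>j<n. continuous_map X euclidean (\<lambda>x. f x $$ (i, j)))"
    (is "?L \<longleftrightarrow> ?R")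
proof
  let ?g = "\<lambda>A :: 'k mat. \<lambda>ij\<in>{..<n}\<times>{..<n}. A $$ ij"
  assume L: ?L
  have "continuous_map (mat_top n) (product_topology (\<lambda>_. euclidean) ({..<n}\<times>{..<n})) (id \<circ> ?g)"
    unfolding mat_top_def by (rule continuous_map_pullback) simp
  then have 1: "continuous_map X (product_topology (\<lambda>_. euclidean) ({..<n}\<times>{..<n})) ((id \<circ> ?g) \<circ> f)"
    by (rule continuous_map_compose[OF L])
  have "continuous_map X euclidean (\<lambda>x. f x $$ (i, j))" if "i < n" "j < n" for i j
  proof -
    have "(i, j) \<in> {..<n}\<times>{..<n}" using that by simp
    from continuous_map_compose[OF 1 continuous_map_product_projection[OF this]]
    show ?thesis using that by (simp add: o_def)
  qed
  moreover have "f \<in> topspace X \<rightarrow> carrier_mat n n"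
    using continuous_map_funspace[OF L] by simp
  ultimately show ?R by simp
next
  let ?g = "\<lambda>A :: 'k mat. \<lambda>ij\<in>{..<n}\<times>{..<n}. A $$ ij"
  assume R: ?R
  show ?L
    unfolding mat_top_def
  proof (rule continuous_map_pullback')
    show "continuous_map X (product_topology (\<lambda>_. euclidean) ({..<n}\<times>{..<n})) (?g \<circ> f)"
      using R by (auto simp: continuous_map_componentwise)
    show "topspace X \<subseteq> f -` carrier_mat n n" using R by auto
  qed
qed

lemma continuous_map_mat_mult:
  fixes f g :: "'x \<Rightarrow> real mat"
  assumes f: "continuous_map X (mat_top n) f" and g: "continuous_map X (mat_top n) g"
  shows "continuous_map X (mat_top n) (\<lambda>x. f x * g x)"
proof -
  have c: "f x \<in> carrier_mat n n" "g x \<in> carrier_mat n n" if "x \<in> topspace X" for x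
    using that f g by (auto simp: continuous_map_mat_top)
  have "continuous_map X euclidean (\<lambda>x. (f x * g x) $$ (i, j))" if ij: "i < n" "j < n" for i j
  proof (rule continuous_map_eq)
    show "continuous_map X euclidean (\<lambda>x. \<Sum>k<n. f x $$ (i, k) * g x $$ (k, j))"
      using f g ij by (intro continuous_map_sum continuous_map_real_mult) (auto simp: continuous_map_mat_top)
    show "(\<Sum>k<n. f x $$ (i, k) * g x $$ (k, j)) = (f x * g x) $$ (i, j)" if "x \<in> topspace X" for x
      using c[OF that] ij by (simp add: scalar_prod_def atLeast0LessThan)
  qed
  then show ?thesis
    using c unfolding continuous_map_mat_top by (auto intro!: mult_carrier_mat[of _ n n])
qed

context euclidean_copy
begin

text \<open>The topology of the frame bundle is generated by all charts, so the matrix of a frame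
  has to vary continuously in each of them. The first order of smoothness of the chart change
  suffices.\<close>

lemma S_continuous:
  assumes c: "c \<in> max_atlas Mtop n {c0}"
  shows "continuous_map (subtopology (Euclidean_space n) (\<kappa> ` fst c)) (mat_top n) (\<lambda>x. S c (\<iota> x))"
proof -
  have "continuous_map (subtopology (Euclidean_space n) (\<kappa> ` fst c)) euclideanreal (\<lambda>x. S c (\<iota> x) $$ (i, j))"
    if "i < n" "j < n" for i j
  proof (rule continuous_map_eq)
    have "Rn_Ck (Suc 0) n (\<kappa> ` fst c) (\<lambda>y. local_rep c0 (\<lambda>q. q) c y i)"
      using from_c0_smooth[OF c] by (simp only: Rn_smooth_map_def Rn_smooth_def)
    then show "continuous_map (subtopology (Euclidean_space n) (\<kappa> ` fst c)) euclideanreal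
        (partial j (\<lambda>y. local_rep c0 (\<lambda>q. q) c y i))"
      using that by simp
    show "partial j (\<lambda>y. local_rep c0 (\<lambda>q. q) c y i) x = S c (\<iota> x) $$ (i, j)"
      if "x \<in> topspace (subtopology (Euclidean_space n) (\<kappa> ` fst c))" for x
      using that \<open>i < n\<close> \<open>j < n\<close> by (simp add: S_def jac_mat_def)
  qed
  then show ?thesis by (simp add: continuous_map_mat_top)
qed

abbreviation "GLtop \<equiv> subtopology (mat_top n) (carrier (GL_pos n)) :: real mat topology"

lemma GLtop_topspace: "topspace GLtop = {X \<in> carrier_mat n n. 0 < Determinant.det X}"
  by (auto simp: GL_pos_def)

lemma frame_top_topspace: "topspace (frame_top M Or) = pos_frames M Or"
proof -
  let ?G = "{{b \<in> pos_frames M Or. fst b \<in> fst c \<and> (fst b, frame_mat M c b) \<in> V} | c V.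
        c \<in> atlas M \<and> openin (prod_topology (mtop M) (mat_top (mdim M))) V}"
  have "b \<in> \<Union>?G" if b: "b \<in> pos_frames M Or" for b
  proof -
    let ?V = "topspace (prod_topology (mtop M) (mat_top (mdim M))) :: ('a \<times> real mat) set"
    let ?U = "{b \<in> pos_frames M Or. fst b \<in> fst c0 \<and> (fst b, frame_mat M c0 b) \<in> ?V}"
    have "?U \<in> ?G" 
      by (intro CollectI exI[of _ c0] exI[of _ ?V] conjI refl) (simp_all only: M_simps c0_atlas openin_topspace)
    moreover have "b \<in> ?U" using b pos_frames_fr(1)[OF b] by simp
    ultimately show ?thesis by (rule UnionI)
  qed
  moreover have "\<Union>?G \<subseteq> pos_frames M Or" by auto
  ultimately show ?thesis
    unfolding frame_top_def topology_generated_by_topspace by blast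
qed

text \<open>Continuity of the parametrization has to be tested in every chart, where
  \<open>S c\<close> enters; for the inverse the global chart is enough.\<close>

lemma frame_homeo:
  "homeomorphic_maps (prod_topology (Euclidean_space n) GLtop) (frame_top M Or)
     (\<lambda>(x, X). fr (\<iota> x) X) (\<lambda>b. (\<kappa> (fst b), frame_mat M c0 b))"
  unfolding homeomorphic_maps_def
proof (intro conjI ballI)
  let ?P = "prod_topology (Euclidean_space n) GLtop"
  have tp: "topspace ?P = E n \<times> {X \<in> carrier_mat n n. 0 < Determinant.det X}"
    by (simp only: topspace_prod_topology GLtop_topspace)
  have tpD: "fst z \<in> E n \<and> snd z \<in> carrier_mat n n \<and> 0 < Determinant.det (snd z)" if "z \<in> topspace ?P" for z
    using that unfolding tp by auto
  show "continuous_map ?P (frame_top M Or) (\<lambda>(x, X). fr (\<iota> x) X)"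
    unfolding frame_top_def
  proof (rule continuous_on_generated_topo)
    fix W assume "W \<in> {{b \<in> pos_frames M Or. fst b \<in> fst c \<and> (fst b, frame_mat M c b) \<in> V} | c V.
        c \<in> atlas M \<and> openin (prod_topology (mtop M) (mat_top (mdim M))) V}"
    then obtain c V where c: "c \<in> max_atlas Mtop n {c0}" and V: "openin (prod_topology Mtop (mat_top n)) V"
      and W: "W = {b \<in> pos_frames M Or. fst b \<in> fst c \<and> (fst b, frame_mat M c b) \<in> V}"
      unfolding M_simps by blast
    let ?U = "(\<kappa> ` fst c) \<times> topspace GLtop"
    let ?Q = "subtopology ?P ?U"
    have Uo: "openin ?P ?U"
      using kappa_open[OF c] by (simp only: openin_prod_Times_iff openin_topspace simp_thms)
    have f1: "continuous_map ?Q (Euclidean_space n) fst" and f2: "continuous_map ?Q (mat_top n) snd"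
      using continuous_map_fst[of "Euclidean_space n" GLtop] continuous_map_snd[of "Euclidean_space n" GLtop]
      by (simp_all add: continuous_map_from_subtopology continuous_map_in_subtopology)
    have "continuous_map ?Q Mtop (\<iota> \<circ> fst)"
      using kappa_homeo by (intro continuous_map_compose[OF f1]) (simp add: homeomorphic_maps_def)
    moreover have "continuous_map ?Q (mat_top n) (\<lambda>z. S c (\<iota> (fst z)) * snd z)"
    proof (rule continuous_map_mat_mult[OF _ f2])
      have "continuous_map ?Q (subtopology (Euclidean_space n) (\<kappa> ` fst c)) fst"
        using f1 by (auto simp: continuous_map_in_subtopology)
      from continuous_map_compose[OF this S_continuous[OF c]]
      show "continuous_map ?Q (mat_top n) (\<lambda>z. S c (\<iota> (fst z)))" by (simp add: o_def)
    qed
    ultimately have "continuous_map ?Q (prod_topology Mtop (mat_top n)) (\<lambda>z. (\<iota> (fst z), S c (\<iota> (fst z)) * snd z))"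
      by (simp add: continuous_map_pairwise o_def)
    from continuous_map_open[OF this V]
    have "openin ?P ((\<lambda>z. (\<iota> (fst z), S c (\<iota> (fst z)) * snd z)) -` V \<inter> topspace ?Q)"
      using Uo by (rule openin_trans_full)
    moreover have "(\<lambda>z. (\<iota> (fst z), S c (\<iota> (fst z)) * snd z)) -` V \<inter> topspace ?Q =
        (\<lambda>(x, X). fr (\<iota> x) X) -` W \<inter> topspace ?P"
    proof (rule Set.set_eqI)
      fix z :: "(nat \<Rightarrow> real) \<times> real mat"
      obtain x X where z: "z = (x, X)" by (cases z)
      have "z \<in> (\<lambda>z. (\<iota> (fst z), S c (\<iota> (fst z)) * snd z)) -` V \<inter> topspace ?Q \<longleftrightarrow>
          z \<in> topspace ?P \<and> x \<in> \<kappa> ` fst c \<and> (\<iota> x, S c (\<iota> x) * X) \<in> V"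
        by (auto simp: z)
      also have "\<dots> \<longleftrightarrow> z \<in> topspace ?P \<and> \<iota> x \<in> fst c \<and> (\<iota> x, frame_mat M c (fr (\<iota> x) X)) \<in> V"
      proof (rule conj_cong[OF refl])
        assume "z \<in> topspace ?P"
        then have xX: "x \<in> E n" "X \<in> carrier_mat n n" using tpD[of z] by (simp_all add: z)
        have "x \<in> \<kappa> ` fst c \<longleftrightarrow> \<iota> x \<in> fst c"
        proof
          assume "x \<in> \<kappa> ` fst c"
          then show "\<iota> x \<in> fst c" using chart_open(2)[OF c] by (auto simp: subset_iff)
        next
          assume "\<iota> x \<in> fst c"
          then show "x \<in> \<kappa> ` fst c" using xX(1) by (intro image_eqI[of _ _ "\<iota> x"]) simp_all
        qed
        then show "(x \<in> \<kappa> ` fst c \<and> (\<iota> x, S c (\<iota> x) * X) \<in> V) =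
            (\<iota> x \<in> fst c \<and> (\<iota> x, frame_mat M c (fr (\<iota> x) X)) \<in> V)"
          using frame_mat_fr[OF c _ xX(2)] by auto
      qed
      also have "\<dots> \<longleftrightarrow> z \<in> (\<lambda>(x, X). fr (\<iota> x) X) -` W \<inter> topspace ?P"
        using fr_pos_frames[OF iota_pts] tpD[of z] by (auto simp: z W)
      finally show "z \<in> (\<lambda>z. (\<iota> (fst z), S c (\<iota> (fst z)) * snd z)) -` V \<inter> topspace ?Q \<longleftrightarrow>
         z \<in> (\<lambda>(x, X). fr (\<iota> x) X) -` W \<inter> topspace ?P" .
    qed
    ultimately show "openin ?P ((\<lambda>(x, X). fr (\<iota> x) X) -` W \<inter> topspace ?P)" by simp
  next
    have "(\<lambda>(x, X). fr (\<iota> x) X) ` topspace ?P \<subseteq> topspace (frame_top M Or)"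
      unfolding frame_top_topspace using fr_pos_frames[OF iota_pts] tpD by fastforce
    then show "(\<lambda>(x, X). fr (\<iota> x) X) ` topspace ?P \<subseteq>
        \<Union>{{b \<in> pos_frames M Or. fst b \<in> fst c \<and> (fst b, frame_mat M c b) \<in> V} | c V.
        c \<in> atlas M \<and> openin (prod_topology (mtop M) (mat_top (mdim M))) V}"
      unfolding frame_top_def topology_generated_by_topspace .
  qed
  show "continuous_map (frame_top M Or) ?P (\<lambda>b. (\<kappa> (fst b), frame_mat M c0 b))"
  proof -
    have "continuous_map (frame_top M Or) (prod_topology Mtop (mat_top n)) (\<lambda>b. (fst b, frame_mat M c0 b))"
      unfolding continuous_map_alt
    proof (intro conjI allI impI)
      fix V :: "('a \<times> real mat) set" assume V: "openin (prod_topology Mtop (mat_top n)) V"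
      have "{b \<in> pos_frames M Or. fst b \<in> fst c0 \<and> (fst b, frame_mat M c0 b) \<in> V} \<in>
         {{b \<in> pos_frames M Or. fst b \<in> fst c \<and> (fst b, frame_mat M c b) \<in> V} | c V.
        c \<in> atlas M \<and> openin (prod_topology (mtop M) (mat_top (mdim M))) V}"
        using V c0_atlas by (intro CollectI exI[of _ c0] exI[of _ V]) simp
      then have "openin (frame_top M Or) {b \<in> pos_frames M Or. fst b \<in> fst c0 \<and> (fst b, frame_mat M c0 b) \<in> V}"
        unfolding frame_top_def by (rule topology_generated_by_Basis)
      moreover have "{b \<in> pos_frames M Or. fst b \<in> fst c0 \<and> (fst b, frame_mat M c0 b) \<in> V} =
          (\<lambda>b. (fst b, frame_mat M c0 b)) -` V \<inter> topspace (frame_top M Or)"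
        unfolding frame_top_topspace using pos_frames_fr(1) by auto
      ultimately show "openin (frame_top M Or) ((\<lambda>b. (fst b, frame_mat M c0 b)) -` V \<inter> topspace (frame_top M Or))"
        by simp
    next
      show "(\<lambda>b. (fst b, frame_mat M c0 b)) \<in> topspace (frame_top M Or) \<rightarrow> topspace (prod_topology Mtop (mat_top n))"
        unfolding frame_top_topspace using pos_frames_fr(1) by simp
    qed
    then have fm: "continuous_map (frame_top M Or) Mtop fst" "continuous_map (frame_top M Or) (mat_top n) (frame_mat M c0)"
      by (simp_all add: continuous_map_pairwise o_def)
    have "continuous_map (frame_top M Or) (Euclidean_space n) (\<kappa> \<circ> fst)"
      using kappa_homeo by (intro continuous_map_compose[OF fm(1)]) (simp add: homeomorphic_maps_def)
    moreover have "continuous_map (frame_top M Or) GLtop (frame_mat M c0)"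
      using fm(2) pos_frames_fr(2) by (auto simp: continuous_map_in_subtopology frame_top_topspace GL_pos_def)
    ultimately show ?thesis by (simp add: continuous_map_pairwise o_def)
  qed
  show "(\<lambda>b. (\<kappa> (fst b), frame_mat M c0 b)) (case z of (x, X) \<Rightarrow> fr (\<iota> x) X) = z" if "z \<in> topspace ?P" for z
    using tpD[OF that] by (cases z) (simp add: frame_mat_fr_c0 iota_pts)
  show "(case (\<kappa> (fst b), frame_mat M c0 b) of (x, X) \<Rightarrow> fr (\<iota> x) X) = b" if "b \<in> topspace (frame_top M Or)" for b
    using that pos_frames_fr[of b] by (simp add: frame_top_topspace)
qed

section \<open>Linear maps as oriented diffeomorphisms\<close>

definition lin :: "real mat \<Rightarrow> 'a \<Rightarrow> 'a" where
  "lin A = restrict (\<lambda>p. \<iota> (mulv A (\<kappa> p))) pts"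

lemma lin_pts: "A \<in> carrier_mat n n \<Longrightarrow> p \<in> pts \<Longrightarrow> lin A p \<in> pts"
  by (simp add: lin_def iota_pts mulv_E)

lemma kappa_lin: "A \<in> carrier_mat n n \<Longrightarrow> p \<in> pts \<Longrightarrow> \<kappa> (lin A p) = mulv A (\<kappa> p)"
  by (simp add: lin_def mulv_E)

lemma lin_iota: "A \<in> carrier_mat n n \<Longrightarrow> x \<in> E n \<Longrightarrow> lin A (\<iota> x) = \<iota> (mulv A x)"
  by (simp add: lin_def iota_pts)

lemma lin_lin:
  "A \<in> carrier_mat n n \<Longrightarrow> B \<in> carrier_mat n n \<Longrightarrow> p \<in> pts \<Longrightarrow> lin A (lin B p) = lin (A * B) p"
  by (simp add: lin_def iota_pts mulv_E mulv_mult)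

lemma lin_one: "p \<in> pts \<Longrightarrow> lin (1\<^sub>m n) p = p"
  by (simp add: lin_def mulv_one kappa_E)

lemma c0_smooth_lin:
  assumes A: "A \<in> carrier_mat n n"
  shows "c0_smooth (lin A)"
  unfolding c0_smooth_def Rn_smooth_map_def
proof (intro conjI allI)
  show "lin A \<in> pts \<rightarrow> pts" using lin_pts[OF A] by simp
  fix i
  have "Rn_smooth n (E n) (\<lambda>y. mulv A y i)"
  proof (cases "i < n")
    case True
    have "Rn_smooth n (E n) (\<lambda>y. \<Sum>j<n. A $$ (i, j) * y j)"
      by (intro Rn_smooth_sum Rn_smooth_mult Rn_smooth_const Rn_smooth_coord openin_topspace)
    then show ?thesis using True A by (simp add: mulv_def)
  qed (use A Rn_smooth_const in \<open>simp add: mulv_def\<close>)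
  then show "Rn_smooth n (E n) (\<lambda>y. \<kappa> (lin A (\<iota> y)) i)"
    by (rule Rn_smooth_cong[OF openin_topspace, rotated]) (simp add: kappa_lin[OF A] iota_pts)
qed

lemma F_lin:
  assumes A: "A \<in> carrier_mat n n" and p: "p \<in> pts"
  shows "F (lin A) p = A"
proof -
  have "F (lin A) p = jac_mat n (mulv A) (\<kappa> p)"
    unfolding F_def
    by (rule jac_mat_cong[OF openin_topspace kappa_E[OF p]]) (simp add: kappa_lin[OF A] iota_pts)
  also have "\<dots> = A"
  proof (rule eq_matI)
    fix i j assume "i < dim_row A" "j < dim_col A"
    then have ij: "i < n" "j < n" using A by auto
    have "((\<lambda>t. \<Sum>k<n. A $$ (i, k) * ((\<kappa> p)(j := t)) k) has_real_derivative
        (\<Sum>k<n. A $$ (i, k) * (if k = j then 1 else 0))) (at (\<kappa> p j))"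
      by (intro DERIV_sum DERIV_cmult) auto
    then have "partial j (\<lambda>y. mulv A y i) (\<kappa> p) = (\<Sum>k<n. A $$ (i, k) * (if k = j then 1 else 0))"
      using A ij by (simp add: partial_def mulv_def DERIV_imp_deriv)
    also have "\<dots> = A $$ (i, j)"
      using ij by (simp add: if_distrib[of "\<lambda>t. _ * t"] cong: if_cong)
    finally show "jac_mat n (mulv A) (\<kappa> p) $$ (i, j) = A $$ (i, j)"
      using ij by (simp add: jac_mat_def)
  qed (use A in \<open>simp_all add: jac_mat_def\<close>)
  finally show ?thesis .
qed

lemma c0_smooth_smooth_maps: "c0_smooth f \<Longrightarrow> f \<in> extensional pts \<Longrightarrow> f \<in> smooth_maps M M"
  unfolding smooth_maps_def by (simp add: c0_smooth_continuous local_rep_smooth)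

lemma lin_diffeo:
  assumes A: "A \<in> carrier_mat n n" "0 < Determinant.det A" and B: "B \<in> carrier_mat n n" "A * B = 1\<^sub>m n" "B * A = 1\<^sub>m n"
  shows "lin A \<in> oriented_diffeos M Or M Or"
proof -
  have ext: "lin C \<in> extensional pts" for C by (simp add: lin_def)
  have AB: "lin A (lin B p) = p" "lin B (lin A p) = p" if "p \<in> pts" for p
    using that A B by (simp_all add: lin_lin lin_one)
  have bij: "bij_betw (lin A) pts pts"
    by (rule bij_betw_byWitness[of _ "lin B"]) (use AB lin_pts A B in auto)
  have "restrict (inv_into pts (lin A)) pts = lin B"
  proof
    fix p show "restrict (inv_into pts (lin A)) pts p = lin B p"
    proof (cases "p \<in> pts")
      case True
      have "inv_into pts (lin A) (lin A (lin B p)) = lin B p"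
        by (rule inv_into_f_f[OF bij_betw_imp_inj_on[OF bij] lin_pts[OF B(1) True]])
      then show ?thesis using True AB(1) by simp
    qed (simp add: lin_def)
  qed
  moreover have "dframe M M (lin A) b \<in> pos_frames M Or" if b: "b \<in> pos_frames M Or" for b
  proof -
    let ?X = "frame_mat M c0 b"
    have "dframe M M (lin A) (fr (fst b) ?X) = fr (lin A (fst b)) (A * ?X)"
      using pos_frames_fr(1)[OF b] A by (simp add: dframe_fr c0_smooth_lin F_lin)
    moreover have "fr (lin A (fst b)) (A * ?X) \<in> pos_frames M Or"
      using pos_frames_fr(1,2)[OF b] A lin_pts[OF A(1)]
      by (intro fr_pos_frames) (simp_all add: mult_carrier_mat[of _ n n] det_mult[of _ n])
    ultimately show ?thesis by (simp add: pos_frames_fr(3)[OF b])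
  qed
  ultimately show ?thesis
    using bij c0_smooth_smooth_maps[OF c0_smooth_lin ext] A B by (simp add: oriented_diffeos_def)
qed

section \<open>The flat metric and its orthonormal frames\<close>

definition g :: "'a tvec \<Rightarrow> 'a tvec \<Rightarrow> real" where
  "g e e' = (\<Sum>i<n. snd e c0 i * snd e' c0 i)"

lemma g_pair: "g (p, v) (q, w) = (\<Sum>i<n. v c0 i * w c0 i)"
  by (simp add: g_def)

lemma mulv_orthogonal:
  assumes A: "A \<in> carrier_mat n n" "transpose_mat A * A = 1\<^sub>m n"
  shows "(\<Sum>i<n. mulv A v i * mulv A w i) = (\<Sum>i<n. v i * w i)"
proof -
  have "(\<Sum>i<n. mulv A v i * mulv A w i) = (\<Sum>i<n. \<Sum>j<n. \<Sum>k<n. v j * w k * (A $$ (i, j) * A $$ (i, k)))"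
    using A by (simp add: mulv_def sum_product mult_ac)
  also have "\<dots> = (\<Sum>j<n. \<Sum>k<n. v j * w k * (\<Sum>i<n. A $$ (i, j) * A $$ (i, k)))"
    by (subst sum.swap, rule sum.cong, simp, subst sum.swap) (simp add: sum_distrib_left)
  also have "\<dots> = (\<Sum>j<n. \<Sum>k<n. v j * w k * (1\<^sub>m n $$ (j, k)))"
  proof (intro sum.cong refl)
    fix j k assume "j \<in> {..<n}" "k \<in> {..<n}"
    then have "(transpose_mat A * A) $$ (j, k) = (\<Sum>i<n. A $$ (i, j) * A $$ (i, k))"
      using A(1) by (simp add: scalar_prod_def atLeast0LessThan)
    then show "v j * w k * (\<Sum>i<n. A $$ (i, j) * A $$ (i, k)) = v j * w k * (1\<^sub>m n $$ (j, k))"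
      by (simp only: A(2))
  qed
  also have "\<dots> = (\<Sum>j<n. v j * w j)"
    by (intro sum.cong refl) (simp add: if_distrib[of "\<lambda>t. _ * t"] cong: if_cong)
  finally show ?thesis .
qed

lemma g_lin:
  assumes A: "A \<in> carrier_mat n n" "transpose_mat A * A = 1\<^sub>m n" and p: "p \<in> pts"
    and v: "v \<in> tangent M p" and w: "w \<in> tangent M p"
  shows "g (dmap M M (lin A) v) (dmap M M (lin A) w) = g v w"
proof -
  have *: "u = tv p (snd u c0) \<and> snd u c0 \<in> E n" if "u \<in> tangent M p" for u
  proof -
    have u: "(fst u, snd u) \<in> tangent M p" using that by simp
    then have "u = tv p (snd u c0)"
      using tangent_tv(1,3)[OF p u] by (intro prod_eqI) simp_all
    then show ?thesis using tangent_tv(2)[OF p u] by blast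
  qed
  have d: "snd (dmap M M (lin A) u) c0 = mulv A (snd u c0)" if "u \<in> tangent M p" for u
  proof -
    have "dmap M M (lin A) u = tv (lin A p) (mulv A (snd u c0))"
      using dmap_tv[OF c0_smooth_lin[OF A(1)] p, of "snd u c0"] *[OF that] F_lin[OF A(1) p] by simp
    then show ?thesis using lin_pts[OF A(1) p] mulv_E[OF A(1)] by simp
  qed
  show ?thesis using mulv_orthogonal[OF A] by (simp add: g_def d v w)
qed

lemma riemannian_g: "riemannian_metric M g"
  unfolding riemannian_metric_def M_simps Mtop_topspace
proof (intro conjI ballI allI impI)
  fix p v w assume p: "p \<in> pts" and v: "(p, v) \<in> tangent M p" and w: "(p, w) \<in> tangent M p"
  show "g (p, v) (p, w) = g (p, w) (p, v)" by (simp add: g_pair mult.commute)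
  show "0 < g (p, v) (p, v)" if "v \<noteq> (\<lambda>_ _. 0)"
  proof -
    have "v c0 \<noteq> (\<lambda>_. 0)"
    proof
      assume "v c0 = (\<lambda>_. 0)"
      then have "v = snd (tv p (\<lambda>_. 0))" using tangent_tv(3)[OF p v] by simp
      then have "v = (\<lambda>_ _. 0)" by (auto simp: fun_eq_iff snd_tv[OF p] mulv_zero)
      then show False using that by simp
    qed
    then obtain i where "v c0 i \<noteq> 0" by auto
    then have "i < n" "0 < v c0 i * v c0 i"
      using tangent_tv(2)[OF p v] by (auto simp: E_iff not_less[symmetric] zero_less_mult_iff)
    then show ?thesis unfolding g_pair by (intro sum_pos2[of _ i]) auto
  qed
  fix u a
  show "g (p, \<lambda>c i. a * v c i + u c i) (p, w) = a * g (p, v) (p, w) + g (p, u) (p, w)"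
    by (simp add: g_pair distrib_right sum.distrib sum_distrib_left mult.assoc)
next
  fix c i j assume c: "c \<in> max_atlas Mtop n {c0}" and ij: "i < n" "j < n"
  let ?t = "local_rep c (\<lambda>q. q) c0"
  have sm: "Rn_smooth n (snd c ` fst c) (\<lambda>x. ?t x k)" for k
    using to_c0_smooth[OF c] by (simp only: Rn_smooth_map_def)
  \<comment> \<open>In the chart \<open>c\<close> the metric is the Gram matrix of the columns of
    the Jacobian of the change to \<open>c0\<close>.\<close>
  have "Rn_smooth n (snd c ` fst c) (\<lambda>x. \<Sum>k<n. partial i (\<lambda>y. ?t y k) x * partial j (\<lambda>y. ?t y k) x)"
    using Rn_smooth_partial[OF sm] ij
    by (intro Rn_smooth_sum Rn_smooth_mult chart_image_open[OF c])
  then show "Rn_smooth n (snd c ` fst c) (\<lambda>x. g (tvec_of M c (chart_inv c x) (\<lambda>k. if k = i then 1 else 0))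
      (tvec_of M c (chart_inv c x) (\<lambda>k. if k = j then 1 else 0)))"
  proof (rule Rn_smooth_cong[OF chart_image_open[OF c], rotated])
    fix x assume x: "x \<in> snd c ` fst c"
    then have q: "chart_inv c x \<in> fst c" "snd c (chart_inv c x) = x" using chart_inv_right[OF x] by auto
    then have "chart_inv c x \<in> pts" using chart_open(2)[OF c] by auto
    then have "snd (tvec_of M c (chart_inv c x) (\<lambda>k. if k = l then 1 else 0)) c0 k = partial l (\<lambda>y. ?t y k) x"
      if "l < n" for l k
      using that q by (simp add: tvec_of_def jac_def if_distrib[of "\<lambda>t. _ * t"] cong: if_cong)
    then show "(\<Sum>k<n. partial i (\<lambda>y. ?t y k) x * partial j (\<lambda>y. ?t y k) x) =
        g (tvec_of M c (chart_inv c x) (\<lambda>k. if k = i then 1 else 0))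
          (tvec_of M c (chart_inv c x) (\<lambda>k. if k = j then 1 else 0))"
      using ij by (simp add: g_def)
  qed
qed

text \<open>Orthonormality says that the frame matrix is orthogonal; the sign of its determinant is
  settled by the positivity of the frame.\<close>

lemma on_frames_iff:
  "b \<in> on_frames M Or g \<longleftrightarrow> b \<in> pos_frames M Or \<and> frame_mat M c0 b \<in> SO_mats n"
proof -
  have "(\<forall>i<n. \<forall>j<n. g (fst b, snd b i) (fst b, snd b j) = (if i = j then 1 else 0)) \<longleftrightarrow> frame_mat M c0 b \<in> SO_mats n"
    if b: "b \<in> pos_frames M Or"
  proof -
    let ?X = "frame_mat M c0 b"
    have X: "?X \<in> carrier_mat n n" by simp
    have d: "0 < Determinant.det ?X" by (rule pos_frames_fr(2)[OF b])
    have e: "(transpose_mat ?X * ?X) $$ (i, j) = g (fst b, snd b i) (fst b, snd b j)" if "i < n" "j < n" for i j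
      using that by (simp add: scalar_prod_def atLeast0LessThan g_pair frame_mat_def)
    have "(\<forall>i<n. \<forall>j<n. g (fst b, snd b i) (fst b, snd b j) = (if i = j then 1 else 0)) \<longleftrightarrow>
        transpose_mat ?X * ?X = 1\<^sub>m n"
    proof
      assume *: "\<forall>i<n. \<forall>j<n. g (fst b, snd b i) (fst b, snd b j) = (if i = j then 1 else 0)"
      show "transpose_mat ?X * ?X = 1\<^sub>m n"
      proof (rule eq_matI)
        fix i j assume "i < dim_row (1\<^sub>m n :: real mat)" "j < dim_col (1\<^sub>m n :: real mat)"
        then have ij: "i < n" "j < n" by simp_all
        show "(transpose_mat ?X * ?X) $$ (i, j) = 1\<^sub>m n $$ (i, j)"
          unfolding e[OF ij] using * ij by simp
      qed (simp_all add: frame_mat_def)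
    next
      assume *: "transpose_mat ?X * ?X = 1\<^sub>m n"
      show "\<forall>i<n. \<forall>j<n. g (fst b, snd b i) (fst b, snd b j) = (if i = j then 1 else 0)"
      proof (intro allI impI)
        fix i j assume ij: "i < n" "j < n"
        show "g (fst b, snd b i) (fst b, snd b j) = (if i = j then 1 else 0)"
          unfolding e[OF ij, symmetric] * using ij by simp
      qed
    qed
    moreover have "Determinant.det ?X = 1" if "transpose_mat ?X * ?X = 1\<^sub>m n"
    proof -
      have "Determinant.det ?X * Determinant.det ?X = 1"
        using that det_mult[of "transpose_mat ?X" n ?X] det_transpose[OF X] by simp
      then show ?thesis using d by (auto simp: square_eq_1_iff)
    qed
    ultimately show ?thesis by (auto simp: SO_mats_def)
  qed
  then show ?thesis by (auto simp: on_frames_def)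
qed

end

section \<open>The spin structure of Euclidean space\<close>

text \<open>As \<iota> does for the base, \<open>j\<close> copies the total space of the product
  bundle into the type prescribed for total spaces.\<close>

locale spin_euclid = spin_context D + euclidean_copy "sd_dim D" \<iota>
  for D :: "'h spin_data" and \<iota> :: "(nat \<Rightarrow> real) \<Rightarrow> 'a" +
  fixes j :: "(nat \<Rightarrow> real) \<times> 'h \<Rightarrow> 'p"
  assumes inj_j: "inj_on j (E (sd_dim D) \<times> spin_carrier D)"
begin

interpretation group "sd_grp D" by (rule group_G)

section \<open>The metric spin structure\<close>

definition Pset :: "'p set" where "Pset = j ` (E m \<times> Spin)"

definition jinv :: "'p \<Rightarrow> (nat \<Rightarrow> real) \<times> 'h" where "jinv = inv_into (E m \<times> Spin) j"

definition Ptop :: "'p topology" where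
  "Ptop = pullback_topology Pset jinv (prod_topology (Euclidean_space m) (spin_top D))"

text \<open>The product spin structure of flat space; its unit section lies over the standard
  frame.\<close>

definition X :: "('a, 'p, 'h) riem_spin_mfd" where
  "X = \<lparr>sm_mfd = M, sm_or = Or, sm_top = Ptop,
     sm_act = (\<lambda>b h. case jinv b of (x, s) \<Rightarrow> j (x, s \<otimes>\<^bsub>G\<^esub> h)),
     sm_map = (\<lambda>b. case jinv b of (x, s) \<Rightarrow> fr (\<iota> x) (cov s)), sm_met = g\<rparr>"

lemma X_simps [simp]: "sm_mfd X = M" "sm_or X = Or" "sm_top X = Ptop" "sm_met X = g"
  by (simp_all add: X_def)

lemma jinv_j [simp]: "x \<in> E m \<Longrightarrow> s \<in> Spin \<Longrightarrow> jinv (j (x, s)) = (x, s)"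
  by (simp add: jinv_def inv_into_f_f inj_j)

lemma j_Pset [simp]: "x \<in> E m \<Longrightarrow> s \<in> Spin \<Longrightarrow> j (x, s) \<in> Pset"
  by (simp add: Pset_def)

lemma PsetE:
  assumes "b \<in> Pset" obtains x s where "x \<in> E m" "s \<in> Spin" "b = j (x, s)"
  using assms by (auto simp: Pset_def)

lemma act_X [simp]: "x \<in> E m \<Longrightarrow> s \<in> Spin \<Longrightarrow> sm_act X (j (x, s)) h = j (x, s \<otimes>\<^bsub>G\<^esub> h)"
  and map_X [simp]: "x \<in> E m \<Longrightarrow> s \<in> Spin \<Longrightarrow> sm_map X (j (x, s)) = fr (\<iota> x) (cov s)"
  by (simp_all add: X_def)

lemma sd_top_topspace: "topspace (sd_top D) = carrier G"
  and sd_top_mult: "continuous_map (prod_topology (sd_top D) (sd_top D)) (sd_top D) (\<lambda>(x, y). x \<otimes>\<^bsub>G\<^esub> y)"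
  using spin_setup unfolding spin_setup_def topological_group_def by blast+

lemma Spin_sub: "Spin \<subseteq> carrier G"
  using Spin_subset by blast

lemma spin_top_topspace [simp]: "topspace (spin_top D) = Spin"
  using Spin_sub by (auto simp: spin_top_def sd_top_topspace)

lemma Ptop_topspace [simp]: "topspace Ptop = Pset"
  by (auto simp: Ptop_def topspace_pullback_topology elim!: PsetE)

lemma Ptop_homeo: "homeomorphic_maps (prod_topology (Euclidean_space m) (spin_top D)) Ptop j jinv"
  unfolding homeomorphic_maps_def
proof (intro conjI ballI)
  let ?Q = "prod_topology (Euclidean_space m) (spin_top D)"
  have Q: "z = (fst z, snd z) \<and> fst z \<in> E m \<and> snd z \<in> Spin" if "z \<in> topspace ?Q" for z
    using that by (auto simp: mem_Times_iff)
  show "continuous_map ?Q Ptop j"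
    unfolding Ptop_def
  proof (rule continuous_map_pullback')
    show "continuous_map ?Q ?Q (jinv \<circ> j)"
      by (rule continuous_map_eq[OF continuous_map_id]) (use Q jinv_j in \<open>metis comp_apply id_apply\<close>)
    show "topspace ?Q \<subseteq> j -` Pset" using Q j_Pset by (metis subsetI vimageI)
  qed
  have "continuous_map Ptop ?Q (id \<circ> jinv)"
    unfolding Ptop_def by (rule continuous_map_pullback) simp
  then show "continuous_map Ptop ?Q jinv" by simp
  show "jinv (j z) = z" if "z \<in> topspace ?Q" for z using Q[OF that] jinv_j by metis
  show "j (jinv b) = b" if "b \<in> topspace Ptop" for b using that by (auto elim: PsetE)
qed

lemma cov_dc: "double_covering (sd_top D) GLtop cov"
  using spin_setup unfolding spin_setup_def by blast

lemma frame_homeo_SO: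
  "homeomorphic_maps (prod_topology (Euclidean_space m) (subtopology GLtop (SO_mats m)))
     (subtopology (frame_top M Or) (on_frames M Or g))
     (\<lambda>(x, X). fr (\<iota> x) X) (\<lambda>b. (\<kappa> (fst b), frame_mat M c0 b))"
proof -
  have "homeomorphic_maps (subtopology (prod_topology (Euclidean_space m) GLtop) (E m \<times> SO_mats m))
     (subtopology (frame_top M Or) (on_frames M Or g))
     (\<lambda>(x, X). fr (\<iota> x) X) (\<lambda>b. (\<kappa> (fst b), frame_mat M c0 b))"
  proof (rule homeomorphic_maps_subtopologies_alt[OF frame_homeo])
    show "(\<lambda>(x, X). fr (\<iota> x) X) ` (topspace (prod_topology (Euclidean_space m) GLtop) \<inter> E m \<times> SO_mats m) \<subseteq> on_frames M Or g"
    proof (rule image_subsetI)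
      fix z assume z: "z \<in> topspace (prod_topology (Euclidean_space m) GLtop) \<inter> E m \<times> SO_mats m"
      have "fst z \<in> E m" "snd z \<in> carrier_mat m m" "0 < Determinant.det (snd z)" "snd z \<in> SO_mats m"
        using z by (auto simp: SO_mats_def)
      then show "(case z of (x, A) \<Rightarrow> fr (\<iota> x) A) \<in> on_frames M Or g"
        by (simp add: on_frames_iff fr_pos_frames iota_pts frame_mat_fr_c0 split_def)
    qed
    show "(\<lambda>b. (\<kappa> (fst b), frame_mat M c0 b)) ` (topspace (frame_top M Or) \<inter> on_frames M Or g) \<subseteq> E m \<times> SO_mats m"
      using pos_frames_fr(1) kappa_E by (auto simp: on_frames_iff)
  qed
  then show ?thesis by (simp add: prod_topology_subtopology)
qed

lemma act_frames:
  assumes "x \<in> E m" "h \<in> carrier G" "k \<in> carrier G"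
  shows "fr (\<iota> x) (cov (h \<otimes>\<^bsub>G\<^esub> k)) = frame_act m (fr (\<iota> x) (cov h)) (cov k)"
  using assms by (simp add: frame_act_fr iota_pts cov_carrier cov_mult)

lemma X_object: "X \<in> Ob (RiemSpinMf D)"
proof -
  have pb: "principal_bundle (spin_grp D) (spin_top D) Mtop Ptop (sm_act X) (\<lambda>b. fst (sm_map X b))"
  proof (rule trivial_principal_bundle[OF _ _ _ Ptop_homeo])
    show "topspace (spin_top D) = carrier (spin_grp D)" by (simp add: spin_grp_def)
    have "continuous_map (prod_topology (spin_top D) (spin_top D)) (sd_top D) (\<lambda>(x, y). x \<otimes>\<^bsub>G\<^esub> y)"
      using continuous_map_from_subtopology[OF sd_top_mult, of "Spin \<times> Spin"]
      by (simp add: spin_top_def subtopology_Times)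
    moreover have "(\<lambda>(x, y). x \<otimes>\<^bsub>G\<^esub> y) \<in> topspace (prod_topology (spin_top D) (spin_top D)) \<rightarrow> Spin"
      by (auto intro: Spin_mult)
    ultimately show "continuous_map (prod_topology (spin_top D) (spin_top D)) (spin_top D) (\<lambda>(x, y). x \<otimes>\<^bsub>spin_grp D\<^esub> y)"
      unfolding spin_top_def[of D] continuous_map_in_subtopology by (simp add: spin_grp_def spin_top_def)
    show "monoid (spin_grp D)"
      by (rule monoidI) (auto simp: spin_grp_def Spin_mult Spin_one Spin_subset m_assoc)
    show "homeomorphic_maps (Euclidean_space m) Mtop \<iota> \<kappa>"
      using kappa_homeo by (rule homeomorphic_maps_sym[THEN iffD1])
  qed (auto simp: spin_grp_def)
  have "double_covering (spin_top D) (subtopology GLtop (SO_mats m)) cov"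
  proof -
    have "subtopology (sd_top D) {h \<in> topspace (sd_top D). cov h \<in> SO_mats m} = spin_top D"
      by (simp add: spin_top_def spin_carrier_def sd_top_topspace)
    then show ?thesis using double_covering_restrict[OF cov_dc, of "SO_mats m"] by simp
  qed
  \<comment> \<open>The covering of the frame bundle is that of the structure group, multiplied by
    the base and read in the two trivializations.\<close>
  from double_covering_homeo[OF double_covering_prod[OF this] Ptop_homeo[THEN homeomorphic_maps_sym[THEN iffD1]] frame_homeo_SO]
  have dc: "double_covering Ptop (subtopology (frame_top M Or) (on_frames M Or g)) (sm_map X)"
    by (rule double_covering_cong) (auto elim!: PsetE)
  have "sm_map X (sm_act X b h) = frame_act m (sm_map X b) (cov h)" if "b \<in> Pset" "h \<in> Spin" for b h
    using that by (auto elim!: PsetE simp: Spin_mult act_frames Spin_subset)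
  then show ?thesis
    using pb dc smooth_manifold_M orientation_Or riemannian_g
    by (simp add: RiemSpinMf_def metric_spin_mfd_def)
qed

text \<open>The class of \<open>((x, 1), k)\<close> in the extension of \<open>\<real>\<^sup>m \<times> Spin\<^sub>m\<close>, which is thereby identified
  with \<open>\<real>\<^sup>m \<times> GL~\<^sup>+\<^sub>m\<close>.\<close>

definition EC :: "(nat \<Rightarrow> real) \<Rightarrow> 'h \<Rightarrow> ('p \<times> 'h) set" where
  "EC x k = {(j (x, t), inv\<^bsub>G\<^esub> t \<otimes>\<^bsub>G\<^esub> k) | t. t \<in> Spin}"

text \<open>Replacing t by s t among the representatives moves s across the pair: [(x, s), h] =
  [(x, 1), s h].\<close>

lemma ext_cls_EC:
  assumes x: "x \<in> E m" and s: "s \<in> Spin" and h: "h \<in> carrier G"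
  shows "ext_cls D X (j (x, s), h) = EC x (s \<otimes>\<^bsub>G\<^esub> h)"
proof -
  have sc: "s \<in> carrier G" using Spin_subset[OF s] .
  have "ext_cls D X (j (x, s), h) = {(j (x, s \<otimes>\<^bsub>G\<^esub> t), inv\<^bsub>G\<^esub> t \<otimes>\<^bsub>G\<^esub> h) | t. t \<in> Spin}"
    using x s by (simp add: ext_cls_def assoc_cls_def)
  also have "\<dots> = EC x (s \<otimes>\<^bsub>G\<^esub> h)"
    unfolding EC_def
  proof (rule Set.set_eqI, rule iffI)
    fix z assume "z \<in> {(j (x, s \<otimes>\<^bsub>G\<^esub> t), inv\<^bsub>G\<^esub> t \<otimes>\<^bsub>G\<^esub> h) | t. t \<in> Spin}"
    then obtain t where t: "t \<in> Spin" "z = (j (x, s \<otimes>\<^bsub>G\<^esub> t), inv\<^bsub>G\<^esub> t \<otimes>\<^bsub>G\<^esub> h)" by blast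
    have tc: "t \<in> carrier G" using Spin_subset[OF t(1)] .
    have "inv\<^bsub>G\<^esub> (s \<otimes>\<^bsub>G\<^esub> t) \<otimes>\<^bsub>G\<^esub> (s \<otimes>\<^bsub>G\<^esub> h) = inv\<^bsub>G\<^esub> t \<otimes>\<^bsub>G\<^esub> h"
      using sc tc h by (simp add: inv_mult_group m_assoc[symmetric]) (simp add: m_assoc)
    then show "z \<in> {(j (x, t), inv\<^bsub>G\<^esub> t \<otimes>\<^bsub>G\<^esub> (s \<otimes>\<^bsub>G\<^esub> h)) | t. t \<in> Spin}"
      using t Spin_mult[OF s t(1)] by (intro CollectI exI[of _ "s \<otimes>\<^bsub>G\<^esub> t"]) simp
  next
    fix z assume "z \<in> {(j (x, t), inv\<^bsub>G\<^esub> t \<otimes>\<^bsub>G\<^esub> (s \<otimes>\<^bsub>G\<^esub> h)) | t. t \<in> Spin}"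
    then obtain t where t: "t \<in> Spin" "z = (j (x, t), inv\<^bsub>G\<^esub> t \<otimes>\<^bsub>G\<^esub> (s \<otimes>\<^bsub>G\<^esub> h))" by blast
    have tc: "t \<in> carrier G" using Spin_subset[OF t(1)] .
    have 1: "s \<otimes>\<^bsub>G\<^esub> (inv\<^bsub>G\<^esub> s \<otimes>\<^bsub>G\<^esub> t) = t" using sc tc by (simp add: m_assoc[symmetric])
    have 2: "inv\<^bsub>G\<^esub> (inv\<^bsub>G\<^esub> s \<otimes>\<^bsub>G\<^esub> t) \<otimes>\<^bsub>G\<^esub> h = inv\<^bsub>G\<^esub> t \<otimes>\<^bsub>G\<^esub> (s \<otimes>\<^bsub>G\<^esub> h)"
      using sc tc h by (simp add: inv_mult_group m_assoc)
    show "z \<in> {(j (x, s \<otimes>\<^bsub>G\<^esub> t), inv\<^bsub>G\<^esub> t \<otimes>\<^bsub>G\<^esub> h) | t. t \<in> Spin}"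
      using t Spin_mult[OF Spin_inv[OF s] t(1)] 1 2
      by (intro CollectI exI[of _ "inv\<^bsub>G\<^esub> s \<otimes>\<^bsub>G\<^esub> t"]) simp
  qed
  finally show ?thesis .
qed

text \<open>\<open>MetrTop\<close> acts on classes through a representative picked by
  \<open>SOME\<close>; this records all that may be assumed about it.\<close>

lemma some_EC:
  assumes "x \<in> E m" "k \<in> carrier G"
  obtains t where "t \<in> Spin" "(SOME y. y \<in> EC x k) = (j (x, t), inv\<^bsub>G\<^esub> t \<otimes>\<^bsub>G\<^esub> k)"
proof -
  have "(j (x, \<one>\<^bsub>G\<^esub>), inv\<^bsub>G\<^esub> \<one>\<^bsub>G\<^esub> \<otimes>\<^bsub>G\<^esub> k) \<in> EC x k"
    unfolding EC_def using Spin_one by blast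
  then have "(SOME y. y \<in> EC x k) \<in> EC x k" by (rule someI)
  then show thesis using that unfolding EC_def by blast
qed

section \<open>The topological spin structure as a product with the double covering group\<close>

definition Ytop :: "('p \<times> 'h) set topology" where "Ytop = ext_top D X"

definition rmap :: "'p \<times> 'h \<Rightarrow> (nat \<Rightarrow> real) \<times> 'h" where
  "rmap z = (fst (jinv (fst z)), snd (jinv (fst z)) \<otimes>\<^bsub>G\<^esub> snd z)"

definition ECinv :: "('p \<times> 'h) set \<Rightarrow> (nat \<Rightarrow> real) \<times> 'h" where
  "ECinv C = rmap (SOME y. y \<in> C)"

lemma ECinv_EC [simp]:
  assumes "x \<in> E m" "k \<in> carrier G"
  shows "ECinv (EC x k) = (x, k)"
proof -
  obtain t where t: "t \<in> Spin" "(SOME y. y \<in> EC x k) = (j (x, t), inv\<^bsub>G\<^esub> t \<otimes>\<^bsub>G\<^esub> k)"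
    using some_EC[OF assms] .
  have "t \<otimes>\<^bsub>G\<^esub> (inv\<^bsub>G\<^esub> t \<otimes>\<^bsub>G\<^esub> k) = k"
    using Spin_subset[OF t(1)] assms by (simp add: m_assoc[symmetric])
  then show ?thesis using t assms by (simp add: ECinv_def rmap_def)
qed

text \<open>The map ((x, s), h) to (x, s h) separates exactly the classes and has the continuous
  section (x, k) to ((x, 1), k), so the quotient topology is that of the product.\<close>

lemma Y_homeo:
  "homeomorphic_maps (prod_topology (Euclidean_space m) (sd_top D)) Ytop (\<lambda>(x, k). EC x k) ECinv"
proof -
  let ?X = "prod_topology Ptop (sd_top D)" and ?Z = "prod_topology (Euclidean_space m) (sd_top D)"
  have jc: "continuous_map Ptop (prod_topology (Euclidean_space m) (spin_top D)) jinv"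
    and jj: "continuous_map (prod_topology (Euclidean_space m) (spin_top D)) Ptop j"
    using Ptop_homeo by (simp_all add: homeomorphic_maps_def)
  have "homeomorphic_maps ?Z (ext_top D X) (\<lambda>z. ext_cls D X (j (fst z, \<one>\<^bsub>G\<^esub>), snd z)) ECinv"
    unfolding ext_top_def X_simps
  proof (rule quotient_top_homeo)
    have 1: "continuous_map ?X (Euclidean_space m) (\<lambda>z. fst (jinv (fst z)))"
      and 2: "continuous_map ?X (spin_top D) (\<lambda>z. snd (jinv (fst z)))"
      using continuous_map_compose[OF continuous_map_fst[of Ptop "sd_top D"] jc]
      by (simp_all add: continuous_map_pairwise o_def)
    have "continuous_map ?X (sd_top D) (\<lambda>z. snd (jinv (fst z)))"
      using 2 by (simp add: spin_top_def continuous_map_in_subtopology)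
    then have "continuous_map ?X (prod_topology (sd_top D) (sd_top D)) (\<lambda>z. (snd (jinv (fst z)), snd z))"
      using continuous_map_snd[of Ptop "sd_top D"] by (simp add: continuous_map_pairwise o_def)
    from continuous_map_compose[OF this sd_top_mult]
    have "continuous_map ?X (sd_top D) (\<lambda>z. snd (jinv (fst z)) \<otimes>\<^bsub>G\<^esub> snd z)" by (simp add: o_def)
    then show "continuous_map ?X ?Z rmap"
      using 1 by (simp add: continuous_map_pairwise o_def rmap_def)
    have "continuous_map ?Z (prod_topology (Euclidean_space m) (spin_top D)) (\<lambda>z. (fst z, \<one>\<^bsub>G\<^esub>))"
      using continuous_map_fst[of "Euclidean_space m" "sd_top D"] Spin_one
      by (simp add: continuous_map_pairwise o_def)
    from continuous_map_compose[OF this jj]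
    have "continuous_map ?Z Ptop (\<lambda>z. j (fst z, \<one>\<^bsub>G\<^esub>))" by (simp add: o_def)
    then show "continuous_map ?Z ?X (\<lambda>z. (j (fst z, \<one>\<^bsub>G\<^esub>), snd z))"
      using continuous_map_snd[of "Euclidean_space m" "sd_top D"] by (simp add: continuous_map_pairwise o_def)
    show "rmap (j (fst z, \<one>\<^bsub>G\<^esub>), snd z) = z" if "z \<in> topspace ?Z" for z
      using that by (simp add: rmap_def Spin_one sd_top_topspace mem_Times_iff)
    fix z assume "z \<in> topspace ?X"
    then have "fst z \<in> Pset" "snd z \<in> carrier G" by (simp_all add: sd_top_topspace mem_Times_iff)
    then obtain x s h where z: "z = (j (x, s), h)" "x \<in> E m" "s \<in> Spin" "h \<in> carrier G"
      by (metis PsetE prod.collapse)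
    then have sh: "s \<otimes>\<^bsub>G\<^esub> h \<in> carrier G" using Spin_subset by simp
    show "ext_cls D X (j (fst (rmap z), \<one>\<^bsub>G\<^esub>), snd (rmap z)) = ext_cls D X z"
      using z sh by (simp add: rmap_def ext_cls_EC Spin_one)
    show "ECinv (ext_cls D X z) = rmap z"
      using z sh by (simp add: rmap_def ext_cls_EC)
  qed
  moreover have "ext_cls D X (j (fst z, \<one>\<^bsub>G\<^esub>), snd z) = (\<lambda>(x, k). EC x k) z" if "z \<in> topspace ?Z" for z
    using that by (simp add: ext_cls_EC Spin_one sd_top_topspace mem_Times_iff split_def)
  ultimately show ?thesis
    unfolding Ytop_def by (rule homeomorphic_maps_eq) simp_all
qed

lemma Ytop_topspace: "topspace Ytop = {EC x k | x k. x \<in> E m \<and> k \<in> carrier G}"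
proof -
  have "(\<lambda>(x, k). EC x k) ` (E m \<times> carrier G) = topspace Ytop"
    using homeomorphic_imp_surjective_map[OF homeomorphic_maps_imp_map[OF Y_homeo]]
    by (simp add: sd_top_topspace)
  from this[symmetric] show ?thesis by auto
qed

lemma EC_Ytop [simp]: "x \<in> E m \<Longrightarrow> k \<in> carrier G \<Longrightarrow> EC x k \<in> topspace Ytop"
  by (auto simp: Ytop_topspace)

definition Y :: "('a, ('p \<times> 'h) set, 'h) spin_mfd" where "Y = omap (MetrTop D) X"

lemma Y_simps [simp]: "sm_mfd Y = M" "sm_or Y = Or" "sm_top Y = Ytop"
  by (simp_all add: Y_def MetrTop_def Ytop_def)

lemma act_Y [simp]:
  assumes "x \<in> E m" "k \<in> carrier G" "h \<in> carrier G"
  shows "sm_act Y (EC x k) h = EC x (k \<otimes>\<^bsub>G\<^esub> h)"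
proof -
  obtain t where t: "t \<in> Spin" "(SOME y. y \<in> EC x k) = (j (x, t), inv\<^bsub>G\<^esub> t \<otimes>\<^bsub>G\<^esub> k)"
    using some_EC[OF assms(1,2)] .
  have tc: "t \<in> carrier G" using Spin_subset[OF t(1)] .
  have "t \<otimes>\<^bsub>G\<^esub> (inv\<^bsub>G\<^esub> t \<otimes>\<^bsub>G\<^esub> k \<otimes>\<^bsub>G\<^esub> h) = k \<otimes>\<^bsub>G\<^esub> h"
    using tc assms by (simp add: m_assoc[symmetric])
  then show ?thesis
    using t tc assms by (simp add: Y_def MetrTop_def ext_cls_EC)
qed

lemma map_Y [simp]:
  assumes "x \<in> E m" "k \<in> carrier G"
  shows "sm_map Y (EC x k) = fr (\<iota> x) (cov k)"
proof -
  obtain t where t: "t \<in> Spin" "(SOME y. y \<in> EC x k) = (j (x, t), inv\<^bsub>G\<^esub> t \<otimes>\<^bsub>G\<^esub> k)"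
    using some_EC[OF assms] .
  have tc: "t \<in> carrier G" using Spin_subset[OF t(1)] .
  have "t \<otimes>\<^bsub>G\<^esub> (inv\<^bsub>G\<^esub> t \<otimes>\<^bsub>G\<^esub> k) = k" using tc assms by (simp add: m_assoc[symmetric])
  then show ?thesis
    using t tc assms act_frames[of x t "inv\<^bsub>G\<^esub> t \<otimes>\<^bsub>G\<^esub> k"] by (simp add: Y_def MetrTop_def)
qed

lemma YE:
  assumes "C \<in> topspace Ytop" obtains x k where "x \<in> E m" "k \<in> carrier G" "C = EC x k"
  using assms by (auto simp: Ytop_topspace)

lemma Y_object: "Y \<in> Ob (SpinMfds D)"
proof -
  have pb: "principal_bundle G (sd_top D) Mtop Ytop (sm_act Y) (\<lambda>b. fst (sm_map Y b))"
    by (rule trivial_principal_bundle[OF sd_top_topspace sd_top_mult is_monoid Y_homeo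
          kappa_homeo[THEN homeomorphic_maps_sym[THEN iffD1]]]) simp_all
  from double_covering_homeo[OF double_covering_prod[OF cov_dc] Y_homeo[THEN homeomorphic_maps_sym[THEN iffD1]] frame_homeo]
  have dc: "double_covering Ytop (frame_top M Or) (sm_map Y)"
    by (rule double_covering_cong) (auto elim!: YE)
  have "sm_map Y (sm_act Y b h) = frame_act m (sm_map Y b) (cov h)" if "b \<in> topspace Ytop" "h \<in> carrier G" for b h
    using that by (auto elim!: YE simp: act_frames)
  then show ?thesis
    using pb dc smooth_manifold_M orientation_Or
    by (simp add: SpinMfds_def topological_spin_mfd_def)
qed

end

section \<open>The spin diffeomorphisms induced by linear maps\<close>

context spin_euclid
begin

interpretation group "sd_grp D" by (rule group_G)

text \<open>Left translation, which commutes with the right action of the structure group. The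
  element \<open>h\<close> itself selects one of the two lifts of
  \<open>lin (cov h)\<close>.\<close>

definition L :: "'h \<Rightarrow> ('a \<Rightarrow> 'a) \<times> (('p \<times> 'h) set \<Rightarrow> ('p \<times> 'h) set)" where
  "L h = (lin (cov h), \<lambda>C\<in>topspace Ytop. case ECinv C of (x, k) \<Rightarrow> EC (mulv (cov h) x) (h \<otimes>\<^bsub>G\<^esub> k))"

definition R :: "'h \<Rightarrow> ('a \<Rightarrow> 'a) \<times> ('p \<Rightarrow> 'p)" where
  "R s = (lin (cov s), \<lambda>b\<in>Pset. case jinv b of (x, t) \<Rightarrow> j (mulv (cov s) x, s \<otimes>\<^bsub>G\<^esub> t))"

lemma mulv_cov_E: "h \<in> carrier G \<Longrightarrow> mulv (cov h) x \<in> E m"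
  by (rule mulv_E) (rule cov_carrier)

lemma L_EC: "h \<in> carrier G \<Longrightarrow> x \<in> E m \<Longrightarrow> k \<in> carrier G \<Longrightarrow> snd (L h) (EC x k) = EC (mulv (cov h) x) (h \<otimes>\<^bsub>G\<^esub> k)"
  by (simp add: L_def)

lemma R_j: "s \<in> Spin \<Longrightarrow> x \<in> E m \<Longrightarrow> t \<in> Spin \<Longrightarrow> snd (R s) (j (x, t)) = j (mulv (cov s) x, s \<otimes>\<^bsub>G\<^esub> t)"
  by (simp add: R_def)

lemma mulv_continuous:
  assumes "A \<in> carrier_mat m m"
  shows "continuous_map (Euclidean_space m) (Euclidean_space m) (mulv A)"
  unfolding continuous_map_into_E
proof (intro conjI allI impI)
  fix i assume i: "i < m"
  have "continuous_map (Euclidean_space m) euclideanreal (\<lambda>x. \<Sum>j<m. A $$ (i, j) * x j)"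
    by (intro continuous_map_sum continuous_map_real_mult continuous_map_E_coord) simp_all
  then show "continuous_map (Euclidean_space m) euclideanreal (\<lambda>x. mulv A x i)"
    using i assms by (simp add: mulv_def)
qed (use mulv_E[OF assms] in simp)

lemma translate_continuous:
  assumes h: "h \<in> carrier G"
  shows "continuous_map (prod_topology (Euclidean_space m) (sd_top D)) (prod_topology (Euclidean_space m) (sd_top D))
    (\<lambda>z. (mulv (cov h) (fst z), h \<otimes>\<^bsub>G\<^esub> snd z))"
proof -
  let ?Z = "prod_topology (Euclidean_space m) (sd_top D)"
  have "continuous_map ?Z (prod_topology (sd_top D) (sd_top D)) (\<lambda>z. (h, snd z))"
    using h continuous_map_snd[of "Euclidean_space m" "sd_top D"] by (simp add: continuous_map_pairwise o_def sd_top_topspace)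
  from continuous_map_compose[OF this sd_top_mult]
  have "continuous_map ?Z (sd_top D) (\<lambda>z. h \<otimes>\<^bsub>G\<^esub> snd z)" by (simp add: o_def)
  moreover have "continuous_map ?Z (Euclidean_space m) (\<lambda>z. mulv (cov h) (fst z))"
    using continuous_map_compose[OF continuous_map_fst[of "Euclidean_space m" "sd_top D"] mulv_continuous[OF cov_carrier[OF h]]]
    by (simp add: o_def)
  ultimately show ?thesis by (simp add: continuous_map_pairwise o_def)
qed

lemma lin_cov_diffeo: "h \<in> carrier G \<Longrightarrow> lin (cov h) \<in> oriented_diffeos M Or M Or"
  by (rule lin_diffeo[of _ "cov (inv\<^bsub>G\<^esub> h)"]) (simp_all add: cov_carrier cov_det cov_inv)

lemma dframe_lin:
  assumes "h \<in> carrier G" "k \<in> carrier G" "x \<in> E m"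
  shows "dframe M M (lin (cov h)) (fr (\<iota> x) (cov k)) = fr (\<iota> (mulv (cov h) x)) (cov (h \<otimes>\<^bsub>G\<^esub> k))"
  using assms by (simp add: dframe_fr c0_smooth_lin cov_carrier F_lin iota_pts lin_iota cov_mult)

lemma L_lift:
  assumes h: "h \<in> carrier G"
  shows "L h \<in> spin_lifts Y Y"
proof -
  have "continuous_map Ytop Ytop (snd (L h))"
  proof (rule continuous_map_eq)
    let ?Z = "prod_topology (Euclidean_space m) (sd_top D)"
    have "continuous_map Ytop ?Z ECinv" "continuous_map ?Z Ytop (\<lambda>(x, k). EC x k)"
      using Y_homeo unfolding homeomorphic_maps_def by blast+
    then show "continuous_map Ytop Ytop ((\<lambda>(x, k). EC x k) \<circ> ((\<lambda>z. (mulv (cov h) (fst z), h \<otimes>\<^bsub>G\<^esub> snd z)) \<circ> ECinv))"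
      using translate_continuous[OF h] by (intro continuous_map_compose)
    show "((\<lambda>(x, k). EC x k) \<circ> ((\<lambda>z. (mulv (cov h) (fst z), h \<otimes>\<^bsub>G\<^esub> snd z)) \<circ> ECinv)) C = snd (L h) C"
      if C: "C \<in> topspace Ytop" for C
    proof -
      obtain x k where "x \<in> E m" "k \<in> carrier G" "C = EC x k" by (rule YE[OF C])
      then show ?thesis using h by (simp add: L_EC)
    qed
  qed
  moreover have "sm_map Y (snd (L h) C) = dframe M M (lin (cov h)) (sm_map Y C)" if C: "C \<in> topspace Ytop" for C
  proof -
    obtain x k where "x \<in> E m" "k \<in> carrier G" "C = EC x k" by (rule YE[OF C])
    then show ?thesis using h by (simp add: L_EC mulv_cov_E dframe_lin)
  qed
  moreover have "fst (L h) = lin (cov h)" "snd (L h) \<in> extensional (topspace Ytop)"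
    by (simp_all add: L_def)
  ultimately show ?thesis
    using lin_cov_diffeo[OF h] by (simp add: spin_lifts_def split_def)
qed

text \<open>\<open>L\<close> is multiplicative on the double cover itself, not merely up to the
  choice of lifts; a functor therefore yields a genuine action of that group.\<close>

lemma L_mult:
  assumes h: "h \<in> carrier G" and k: "k \<in> carrier G"
  shows "spin_cmp Y (L h) (L k) = L (h \<otimes>\<^bsub>G\<^esub> k)"
proof -
  have "compose pts (lin (cov h)) (lin (cov k)) = lin (cov (h \<otimes>\<^bsub>G\<^esub> k))"
  proof
    fix p show "compose pts (lin (cov h)) (lin (cov k)) p = lin (cov (h \<otimes>\<^bsub>G\<^esub> k)) p"
      using h k by (cases "p \<in> pts") (simp_all add: compose_def lin_lin cov_carrier cov_mult, simp add: lin_def)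
  qed
  moreover have "compose (topspace Ytop) (snd (L h)) (snd (L k)) = snd (L (h \<otimes>\<^bsub>G\<^esub> k))"
  proof
    fix C show "compose (topspace Ytop) (snd (L h)) (snd (L k)) C = snd (L (h \<otimes>\<^bsub>G\<^esub> k)) C"
    proof (cases "C \<in> topspace Ytop")
      case True
      obtain x l where "x \<in> E m" "l \<in> carrier G" "C = EC x l" by (rule YE[OF True])
      then show ?thesis
        using h k True by (simp add: compose_def L_EC mulv_cov_E cov_mult mulv_mult[OF cov_carrier cov_carrier] m_assoc)
    qed (simp add: compose_def L_def)
  qed
  ultimately show ?thesis by (simp add: spin_cmp_def split_def) (simp add: L_def)
qed

text \<open>For elements of Spin the linear map is orthogonal, hence isometric for the flat
  metric.\<close>

lemma R_hom:
  assumes s: "s \<in> Spin"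
  shows "R s \<in> Hom (RiemSpinMf D) X X"
proof -
  have sc: "s \<in> carrier G" by (rule Spin_subset[OF s])
  have "continuous_map Ptop Ptop (snd (R s))"
  proof (rule continuous_map_eq)
    let ?Z = "prod_topology (Euclidean_space m) (spin_top D)"
    let ?t = "\<lambda>z. (mulv (cov s) (fst z), s \<otimes>\<^bsub>G\<^esub> snd z)"
    have j: "continuous_map Ptop ?Z jinv" "continuous_map ?Z Ptop j"
      using Ptop_homeo unfolding homeomorphic_maps_def by blast+
    have "?Z = subtopology (prod_topology (Euclidean_space m) (sd_top D)) (E m \<times> Spin)"
      by (simp add: spin_top_def prod_topology_subtopology)
    then have "continuous_map ?Z ?Z ?t"
      using continuous_map_from_subtopology[OF translate_continuous[OF sc], of "E m \<times> Spin"] Spin_mult[OF s] mulv_cov_E[OF sc]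
      by (auto simp: continuous_map_in_subtopology)
    then show "continuous_map Ptop Ptop (j \<circ> (?t \<circ> jinv))"
      using j by (intro continuous_map_compose)
    show "(j \<circ> (?t \<circ> jinv)) b = snd (R s) b" if "b \<in> topspace Ptop" for b
    proof -
      have "b \<in> Pset" using that by simp
      then obtain x t where "x \<in> E m" "t \<in> Spin" "b = j (x, t)" by (rule PsetE)
      then show ?thesis using s by (simp add: R_j)
    qed
  qed
  moreover have "sm_map X (snd (R s) b) = dframe M M (lin (cov s)) (sm_map X b)" if b: "b \<in> Pset" for b
  proof -
    obtain x t where "x \<in> E m" "t \<in> Spin" "b = j (x, t)" by (rule PsetE[OF b])
    then show ?thesis using s sc Spin_mult[OF s] by (simp add: R_j mulv_cov_E dframe_lin Spin_subset)
  qed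
  moreover have "fst (R s) = lin (cov s)" "snd (R s) \<in> extensional Pset"
    by (simp_all add: R_def)
  moreover have "g (dmap M M (lin (cov s)) v) (dmap M M (lin (cov s)) w) = g v w"
    if "p \<in> pts" "v \<in> tangent M p" "w \<in> tangent M p" for p v w
    using s that by (intro g_lin) (auto simp: spin_carrier_def SO_mats_def)
  ultimately show ?thesis
    using lin_cov_diffeo[OF sc] by (simp add: RiemSpinMf_def spin_lifts_def split_def)
qed

text \<open>Whichever representative t is picked, it cancels in (s t)(t^-1 k).\<close>

lemma MetrTop_R:
  assumes s: "s \<in> Spin"
  shows "mmap (MetrTop D) X X (R s) = L s"
proof -
  have sc: "s \<in> carrier G" by (rule Spin_subset[OF s])
  have "(case SOME y. y \<in> C of (b, h) \<Rightarrow> ext_cls D X (snd (R s) b, h)) = snd (L s) C" if C: "C \<in> topspace Ytop" for C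
  proof -
    obtain x k where x: "x \<in> E m" "k \<in> carrier G" "C = EC x k" by (rule YE[OF C])
    obtain t where t: "t \<in> Spin" "(SOME y. y \<in> EC x k) = (j (x, t), inv\<^bsub>G\<^esub> t \<otimes>\<^bsub>G\<^esub> k)"
      using some_EC[OF x(1,2)] .
    have tc: "t \<in> carrier G" using Spin_subset[OF t(1)] .
    have "s \<otimes>\<^bsub>G\<^esub> t \<otimes>\<^bsub>G\<^esub> (inv\<^bsub>G\<^esub> t \<otimes>\<^bsub>G\<^esub> k) = s \<otimes>\<^bsub>G\<^esub> k"
    proof -
      have "t \<otimes>\<^bsub>G\<^esub> (inv\<^bsub>G\<^esub> t \<otimes>\<^bsub>G\<^esub> k) = k" using tc x(2) by (simp add: m_assoc[symmetric])
      then show ?thesis using tc sc x(2) by (simp add: m_assoc)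
    qed
    then show ?thesis
      using s sc t tc x Spin_mult[OF s t(1)] by (simp add: R_j ext_cls_EC mulv_cov_E L_EC)
  qed
  then have "(\<lambda>C\<in>topspace Ytop. case SOME y. y \<in> C of (b, h) \<Rightarrow> ext_cls D X (snd (R s) b, h)) = snd (L s)"
    by (auto simp: fun_eq_iff L_def)
  then show ?thesis by (simp add: MetrTop_def split_def Ytop_def) (simp add: R_def L_def)
qed

section \<open>The spinor bundle of Euclidean space in global coordinates\<close>

definition SC :: "(nat \<Rightarrow> real) \<Rightarrow> complex Matrix.vec \<Rightarrow> ('p \<times> complex Matrix.vec) set" where
  "SC x v = {(j (x, t), \<rho> (inv\<^bsub>G\<^esub> t) *\<^sub>v v) | t. t \<in> Spin}"

lemma rho_vec: "s \<in> Spin \<Longrightarrow> v \<in> carrier_vec N \<Longrightarrow> \<rho> s *\<^sub>v v \<in> carrier_vec N"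
  using rho_carrier by (rule mult_mat_vec_carrier)

lemma rho_rho:
  "s \<in> Spin \<Longrightarrow> t \<in> Spin \<Longrightarrow> v \<in> carrier_vec N \<Longrightarrow> \<rho> s *\<^sub>v (\<rho> t *\<^sub>v v) = \<rho> (s \<otimes>\<^bsub>G\<^esub> t) *\<^sub>v v"
  by (simp add: rho_mult assoc_mult_mat_vec[OF rho_carrier rho_carrier])

lemma rho_one_vec: "v \<in> carrier_vec N \<Longrightarrow> \<rho> \<one>\<^bsub>G\<^esub> *\<^sub>v v = v"
  by (simp add: rho_one)

text \<open>Moving s across the pair turns [(x, s), v] into [(x, 1), \<rho>(s) v]. Thus
  \<open>SC x\<close> is a coordinate system on the fibre over the copy of x.\<close>

lemma spinor_cls_SC:
  assumes x: "x \<in> E m" and s: "s \<in> Spin" and v: "v \<in> carrier_vec N"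
  shows "spinor_cls D X (j (x, s), v) = SC x (\<rho> s *\<^sub>v v)"
proof -
  have sc: "s \<in> carrier G" using Spin_subset[OF s] .
  have "spinor_cls D X (j (x, s), v) = {(j (x, s \<otimes>\<^bsub>G\<^esub> t), \<rho> (inv\<^bsub>G\<^esub> t) *\<^sub>v v) | t. t \<in> Spin}"
    using x s by (simp add: spinor_cls_def assoc_cls_def)
  also have "\<dots> = SC x (\<rho> s *\<^sub>v v)"
    unfolding SC_def
  proof (rule Set.set_eqI, rule iffI)
    fix z assume "z \<in> {(j (x, s \<otimes>\<^bsub>G\<^esub> t), \<rho> (inv\<^bsub>G\<^esub> t) *\<^sub>v v) | t. t \<in> Spin}"
    then obtain t where t: "t \<in> Spin" "z = (j (x, s \<otimes>\<^bsub>G\<^esub> t), \<rho> (inv\<^bsub>G\<^esub> t) *\<^sub>v v)" by blast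
    have tc: "t \<in> carrier G" using Spin_subset[OF t(1)] .
    have st: "s \<otimes>\<^bsub>G\<^esub> t \<in> Spin" by (rule Spin_mult[OF s t(1)])
    have "inv\<^bsub>G\<^esub> (s \<otimes>\<^bsub>G\<^esub> t) \<otimes>\<^bsub>G\<^esub> s = inv\<^bsub>G\<^esub> t"
      using sc tc by (simp add: inv_mult_group m_assoc)
    then have "\<rho> (inv\<^bsub>G\<^esub> (s \<otimes>\<^bsub>G\<^esub> t)) *\<^sub>v (\<rho> s *\<^sub>v v) = \<rho> (inv\<^bsub>G\<^esub> t) *\<^sub>v v"
      by (simp only: rho_rho[OF Spin_inv[OF st] s v])
    then show "z \<in> {(j (x, t), \<rho> (inv\<^bsub>G\<^esub> t) *\<^sub>v (\<rho> s *\<^sub>v v)) | t. t \<in> Spin}"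
      using t st by (intro CollectI exI[of _ "s \<otimes>\<^bsub>G\<^esub> t"]) simp
  next
    fix z assume "z \<in> {(j (x, t), \<rho> (inv\<^bsub>G\<^esub> t) *\<^sub>v (\<rho> s *\<^sub>v v)) | t. t \<in> Spin}"
    then obtain t where t: "t \<in> Spin" "z = (j (x, t), \<rho> (inv\<^bsub>G\<^esub> t) *\<^sub>v (\<rho> s *\<^sub>v v))" by blast
    have tc: "t \<in> carrier G" using Spin_subset[OF t(1)] .
    have st: "inv\<^bsub>G\<^esub> s \<otimes>\<^bsub>G\<^esub> t \<in> Spin" by (rule Spin_mult[OF Spin_inv[OF s] t(1)])
    have 1: "s \<otimes>\<^bsub>G\<^esub> (inv\<^bsub>G\<^esub> s \<otimes>\<^bsub>G\<^esub> t) = t" using sc tc by (simp add: m_assoc[symmetric])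
    have "inv\<^bsub>G\<^esub> (inv\<^bsub>G\<^esub> s \<otimes>\<^bsub>G\<^esub> t) = inv\<^bsub>G\<^esub> t \<otimes>\<^bsub>G\<^esub> s"
      using sc tc by (simp add: inv_mult_group)
    then have "\<rho> (inv\<^bsub>G\<^esub> (inv\<^bsub>G\<^esub> s \<otimes>\<^bsub>G\<^esub> t)) *\<^sub>v v = \<rho> (inv\<^bsub>G\<^esub> t) *\<^sub>v (\<rho> s *\<^sub>v v)"
      by (simp only: rho_rho[OF Spin_inv[OF t(1)] s v])
    then show "z \<in> {(j (x, s \<otimes>\<^bsub>G\<^esub> t), \<rho> (inv\<^bsub>G\<^esub> t) *\<^sub>v v) | t. t \<in> Spin}"
      using t st 1 by (intro CollectI exI[of _ "inv\<^bsub>G\<^esub> s \<otimes>\<^bsub>G\<^esub> t"]) simp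
  qed
  finally show ?thesis .
qed

lemma SC_eq_cls: "x \<in> E m \<Longrightarrow> v \<in> carrier_vec N \<Longrightarrow> spinor_cls D X (j (x, \<one>\<^bsub>G\<^esub>), v) = SC x v"
  by (simp add: spinor_cls_SC Spin_one rho_one)

lemma mem_SC: "v \<in> carrier_vec N \<Longrightarrow> (j (x, \<one>\<^bsub>G\<^esub>), v) \<in> SC x v"
  unfolding SC_def using Spin_one by (intro CollectI exI[of _ "\<one>\<^bsub>G\<^esub>"]) (simp add: rho_one_vec)

lemma j_inj: "x \<in> E m \<Longrightarrow> y \<in> E m \<Longrightarrow> s \<in> Spin \<Longrightarrow> t \<in> Spin \<Longrightarrow> j (x, s) = j (y, t) \<longleftrightarrow> x = y \<and> s = t"
  by (metis jinv_j prod.inject)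

text \<open>By injectivity of \<open>j\<close>, a class contains only one pair whose first entry is
  the unit point over x.\<close>

lemma SC_inject:
  assumes "x \<in> E m" "v \<in> carrier_vec N" "w \<in> carrier_vec N" "SC x v = SC x w"
  shows "v = w"
proof -
  have "(j (x, \<one>\<^bsub>G\<^esub>), v) \<in> SC x w" using mem_SC[OF assms(2)] assms(4) by metis
  then obtain t where t: "t \<in> Spin" "j (x, \<one>\<^bsub>G\<^esub>) = j (x, t)" "v = \<rho> (inv\<^bsub>G\<^esub> t) *\<^sub>v w"
    unfolding SC_def by blast
  then have "t = \<one>\<^bsub>G\<^esub>" using j_inj[OF assms(1) assms(1) Spin_one t(1)] by simp
  then show ?thesis using t(3) assms(3) by (simp add: rho_one)
qed

lemma some_SC:
  assumes "v \<in> carrier_vec N"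
  obtains t where "t \<in> Spin" "(SOME y. y \<in> SC x v) = (j (x, t), \<rho> (inv\<^bsub>G\<^esub> t) *\<^sub>v v)"
proof -
  have "(SOME y. y \<in> SC x v) \<in> SC x v" using mem_SC[OF assms] by (rule someI)
  then show thesis using that unfolding SC_def by blast
qed

abbreviation "V \<equiv> spinor_bundle D X"

lemma V_simps [simp]:
  "vbase V = M" "points (vtot V) = topspace (spinor_top D X)" "vproj V = spinor_proj X"
  by (simp_all add: spinor_bundle_def)

lemma spinor_top_topspace: "topspace (spinor_top D X) = {SC x v | x v. x \<in> E m \<and> v \<in> carrier_vec N}"
proof -
  have "topspace (vec_top N :: complex Matrix.vec topology) = carrier_vec N"
    by (auto simp: vec_top_def topspace_pullback_topology)
  then have t: "topspace (spinor_top D X) = spinor_cls D X ` (Pset \<times> carrier_vec N)"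
    by (simp add: spinor_top_def)
  show ?thesis
  proof (rule Set.set_eqI, rule iffI)
    fix C assume "C \<in> topspace (spinor_top D X)"
    then obtain b v where b: "b \<in> Pset" "v \<in> carrier_vec N" "C = spinor_cls D X (b, v)" unfolding t by blast
    obtain x s where "x \<in> E m" "s \<in> Spin" "b = j (x, s)" by (rule PsetE[OF b(1)])
    then show "C \<in> {SC x v | x v. x \<in> E m \<and> v \<in> carrier_vec N}"
      using b spinor_cls_SC rho_vec by blast
  next
    fix C assume "C \<in> {SC x v | x v. x \<in> E m \<and> v \<in> carrier_vec N}"
    then obtain x v where x: "x \<in> E m" "v \<in> carrier_vec N" "C = SC x v" by blast
    then have "C = spinor_cls D X (j (x, \<one>\<^bsub>G\<^esub>), v)" by (simp add: SC_eq_cls)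
    then show "C \<in> topspace (spinor_top D X)"
      unfolding t using x Spin_one by (intro image_eqI[of _ _ "(j (x, \<one>\<^bsub>G\<^esub>), v)"]) simp_all
  qed
qed

lemma spinor_proj_SC: "x \<in> E m \<Longrightarrow> v \<in> carrier_vec N \<Longrightarrow> spinor_proj X (SC x v) = \<iota> x"
  by (rule some_SC[of v x]) (simp_all add: spinor_proj_def)

lemma iota_inj: "x \<in> E m \<Longrightarrow> y \<in> E m \<Longrightarrow> \<iota> x = \<iota> y \<longleftrightarrow> x = y"
  by (metis kappa_iota)

lemma vfib_V:
  assumes x: "x \<in> E m"
  shows "vfib V (\<iota> x) = SC x ` carrier_vec N"
  unfolding vfib_def V_simps spinor_top_topspace
  using x spinor_proj_SC iota_inj[OF _ x] by force

lemma vadd_SC: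
  assumes x: "x \<in> E m" and v: "v \<in> carrier_vec N" and w: "w \<in> carrier_vec N"
  shows "vadd V (SC x v) (SC x w) = SC x (v + w)"
proof -
  let ?P = "\<lambda>(b, v', w'). (b, v') \<in> SC x v \<and> (b, w') \<in> SC x w"
  have "?P (j (x, \<one>\<^bsub>G\<^esub>), v, w)" using mem_SC v w by simp
  then have "?P (SOME y. ?P y)" by (rule someI)
  then obtain b v' w' where y: "(SOME y. ?P y) = (b, v', w')" and b: "(b, v') \<in> SC x v" "(b, w') \<in> SC x w"
    by (cases "SOME y. ?P y") auto
  from b(1) obtain t where t: "t \<in> Spin" "b = j (x, t)" "v' = \<rho> (inv\<^bsub>G\<^esub> t) *\<^sub>v v" unfolding SC_def by blast
  from b(2) obtain t' where t': "t' \<in> Spin" "b = j (x, t')" "w' = \<rho> (inv\<^bsub>G\<^esub> t') *\<^sub>v w" unfolding SC_def by blast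
  \<comment> \<open>\<open>vadd\<close> picks representatives with a common first entry
    \<open>b\<close>, and \<open>j\<close> being injective, this forces the same group element for
    both summands.\<close>
  have "t' = t" using j_inj[OF x x t'(1) t(1)] t(2) t'(2) by simp
  then have "v' + w' = \<rho> (inv\<^bsub>G\<^esub> t) *\<^sub>v (v + w)"
    using t t' v w by (simp add: mult_add_distrib_mat_vec[OF rho_carrier[OF Spin_inv[OF t(1)]]])
  then have "spinor_cls D X (b, v' + w') = SC x (v + w)"
    using t x v w Spin_inv[OF t(1)] Spin_subset[OF t(1)]
    by (simp add: spinor_cls_SC rho_vec rho_rho rho_one)
  then show ?thesis
    using y by (simp add: spinor_bundle_def)
qed

lemma vscl_SC:
  assumes x: "x \<in> E m" and v: "v \<in> carrier_vec N"
  shows "vscl V z (SC x v) = SC x (z \<cdot>\<^sub>v v)"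
proof -
  obtain t where t: "t \<in> Spin" "(SOME y. y \<in> SC x v) = (j (x, t), \<rho> (inv\<^bsub>G\<^esub> t) *\<^sub>v v)"
    by (rule some_SC[OF v])
  have "z \<cdot>\<^sub>v (\<rho> (inv\<^bsub>G\<^esub> t) *\<^sub>v v) = \<rho> (inv\<^bsub>G\<^esub> t) *\<^sub>v (z \<cdot>\<^sub>v v)"
    by (rule mult_mat_vec[OF rho_carrier[OF Spin_inv[OF t(1)]] v, symmetric])
  then have "spinor_cls D X (j (x, t), z \<cdot>\<^sub>v (\<rho> (inv\<^bsub>G\<^esub> t) *\<^sub>v v)) = SC x (z \<cdot>\<^sub>v v)"
    using t x v Spin_inv[OF t(1)] Spin_subset[OF t(1)]
    by (simp add: spinor_cls_SC rho_vec rho_rho rho_one)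
  then show ?thesis
    using t by (simp add: spinor_bundle_def)
qed

text \<open>On representatives the point is moved and the vector is kept; in the coordinates
  \<open>SC\<close> the left factor s turns into \<rho>(s), independently of the
  representative.\<close>

lemma Sigma_R:
  assumes s: "s \<in> Spin" and x: "x \<in> E m" and v: "v \<in> carrier_vec N"
  shows "snd (mmap (forget_dirac \<circ>\<^sub>F Sigma_fun D) X X (R s)) (SC x v) = SC (mulv (cov s) x) (\<rho> s *\<^sub>v v)"
proof -
  obtain t where t: "t \<in> Spin" "(SOME y. y \<in> SC x v) = (j (x, t), \<rho> (inv\<^bsub>G\<^esub> t) *\<^sub>v v)"
    by (rule some_SC[OF v])
  have "SC x v \<in> topspace (spinor_top D X)" using x v by (auto simp: spinor_top_topspace)
  then have "snd (mmap (forget_dirac \<circ>\<^sub>F Sigma_fun D) X X (R s)) (SC x v) =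
      spinor_cls D X (snd (R s) (j (x, t)), \<rho> (inv\<^bsub>G\<^esub> t) *\<^sub>v v)"
    using t by (simp add: funct_comp_def forget_dirac_def Sigma_fun_def split_def)
  also have "\<dots> = SC (mulv (cov s) x) (\<rho> (s \<otimes>\<^bsub>G\<^esub> t) *\<^sub>v (\<rho> (inv\<^bsub>G\<^esub> t) *\<^sub>v v))"
    using s x t(1) v Spin_subset[OF s]
    by (simp add: R_j spinor_cls_SC mulv_cov_E Spin_mult Spin_inv rho_vec)
  also have "\<rho> (s \<otimes>\<^bsub>G\<^esub> t) *\<^sub>v (\<rho> (inv\<^bsub>G\<^esub> t) *\<^sub>v v) = \<rho> s *\<^sub>v v"
    using s t(1) v Spin_subset[OF s] Spin_subset[OF t(1)]
    by (simp add: rho_rho Spin_mult Spin_inv m_assoc)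
  finally show ?thesis .
qed

lemma no_topological_spinor_functor:
  fixes \<Sigma> :: "(('a, ('p \<times> 'h) set, 'h) spin_mfd, ('a \<Rightarrow> 'a) \<times> (('p \<times> 'h) set \<Rightarrow> ('p \<times> 'h) set),
       ('a, ('p \<times> complex Matrix.vec) set, complex) vbundle,
       ('a \<Rightarrow> 'a) \<times> (('p \<times> complex Matrix.vec) set \<Rightarrow> ('p \<times> complex Matrix.vec) set)) funct"
  assumes F: "is_functor (SpinMfds D) VB \<Sigma>"
    and \<Sigma>X: "funct_eq (RiemSpinMf D) (forget_dirac \<circ>\<^sub>F Sigma_fun D) (\<Sigma> \<circ>\<^sub>F MetrTop D)"
    and pr: "funct_eq (SpinMfds D) (pr \<circ>\<^sub>F \<Sigma>) forget_spin"
  shows False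
proof -
  let ?o = "\<lambda>_. 0 :: real"
  have o: "?o \<in> E m" by (simp add: E_iff)
  \<comment> \<open>\<open>Y\<close> is the image of \<open>X\<close> under \<open>MetrTop\<close>,
    so equality on objects places the spinor bundle itself over \<open>Y\<close>.\<close>
  have oV: "omap \<Sigma> Y = V"
    using \<Sigma>X X_object unfolding funct_eq_def
    by (simp add: funct_comp_def forget_dirac_def Sigma_fun_def Y_def)
  define \<Phi> where "\<Phi> h = mmap \<Sigma> Y Y (L h)" for h
  have LH: "L h \<in> Hom (SpinMfds D) Y Y" if "h \<in> carrier G" for h
    using L_lift[OF that] by (simp add: SpinMfds_def)
  \<comment> \<open>Here the equation with \<open>pr\<close> enters: the bundle map covers a linear
    map, which fixes the origin.\<close>
  have \<Phi>1: "fst (\<Phi> h) = lin (cov h)" if h: "h \<in> carrier G" for h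
  proof -
    have "mmap (pr \<circ>\<^sub>F \<Sigma>) Y Y (L h) = mmap forget_spin Y Y (L h)"
      using pr Y_object LH[OF h] unfolding funct_eq_def by blast
    then show ?thesis by (simp add: funct_comp_def pr_def forget_spin_def \<Phi>_def L_def split_def)
  qed
  have \<Phi>B: "\<Phi> h \<in> bundle_maps V V" if h: "h \<in> carrier G" for h
  proof -
    have "\<Phi> h \<in> Hom VB (omap \<Sigma> Y) (omap \<Sigma> Y)"
      unfolding \<Phi>_def using F Y_object LH[OF h] unfolding is_functor_def by blast
    then show ?thesis by (simp add: oV VB_def)
  qed
  have \<Phi>C: "\<Phi> (h \<otimes>\<^bsub>G\<^esub> k) = Cmp VB V V V (\<Phi> h) (\<Phi> k)" if h: "h \<in> carrier G" and k: "k \<in> carrier G" for h k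
  proof -
    have "mmap \<Sigma> Y Y (Cmp (SpinMfds D) Y Y Y (L h) (L k)) = Cmp VB (omap \<Sigma> Y) (omap \<Sigma> Y) (omap \<Sigma> Y) (\<Phi> h) (\<Phi> k)"
      unfolding \<Phi>_def using F Y_object LH[OF h] LH[OF k] unfolding is_functor_def by blast
    then show ?thesis by (simp add: oV \<Phi>_def SpinMfds_def L_mult[OF h k])
  qed
  \<comment> \<open>For s in Spin the morphism \<open>L s\<close> is the image of the isometry
    \<open>R s\<close>, so the equation with \<open>MetrTop\<close> determines
    \<open>\<Phi> s\<close>.\<close>
  have \<Phi>S: "snd (\<Phi> s) (SC ?o v) = SC ?o (\<rho> s *\<^sub>v v)" if s: "s \<in> Spin" and v: "v \<in> carrier_vec N" for s v
  proof -
    have "mmap (forget_dirac \<circ>\<^sub>F Sigma_fun D) X X (R s) = mmap (\<Sigma> \<circ>\<^sub>F MetrTop D) X X (R s)"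
      using \<Sigma>X X_object R_hom[OF s] unfolding funct_eq_def by blast
    also have "\<dots> = \<Phi> s"
      by (simp add: funct_comp_def MetrTop_R[OF s] \<Phi>_def Y_def)
    finally show ?thesis using Sigma_R[OF s o v] by (simp add: mulv_zero)
  qed
  have SCt: "SC ?o v \<in> topspace (spinor_top D X)" if "v \<in> carrier_vec N" for v
    using that o by (auto simp: spinor_top_topspace)
  have ex: "\<exists>u\<in>carrier_vec N. snd (\<Phi> h) (SC ?o v) = SC ?o u" if h: "h \<in> carrier G" and v: "v \<in> carrier_vec N" for h v
  proof -
    have "snd (\<Phi> h) \<in> smooth_maps (vtot V) (vtot V)"
      "\<forall>e\<in>points (vtot V). vproj V (snd (\<Phi> h) e) = fst (\<Phi> h) (vproj V e)"
      using \<Phi>B[OF h] by (auto simp: bundle_maps_def)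
    then have "snd (\<Phi> h) (SC ?o v) \<in> topspace (spinor_top D X)"
      and "spinor_proj X (snd (\<Phi> h) (SC ?o v)) = lin (cov h) (\<iota> ?o)"
      using SCt[OF v] continuous_map_funspace[of "mtop (vtot V)" "mtop (vtot V)" "snd (\<Phi> h)"] o v
      by (auto simp: smooth_maps_def \<Phi>1[OF h] spinor_proj_SC)
    then have "snd (\<Phi> h) (SC ?o v) \<in> vfib V (\<iota> ?o)"
      using o by (simp add: vfib_def lin_iota cov_carrier[OF h] mulv_zero)
    then show ?thesis unfolding vfib_V[OF o] by blast
  qed
  \<comment> \<open>The coordinate vector of the image in the fibre over the origin; it is unique by
    \<open>SC_inject\<close>.\<close>
  define T where "T h v = (SOME u. u \<in> carrier_vec N \<and> snd (\<Phi> h) (SC ?o v) = SC ?o u)" for h v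
  have T: "T h v \<in> carrier_vec N" "snd (\<Phi> h) (SC ?o v) = SC ?o (T h v)" if "h \<in> carrier G" "v \<in> carrier_vec N" for h v
  proof -
    have "\<exists>u. u \<in> carrier_vec N \<and> snd (\<Phi> h) (SC ?o v) = SC ?o u" using ex[OF that] by blast
    then have "T h v \<in> carrier_vec N \<and> snd (\<Phi> h) (SC ?o v) = SC ?o (T h v)" unfolding T_def by (rule someI_ex)
    then show "T h v \<in> carrier_vec N" "snd (\<Phi> h) (SC ?o v) = SC ?o (T h v)" by blast+
  qed
  have TI: "T h v = u" if "h \<in> carrier G" "v \<in> carrier_vec N" "u \<in> carrier_vec N" "snd (\<Phi> h) (SC ?o v) = SC ?o u" for h v u
    using SC_inject[OF o T(1)[OF that(1,2)] that(3)] T(2)[OF that(1,2)] that(4) by simp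
  have lin: "snd (\<Phi> h) (vadd V a b) = vadd V (snd (\<Phi> h) a) (snd (\<Phi> h) b)"
      "snd (\<Phi> h) (vscl V z a) = vscl V z (snd (\<Phi> h) a)"
    if "h \<in> carrier G" "a \<in> vfib V (\<iota> ?o)" "b \<in> vfib V (\<iota> ?o)" for h a b z
    using \<Phi>B[OF that(1)] that(2,3) iota_pts[OF o] by (auto simp: bundle_maps_def)
  have fib: "SC ?o v \<in> vfib V (\<iota> ?o)" if "v \<in> carrier_vec N" for v
    using that by (simp add: vfib_V[OF o])
  interpret rep_extension D T
  proof (unfold_locales)
    fix h k :: 'h and v w :: "complex Matrix.vec" and z :: complex
    show "T h v \<in> carrier_vec N" if "h \<in> carrier G" "v \<in> carrier_vec N" by (rule T(1)[OF that])
    show "T h (v + w) = T h v + T h w" if "h \<in> carrier G" "v \<in> carrier_vec N" "w \<in> carrier_vec N"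
      using that T lin(1)[OF that(1) fib[OF that(2)] fib[OF that(3)]] by (intro TI) (simp_all add: vadd_SC[OF o])
    show "T h (z \<cdot>\<^sub>v v) = z \<cdot>\<^sub>v T h v" if "h \<in> carrier G" "v \<in> carrier_vec N"
      using that T lin(2)[OF that(1) fib[OF that(2)] fib[OF that(2)]] by (intro TI) (simp_all add: vscl_SC[OF o])
    show "T (h \<otimes>\<^bsub>G\<^esub> k) v = T h (T k v)" if "h \<in> carrier G" "k \<in> carrier G" "v \<in> carrier_vec N"
    proof (rule TI)
      show "snd (\<Phi> (h \<otimes>\<^bsub>G\<^esub> k)) (SC ?o v) = SC ?o (T h (T k v))"
        using that T SCt[OF that(3)] by (simp add: \<Phi>C VB_def split_def compose_def)
    qed (use that T in simp_all)
    show "T h v = \<rho> h *\<^sub>v v" if "h \<in> Spin" "v \<in> carrier_vec N"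
      by (rule TI[OF Spin_subset[OF that(1)] that(2) rho_vec[OF that] \<Phi>S[OF that]])
  qed
  show False by (rule no_extension)
qed

end

section \<open>Room for the construction in types of at least continuum size\<close>

lemma inj_real_seq: "\<exists>e :: (nat \<Rightarrow> real) \<Rightarrow> real. inj e"
proof -
  have "(UNIV :: nat set set) \<approx> (UNIV :: real set)" by (rule nat_sets_eqpoll_reals)
  then obtain b :: "nat set \<Rightarrow> real" where b: "bij_betw b UNIV UNIV" unfolding eqpoll_def by blast
  have bi: "inj b" and bs: "surj b" using b by (auto simp: bij_betw_def)
  \<comment> \<open>A real number is coded by a set of natural numbers, and a sequence of such sets
    by one set of coded pairs.\<close>
  define c where "c f = {prod_encode (i, k) | i k. k \<in> inv_into UNIV b (f i)}" for f :: "nat \<Rightarrow> real"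
  have c: "k \<in> inv_into UNIV b (f i) \<longleftrightarrow> prod_encode (i, k) \<in> c f" for f i k
    by (auto simp: c_def)
  have "inj c"
  proof (rule injI)
    fix f h assume eq: "c f = c h"
    show "f = h"
    proof
      fix i
      have "inv_into UNIV b (f i) = inv_into UNIV b (h i)" using c eq by blast
      then show "f i = h i" using bs by (metis f_inv_into_f UNIV_I)
    qed
  qed
  then have "inj (b \<circ> c)" using bi by (rule inj_compose[rotated])
  then show ?thesis by blast
qed

context spin_context
begin

text \<open>At most two group elements lie over a matrix, so the matrix and one bit determine the element.\<close>

lemma group_lepoll_seq: "\<exists>e :: 'h \<Rightarrow> nat \<Rightarrow> real. inj_on e (carrier G)"
proof -
  define c where "c h = (SOME h'. h' \<in> carrier G \<and> cov h' = cov h)" for h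
  have c: "c h \<in> carrier G \<and> cov (c h) = cov h" if "h \<in> carrier G" for h
    unfolding c_def by (rule someI[of _ h]) (simp add: that)
  \<comment> \<open>Of three elements over one matrix, two lie in the same one of the two sheets,
    where \<open>cov\<close> is injective.\<close>
  have two: "h1 = h2 \<or> h1 = h3 \<or> h2 = h3"
    if h: "h1 \<in> carrier G" "h2 \<in> carrier G" "h3 \<in> carrier G" and eq: "cov h2 = cov h1" "cov h3 = cov h1" for h1 h2 h3
  proof -
    have dc: "double_covering (sd_top D) (subtopology (mat_top m) (carrier (GL_pos m))) cov"
      and tp: "topspace (sd_top D) = carrier G"
      using spin_setup by (auto simp: spin_setup_def topological_group_def)
    let ?B = "subtopology (mat_top m) (carrier (GL_pos m))"
    have B: "cov h1 \<in> topspace ?B"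
      using h(1) cov_carrier cov_det by (simp add: GL_pos_def)
    obtain U V1 V2 where "openin ?B U" and U: "cov h1 \<in> U"
      and "openin (sd_top D) V1" "openin (sd_top D) V2" "V1 \<inter> V2 = {}"
      and V: "{x \<in> topspace (sd_top D). cov x \<in> U} = V1 \<union> V2"
      and h1: "homeomorphic_map (subtopology (sd_top D) V1) (subtopology ?B U) cov"
      and h2: "homeomorphic_map (subtopology (sd_top D) V2) (subtopology ?B U) cov"
      by (rule double_coveringE[OF dc B])
    have "V1 \<subseteq> carrier G" "V2 \<subseteq> carrier G" using V tp by auto
    then have i: "inj_on cov V1" "inj_on cov V2"
      using homeomorphic_imp_injective_map[OF h1] homeomorphic_imp_injective_map[OF h2] tp by (simp_all add: inf_absorb2)
    have "h1 \<in> V1 \<union> V2" "h2 \<in> V1 \<union> V2" "h3 \<in> V1 \<union> V2" using V h eq U tp by auto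
    then show ?thesis using i eq unfolding inj_on_def by (metis UnE)
  qed
  \<comment> \<open>The slots with first index 0 hold the bit telling whether \<open>h\<close> is
    the chosen representative; the others hold the matrix entries.\<close>
  define e where "e h = (\<lambda>n. case prod_decode n of (a, b) \<Rightarrow>
    if a = 0 then (if h = c h then 1 else 0) else cov h $$ prod_decode b)" for h
  have "inj_on e (carrier G)"
  proof (rule inj_onI)
    fix h k assume h: "h \<in> carrier G" and k: "k \<in> carrier G" and eq: "e h = e k"
    have "cov h = cov k"
    proof (rule eq_matI)
      show "dim_row (cov h) = dim_row (cov k)" "dim_col (cov h) = dim_col (cov k)"
        using cov_carrier[OF h] cov_carrier[OF k] by auto
      fix i l
      show "cov h $$ (i, l) = cov k $$ (i, l)"
        using fun_cong[OF eq, of "prod_encode (1, prod_encode (i, l))"] by (simp add: e_def)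
    qed
    moreover from this have "c h = c k" by (simp add: c_def)
    moreover have "h = c h \<longleftrightarrow> k = c k"
      using fun_cong[OF eq, of "prod_encode (0, 0)"] by (simp add: e_def split: if_splits)
    \<comment> \<open>Two of \<open>c h\<close>, \<open>h\<close> and \<open>k\<close> coincide; if
      the representative is one of them, equality of the bits makes the remaining element equal to
      it as well.\<close>
    ultimately show "h = k" using two[of "c h" h k] c[OF h] h k by metis
  qed
  then show ?thesis by blast
qed

end

theorem theorem2p35:
  fixes D :: "'h spin_data"
  assumes "spin_setup D"
    and "\<exists>i :: real \<Rightarrow> 'a. inj i"
    and "\<exists>i :: real \<Rightarrow> 'p. inj i"
  shows "\<not> (\<exists>\<Sigma>top ::
      (('a, ('p \<times> 'h) set, 'h) spin_mfd, ('a \<Rightarrow> 'a) \<times> (('p \<times> 'h) set \<Rightarrow> ('p \<times> 'h) set),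
       ('a, ('p \<times> complex Matrix.vec) set, complex) vbundle,
       ('a \<Rightarrow> 'a) \<times> (('p \<times> complex Matrix.vec) set \<Rightarrow> ('p \<times> complex Matrix.vec) set)) funct.
    is_functor (SpinMfds D) VB \<Sigma>top \<and>
    funct_eq (RiemSpinMf D) (forget_dirac \<circ>\<^sub>F Sigma_fun D) (\<Sigma>top \<circ>\<^sub>F MetrTop D) \<and>
    funct_eq (SpinMfds D) (pr \<circ>\<^sub>F \<Sigma>top) forget_spin)"
proof -
  interpret spin_context D by unfold_locales (rule assms(1))
  obtain ia :: "real \<Rightarrow> 'a" where ia: "inj ia" using assms(2) by blast
  obtain ip :: "real \<Rightarrow> 'p" where ip: "inj ip" using assms(3) by blast
  obtain e :: "(nat \<Rightarrow> real) \<Rightarrow> real" where e: "inj e" using inj_real_seq by blast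
  obtain c :: "'h \<Rightarrow> nat \<Rightarrow> real" where c: "inj_on c (carrier G)" using group_lepoll_seq by blast
  \<comment> \<open>The point and the sequence coding the group element are interleaved into one
    sequence, which \<open>e\<close> turns into a single real.\<close>
  define j where "j z = ip (e (\<lambda>n. case prod_decode n of (a, b) \<Rightarrow> if a = 0 then fst z b else c (snd z) b))"
    for z :: "(nat \<Rightarrow> real) \<times> 'h"
  have "inj_on j (E m \<times> Spin)"
  proof (rule inj_onI)
    fix z w assume z: "z \<in> E m \<times> Spin" and w: "w \<in> E m \<times> Spin" and "j z = j w"
    then have eq: "(\<lambda>n. case prod_decode n of (a, b) \<Rightarrow> if a = 0 then fst z b else c (snd z) b) =
        (\<lambda>n. case prod_decode n of (a, b) \<Rightarrow> if a = 0 then fst w b else c (snd w) b)"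
      using injD[OF e injD[OF ip]] by (simp add: j_def)
    have "fst z b = fst w b" "c (snd z) b = c (snd w) b" for b
      using fun_cong[OF eq, of "prod_encode (0, b)"] fun_cong[OF eq, of "prod_encode (1, b)"] by simp_all
    then have "fst z = fst w" "c (snd z) = c (snd w)" by auto
    moreover have "snd z \<in> carrier G" "snd w \<in> carrier G" using z w Spin_subset by auto
    ultimately show "z = w" using inj_onD[OF c] by (simp add: prod_eq_iff)
  qed
  moreover have "inj_on (\<lambda>x. ia (e x)) (E m)"
    using injD[OF e injD[OF ia]] by (auto intro: inj_onI)
  ultimately interpret spin_euclid D "\<lambda>x. ia (e x)" j
    by unfold_locales
  show ?thesis using no_topological_spinor_functor by blast
qed

end
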